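(* For any initial datum $q\in L_0^2$, denote by $u(t)$ the unique solution of the KdV equation with $u(0)=q$ and by $e^{tL}q$ the solution of $\partial_tv=Lv$ with $v(0)=q$, where $L=-\partial_x^3$. Then $$\|u(t)-e^{tL}q\|_{\mathcal H^1}\le C(1+|t|)\qquad\text{for all }t\in\mathbb R.$$ The constant $C>0$ can be chosen locally uniformly for $q\in L_0^2$.
   Context: The KdV equation on the circle $\mathbb T=\mathbb R/\mathbb Z$ is $\partial_tu=-\partial_x^3u+6u\,\partial_xu$. $L_0^2$ is the space of real-valued $L^2$ functions on $\mathbb T$ with mean zero and $\mathcal H^1=\mathcal H^1(\mathbb T,\mathbb R)$ the standard Sobolev space. It is known that the KdV equation is globally wellposed in $L_0^2$: the solution map for smooth initial data extends uniquely to a continuous map $q\mapsto u$ from $L_0^2$ to $C([-T,T],L_0^2)$ for every $T>0$, and $u(t)$ denotes the solution given by this map. *)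

theory Defs
  imports "HOL-Analysis.Analysis"
begin

text \<open>
  Functions on the circle \<open>\<real>/\<int>\<close> are represented by 1-periodic functions on \<open>\<real>\<close>, and elements of
  \<open>L\<^sup>2\<close> by such functions up to a.e. equality. Nothing below depends on the choice of
  representatives of \<open>L\<^sup>2\<close> functions.
\<close>

definition periodic1 :: "(real \<Rightarrow> real) \<Rightarrow> bool" where
  "periodic1 f \<longleftrightarrow> (\<forall>x. f (x + 1) = f x)"

definition L2_circle :: "(real \<Rightarrow> real) set" where
  "L2_circle = {f. periodic1 f \<and> f \<in> borel_measurable lebesgue \<and>
                   set_integrable lebesgue {0..1} (\<lambda>x. (f x)\<^sup>2)}"

definition l2norm :: "(real \<Rightarrow> real) \<Rightarrow> real" where
  "l2norm f = sqrt (LINT x:{0..1}|lebesgue. (f x)\<^sup>2)"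

definition L20 :: "(real \<Rightarrow> real) set" where
  "L20 = {f \<in> L2_circle. (LINT x:{0..1}|lebesgue. f x) = 0}"

definition fourier_coeff :: "(real \<Rightarrow> real) \<Rightarrow> int \<Rightarrow> complex" where
  "fourier_coeff f n =
     (LINT x:{0..1}|lebesgue. complex_of_real (f x) * cis (- 2 * pi * of_int n * x))"

text \<open>With the weight \<open>1 + (2\<pi>n)\<^sup>2\<close> the squared \<open>H\<^sup>1\<close> norm is the sum of the squared
  \<open>L\<^sup>2\<close> norms of the function and of its weak derivative.\<close>

definition H1_circle :: "(real \<Rightarrow> real) set" where
  "H1_circle = {f \<in> L2_circle.
     (\<lambda>n::int. (1 + (2 * pi * of_int n)\<^sup>2) * (cmod (fourier_coeff f n))\<^sup>2) summable_on UNIV}"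

definition h1norm :: "(real \<Rightarrow> real) \<Rightarrow> real" where
  "h1norm f =
     sqrt (\<Sum>\<^sub>\<infinity>n::int. (1 + (2 * pi * of_int n)\<^sup>2) * (cmod (fourier_coeff f n))\<^sup>2)"

definition l2_continuous_on :: "real set \<Rightarrow> (real \<Rightarrow> real \<Rightarrow> real) \<Rightarrow> bool" where
  "l2_continuous_on A u \<longleftrightarrow>
     (\<forall>t\<in>A. ((\<lambda>s. l2norm (\<lambda>x. u s x - u t x)) \<longlongrightarrow> 0) (at t within A))"

definition smooth_circle :: "(real \<Rightarrow> real) \<Rightarrow> bool" where
  "smooth_circle f \<longleftrightarrow> periodic1 f \<and> (\<forall>k x. (deriv ^^ k) f differentiable (at x))"

text \<open>Joint smoothness in time and space: \<open>D i j\<close> is the mixed partial derivative of order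
  \<open>i\<close> in \<open>t\<close> and order \<open>j\<close> in \<open>x\<close>.\<close>

definition smooth_time_circle :: "(real \<Rightarrow> real \<Rightarrow> real) \<Rightarrow> bool" where
  "smooth_time_circle u \<longleftrightarrow> (\<forall>t. periodic1 (u t)) \<and>
     (\<exists>D :: nat \<Rightarrow> nat \<Rightarrow> real \<Rightarrow> real \<Rightarrow> real. D 0 0 = u \<and>
        (\<forall>i j. continuous_on UNIV (\<lambda>(t, x). D i j t x) \<and>
           (\<forall>t x. ((\<lambda>s. D i j s x) has_real_derivative D (Suc i) j t x) (at t) \<and>
                  (D i j t has_real_derivative D i (Suc j) t x) (at x))))"

definition classical_kdv_solution ::
    "(real \<Rightarrow> real) \<Rightarrow> (real \<Rightarrow> real \<Rightarrow> real) \<Rightarrow> bool" where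
  "classical_kdv_solution q u \<longleftrightarrow> smooth_time_circle u \<and> u 0 = q \<and>
     (\<forall>t x. deriv (\<lambda>s. u s x) t = - (deriv ^^ 3) (u t) x + 6 * u t x * deriv (u t) x)"

text \<open>\<open>S q t\<close> is the value at time \<open>t\<close> of the solution with initial datum \<open>q\<close>: \<open>S\<close> extends the
  solution map of smooth data to a continuous map from \<open>L20\<close> to \<open>C([-T,T], L20)\<close>, for every
  \<open>T > 0\<close>. Smooth mean-zero data are dense in \<open>L20\<close>, so this determines \<open>S q t\<close>
  up to a.e. equality.\<close>

definition kdv_solution_map ::
    "((real \<Rightarrow> real) \<Rightarrow> real \<Rightarrow> real \<Rightarrow> real) \<Rightarrow> bool" where
  "kdv_solution_map S \<longleftrightarrow>
     (\<forall>q\<in>L20. smooth_circle q \<longrightarrow>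
        (\<exists>u. classical_kdv_solution q u \<and> (\<forall>t. AE x in lebesgue. S q t x = u t x))) \<and>
     (\<forall>T>0.
        (\<forall>q\<in>L20. (\<forall>t\<in>{-T..T}. S q t \<in> L20) \<and> l2_continuous_on {-T..T} (S q)) \<and>
        (\<forall>q\<in>L20. \<forall>\<epsilon>>0. \<exists>\<delta>>0. \<forall>p\<in>L20. l2norm (\<lambda>x. p x - q x) < \<delta> \<longrightarrow>
           (\<forall>t\<in>{-T..T}. l2norm (\<lambda>x. S p t x - S q t x) < \<epsilon>)))"

text \<open>Solutions in \<open>C(\<real>, L\<^sup>2)\<close> of \<open>\<partial>\<^sub>t v = L v\<close> with \<open>L = - \<partial>\<^sub>x\<^sup>3\<close>, in the sense of distributions
  in \<open>x\<close>. The right-hand side below is \<open>\<langle>L v, \<phi>\<rangle> = \<langle>v, \<partial>\<^sub>x\<^sup>3 \<phi>\<rangle>\<close>, as \<open>L\<close> is skew-adjoint.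
  Testing with trigonometric functions shows that \<open>v t\<close> is determined by \<open>q\<close>; it is
  \<open>e\<^bsup>tL\<^esup> q\<close>.\<close>

definition linear_solution :: "(real \<Rightarrow> real) \<Rightarrow> (real \<Rightarrow> real \<Rightarrow> real) \<Rightarrow> bool" where
  "linear_solution q v \<longleftrightarrow>
     (\<forall>t. v t \<in> L2_circle) \<and> l2_continuous_on UNIV v \<and> (AE x in lebesgue. v 0 x = q x) \<and>
     (\<forall>\<phi> t. smooth_circle \<phi> \<longrightarrow>
        ((\<lambda>s. LINT x:{0..1}|lebesgue. v s x * \<phi> x) has_real_derivative
         (LINT x:{0..1}|lebesgue. v t x * (deriv ^^ 3) \<phi> x)) (at t))"

end

theory Submission
  imports Defs
begin

text \<open>
  For smooth data let \<open>c\<^sub>k\<close> be the Fourier coefficients of the solution \<open>u\<close> and \<open>w\<^sub>k\<close> those of \<open>u\<^sup>2\<close>, so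
  that \<open>c\<^sub>k' = i(2\<pi>k)\<^sup>3c\<^sub>k + 6\<pi>ik w\<^sub>k\<close>. Two normal form transformations remove all nonresonant terms; since
  the mean vanishes and \<open>u\<close> is real, the resonances of the cubic terms cancel down to \<open>|c\<^sub>k|\<^sup>2c\<^sub>k/k\<close>. The
  boundary terms are bounded in \<open>H\<^sup>1\<close> by powers of the conserved \<open>L\<^sup>2\<close> norm, and the remaining quartic terms
  by \<open>\<parallel>u\<^sup>2\<parallel>\<close> times such powers, by the Cauchy-Schwarz inequality alone, because the kernels reduce to
  sums of \<open>1/(mn)\<close> with \<open>m\<close>, \<open>n\<close> independent. It remains to bound \<open>\<integral>\<parallel>u\<^sup>2\<parallel>\<^sup>2 dt\<close> by a multiple of \<open>1 + |t|\<close>,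
  and one more normal form, applied to \<open>\<integral>u\<^sup>4\<close>, does this with the same trilinear estimate. Everything is
  carried out for finitely many frequencies, with a truncation error that tends to zero for smooth \<open>u\<close>.
  General data follow by density, as the estimate depends only on the \<open>L\<^sup>2\<close> norm.
\<close>

section \<open>Multilinear estimates for finite sums\<close>

text \<open>Two facts make Cauchy-Schwarz sufficient. The pairwise sums of \<open>x\<close>,
  \<open>a\<close>, \<open>b\<close> add up to \<open>2 * k\<close>, so the weight \<open>k\<close>
  of the H1 norm cancels one factor of the phase and leaves reciprocals of products of two linear
  forms, which determine a triple of given sum. And the coefficients of u^2 are kept as a separate
  sequence \<open>d\<close> that enters every quartic term linearly, so only the time integral of
  its squared l2 norm matters. That integral closes by absorption: the nonresonant part of the l4
  sum is a time derivative plus a pairing of \<open>d\<close> with a trilinear form, and the pairing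
  carries a factor \<open>1 / lam^2\<close>, small enough to move its share of \<open>d\<close> to
  the left-hand side. Cauchy-Schwarz in time then turns a bound linear in \<open>T\<close> for the
  integrated squared forcing into linear growth of the H1 norm. With finitely many frequencies,
  differentiation and reordering of sums are plain algebra. The price is the truncation error, which
  is measured with the weight y^2 because it enters the forcing with a factor \<open>k\<close> and
  the H1 norm adds another.\<close>

definition pairs :: "int set \<Rightarrow> int set \<Rightarrow> int \<Rightarrow> (int \<times> int) set" where
  "pairs A B k = {(x, y). x \<in> A \<and> y \<in> B \<and> x + y = k}"

definition triples :: "int set \<Rightarrow> int \<Rightarrow> (int \<times> int \<times> int) set" where
  "triples B k = {(x, y, z). x \<in> B \<and> y \<in> B \<and> z \<in> B \<and> x + y + z = k}"

definition quads :: "int set \<Rightarrow> (int \<times> int \<times> int \<times> int) set" where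
  "quads B = {(x, y, z, s). x \<in> B \<and> y \<in> B \<and> z \<in> B \<and> s \<in> B \<and> x + y + z + s = 0}"

lemma finite_pairs [simp]: "finite A \<Longrightarrow> finite B \<Longrightarrow> finite (pairs A B k)"
  by (rule finite_subset[of _ "A \<times> B"]) (auto simp: pairs_def)

lemma finite_triples [simp]: "finite B \<Longrightarrow> finite (triples B k)"
  by (rule finite_subset[of _ "B \<times> B \<times> B"]) (auto simp: triples_def)

lemma finite_quads [simp]: "finite B \<Longrightarrow> finite (quads B)"
  by (rule finite_subset[of _ "B \<times> B \<times> B \<times> B"]) (auto simp: quads_def)

text \<open>Three times this is \<open>(x + y + z)^3 - x^3 - y^3 - z^3\<close>, the phase of a cubic
  interaction. The target ring is left open because the same kernel occurs over the reals in the
  estimates and over the complex numbers in the forms.\<close>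

abbreviation ker :: "int \<Rightarrow> int \<Rightarrow> int \<Rightarrow> 'a::ring_1" where
  "ker x y z \<equiv> of_int (x + y) * of_int (y + z) * of_int (x + z)"

definition sqn :: "int set \<Rightarrow> (int \<Rightarrow> complex) \<Rightarrow> real" where
  "sqn B f = (\<Sum>x\<in>B. (cmod (f x))\<^sup>2)"

lemma sqn_nonneg [simp]: "0 \<le> sqn B f"
  by (simp add: sqn_def sum_nonneg)

text \<open>Points of different \<open>P k\<close> are told apart by \<open>\<sigma>\<close>, so no
  point of \<open>U\<close> is counted twice.\<close>

lemma sum_fibres_le:
  fixes h :: "'a \<Rightarrow> real" and P :: "int \<Rightarrow> 'a set"
  assumes "finite K" "finite U" "\<And>k. P k \<subseteq> U" "\<And>k p. p \<in> P k \<Longrightarrow> \<sigma> p = k" "\<And>p. 0 \<le> h p"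
  shows "(\<Sum>k\<in>K. \<Sum>p\<in>P k. h p) \<le> (\<Sum>p\<in>U. h p)"
proof -
  have fin: "finite (P k)" for k
    using assms(2,3) finite_subset by blast
  have "(\<Sum>k\<in>K. \<Sum>p\<in>P k. h p) = (\<Sum>p\<in>(\<Union>k\<in>K. P k). h p)"
    by (rule sum.UNION_disjoint[symmetric]) (use assms fin in blast)+
  also have "\<dots> \<le> (\<Sum>p\<in>U. h p)"
    by (rule sum_mono2) (use assms in blast)+
  finally show ?thesis .
qed

text \<open>The multiplier is spent on each fibre separately, where its squares sum to at most
  \<open>Z\<close> uniformly in \<open>k\<close>; what remains is a sum of squares of
  \<open>g\<close> over disjoint fibres. A multilinear map with such a multiplier therefore costs
  only the l2 norms of its arguments.\<close>

lemma fibre_cauchy_schwarz: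
  fixes g :: "'a \<Rightarrow> real" and P :: "int \<Rightarrow> 'a set"
  assumes "finite K" "finite U" "\<And>k. P k \<subseteq> U" "\<And>k p. p \<in> P k \<Longrightarrow> \<sigma> p = k"
    and Z: "\<And>k. (\<Sum>p\<in>P k. (m k p)\<^sup>2) \<le> Z"
    and A: "\<And>k. cmod (A k) \<le> (\<Sum>p\<in>P k. \<bar>m k p\<bar> * g p)" and "0 \<le> Z"
  shows "sqn K A \<le> Z * (\<Sum>p\<in>U. (g p)\<^sup>2)"
proof -
  have "(cmod (A k))\<^sup>2 \<le> Z * (\<Sum>p\<in>P k. (g p)\<^sup>2)" for k
  proof -
    have "(cmod (A k))\<^sup>2 \<le> (\<Sum>p\<in>P k. \<bar>m k p\<bar> * g p)\<^sup>2"
      using A by (intro power_mono) auto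
    also have "\<dots> \<le> (\<Sum>p\<in>P k. \<bar>m k p\<bar>\<^sup>2) * (\<Sum>p\<in>P k. (g p)\<^sup>2)"
      by (rule Cauchy_Schwarz_ineq_sum)
    also have "\<dots> \<le> Z * (\<Sum>p\<in>P k. (g p)\<^sup>2)"
      unfolding power2_abs by (intro mult_right_mono Z) (auto simp: sum_nonneg)
    finally show ?thesis .
  qed
  then have "sqn K A \<le> (\<Sum>k\<in>K. Z * (\<Sum>p\<in>P k. (g p)\<^sup>2))"
    unfolding sqn_def by (intro sum_mono)
  also have "\<dots> = Z * (\<Sum>k\<in>K. \<Sum>p\<in>P k. (g p)\<^sup>2)"
    by (simp add: sum_distrib_left)
  also have "\<dots> \<le> Z * (\<Sum>p\<in>U. (g p)\<^sup>2)"
    by (intro mult_left_mono sum_fibres_le[where \<sigma> = \<sigma>] assms) auto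
  finally show ?thesis .
qed

text \<open>The two index sets are kept apart because the second argument will also be the
  truncation error, which lives on more frequencies than the first.\<close>

lemma bilinear_estimate:
  fixes A f g :: "int \<Rightarrow> complex"
  assumes "finite K" "finite B" "finite B'"
    and Z: "\<And>k. (\<Sum>(x,y)\<in>pairs B B' k. (m k x y)\<^sup>2) \<le> Z" and "0 \<le> Z"
    and A: "\<And>k. cmod (A k) \<le> (\<Sum>(x,y)\<in>pairs B B' k. \<bar>m k x y\<bar> * (cmod (f x) * cmod (g y)))"
  shows "sqn K A \<le> Z * (sqn B f * sqn B' g)"
proof -
  have "sqn K A \<le> Z * (\<Sum>p\<in>B \<times> B'. (cmod (f (fst p)) * cmod (g (snd p)))\<^sup>2)"
    by (rule fibre_cauchy_schwarz[where P = "pairs B B'" and \<sigma> = "\<lambda>(x,y). x + y"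
        and m = "\<lambda>k p. m k (fst p) (snd p)"])
       (use assms in \<open>auto simp: pairs_def case_prod_unfold\<close>)
  also have "(\<Sum>p\<in>B \<times> B'. (cmod (f (fst p)) * cmod (g (snd p)))\<^sup>2) = sqn B f * sqn B' g"
    by (simp add: sqn_def sum_product sum.cartesian_product case_prod_unfold power_mult_distrib)
  finally show ?thesis .
qed

lemma trilinear_estimate:
  fixes A f g h :: "int \<Rightarrow> complex"
  assumes "finite K" "finite B"
    and Z: "\<And>k. (\<Sum>(x,y,z)\<in>triples B k. (m k x y z)\<^sup>2) \<le> Z" and "0 \<le> Z"
    and A: "\<And>k. cmod (A k) \<le>
      (\<Sum>(x,y,z)\<in>triples B k. \<bar>m k x y z\<bar> * (cmod (f x) * cmod (g y) * cmod (h z)))"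
  shows "sqn K A \<le> Z * (sqn B f * sqn B g * sqn B h)"
proof -
  let ?g = "\<lambda>(x, y, z). cmod (f x) * cmod (g y) * cmod (h z)"
  have "sqn K A \<le> Z * (\<Sum>p\<in>B \<times> B \<times> B. (?g p)\<^sup>2)"
    by (rule fibre_cauchy_schwarz[where P = "triples B" and \<sigma> = "\<lambda>(x,y,z). x + y + z"
        and m = "\<lambda>k p. m k (fst p) (fst (snd p)) (snd (snd p))"])
       (use assms in \<open>auto simp: triples_def case_prod_unfold\<close>)
  also have "(\<Sum>p\<in>B \<times> B \<times> B. (?g p)\<^sup>2)
      = (\<Sum>x\<in>B. \<Sum>y\<in>B. \<Sum>z\<in>B. (cmod (f x))\<^sup>2 * ((cmod (g y))\<^sup>2 * (cmod (h z))\<^sup>2))"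
    by (simp add: sum.cartesian_product case_prod_unfold power_mult_distrib mult.assoc)
  also have "\<dots> = sqn B f * sqn B g * sqn B h"
    unfolding sqn_def mult.assoc
    by (simp only: sum_distrib_left[symmetric] sum_distrib_right[symmetric])
  finally show ?thesis .
qed

section \<open>Sums of reciprocal squares\<close>

lemma sum_inverse_squares_nat_le: "(\<Sum>n=1..N. 1 / (real n)\<^sup>2) \<le> 2"
proof (cases N)
  case (Suc M)
  \<comment> \<open>Subtracting \<open>1 / real (Suc M)\<close> makes the induction
    telescope.\<close>
  have "(\<Sum>n=1..Suc M. 1 / (real n)\<^sup>2) \<le> 2 - 1 / real (Suc M)"
  proof (induction M)
    case (Suc M)
    have "1 / (real (Suc (Suc M)))\<^sup>2 \<le> 1 / real (Suc M) - 1 / real (Suc (Suc M))"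
      by (simp add: divide_simps power2_eq_square)
    then show ?case using Suc by simp
  qed simp
  also have "\<dots> \<le> 2" by simp
  finally show ?thesis using Suc by simp
qed simp

text \<open>Each sign contributes at most 2, and the term at 0 is \<open>1 / 0 = 0\<close>.\<close>

lemma sum_inverse_squares_int_le:
  fixes A :: "int set"
  assumes "finite A"
  shows "(\<Sum>n\<in>A. 1 / (real_of_int n)\<^sup>2) \<le> 4"
proof -
  obtain N :: nat where N: "\<And>n. n \<in> A \<Longrightarrow> \<bar>n\<bar> \<le> int N"
  proof -
    have "\<bar>n\<bar> \<le> int (nat (Max (insert 0 (abs ` A))))" if "n \<in> A" for n
      using assms that by (auto intro!: Max_ge)
    then show ?thesis using that by blast
  qed
  have "(\<Sum>n\<in>A. 1 / (real_of_int n)\<^sup>2) \<le> (\<Sum>n\<in>{- int N..int N}. 1 / (real_of_int n)\<^sup>2)"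
    by (rule sum_mono2) (use N assms in \<open>force simp: abs_le_iff\<close>)+
  also have "{- int N..int N} = (uminus ` int ` {1..N}) \<union> {0} \<union> int ` {1..N}"
  proof (intro set_eqI iffI)
    fix n assume n: "n \<in> {- int N..int N}"
    show "n \<in> uminus ` int ` {1..N} \<union> {0} \<union> int ` {1..N}"
    proof (cases n "0::int" rule: linorder_cases)
      case less
      then have "n = - int (nat (- n))" "nat (- n) \<in> {1..N}" using n by auto
      then show ?thesis by blast
    next
      case greater
      then have "n = int (nat n)" "nat n \<in> {1..N}" using n by auto
      then show ?thesis by blast
    qed simp
  qed auto
  also have "(\<Sum>n\<in>uminus ` int ` {1..N} \<union> {0} \<union> int ` {1..N}. 1 / (real_of_int n)\<^sup>2)
      = (\<Sum>n=1..N. 1 / (real n)\<^sup>2) + (\<Sum>n=1..N. 1 / (real n)\<^sup>2)"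
    by (subst sum.union_disjoint, simp, simp, force)+ (auto simp: sum.reindex inj_on_def)
  also have "\<dots> \<le> 4"
    using sum_inverse_squares_nat_le[of N] by simp
  finally show ?thesis .
qed

text \<open>Independence of the two linear forms, expressed as injectivity, lets the sum be enlarged
  to a product grid, where it factors into two sums of at most 4 each.\<close>

lemma sum_inverse_squares_pair_le:
  fixes \<alpha> \<beta> :: "'a \<Rightarrow> int"
  assumes "finite P" and inj: "inj_on (\<lambda>p. (\<alpha> p, \<beta> p)) P"
  shows "(\<Sum>p\<in>P. (1 / (real_of_int (\<alpha> p) * real_of_int (\<beta> p)))\<^sup>2) \<le> 16"
proof -
  let ?F = "\<lambda>(a, b). (1 / (real_of_int a)\<^sup>2) * (1 / (real_of_int b)\<^sup>2)"
  have "(\<Sum>p\<in>P. (1 / (real_of_int (\<alpha> p) * real_of_int (\<beta> p)))\<^sup>2) =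
      (\<Sum>q\<in>(\<lambda>p. (\<alpha> p, \<beta> p)) ` P. ?F q)"
    by (simp add: sum.reindex[OF inj] power_mult_distrib power_divide)
  also have "\<dots> \<le> (\<Sum>q\<in>\<alpha> ` P \<times> \<beta> ` P. ?F q)"
    by (rule sum_mono2) (use assms in auto)
  also have "\<dots> = (\<Sum>a\<in>\<alpha> ` P. 1 / (real_of_int a)\<^sup>2) * (\<Sum>b\<in>\<beta> ` P. 1 / (real_of_int b)\<^sup>2)"
    by (simp only: sum_product sum.cartesian_product)
  also have "\<dots> \<le> 4 * 4"
    by (intro mult_mono sum_inverse_squares_int_le) (use assms in \<open>auto intro: sum_nonneg\<close>)
  finally show ?thesis by simp
qed

section \<open>Partial fractions for the kernels\<close>

lemma square_sum3_le: "(a + b + c)\<^sup>2 \<le> 3 * (a\<^sup>2 + b\<^sup>2 + c\<^sup>2)" for a b c :: real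
  using zero_le_power2[of "a - b"] zero_le_power2[of "a - c"] zero_le_power2[of "b - c"]
  by (simp add: power2_eq_square algebra_simps)

lemma square_sum4_le: "(a + b + c + d)\<^sup>2 \<le> 4 * (a\<^sup>2 + b\<^sup>2 + c\<^sup>2 + d\<^sup>2)" for a b c d :: real
  using zero_le_power2[of "a - b"] zero_le_power2[of "a - c"] zero_le_power2[of "b - c"]
    zero_le_power2[of "a - d"] zero_le_power2[of "b - d"] zero_le_power2[of "c - d"]
  by (simp add: power2_eq_square algebra_simps)

text \<open>Dividing \<open>A + B + D = 2 * k\<close> by \<open>2 * A * B * D\<close> writes the
  kernel as half a sum of three reciprocal products; squaring gives the constant 3/4 = 3 *
  (1/2)^2.\<close>

lemma kernel_square_le:
  fixes A B D k :: real
  assumes "A + B + D = 2 * k"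
  shows "(k / (A * B * D))\<^sup>2 \<le> 3/4 * ((1 / (B * D))\<^sup>2 + (1 / (A * D))\<^sup>2 + (1 / (A * B))\<^sup>2)"
proof (cases "A * B * D = 0")
  case False
  then have "k / (A * B * D) = (1/2) * (1 / (B * D) + 1 / (A * D) + 1 / (A * B))"
    using assms by (simp add: field_simps)
  then have "(k / (A * B * D))\<^sup>2 = 1/4 * (1 / (B * D) + 1 / (A * D) + 1 / (A * B))\<^sup>2"
    by (simp only: power_mult_distrib) (simp add: power2_eq_square)
  then show ?thesis
    using square_sum3_le[of "1 / (B * D)" "1 / (A * D)" "1 / (A * B)"] by linarith
qed auto

lemma kernel2_square_le:
  fixes x a b k :: real
  assumes k: "k = x + a + b"
  defines "A \<equiv> x + a" and "B \<equiv> a + b" and "D \<equiv> x + b"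
  shows "(k * a / (x * (A * B * D)))\<^sup>2 \<le>
    4 * ((1 / (D * x))\<^sup>2 + (1 / (A * D))\<^sup>2 + (1 / (B * D))\<^sup>2 + (1 / (A * B))\<^sup>2)"
proof (cases "x * (A * B * D) = 0")
  case False
  then have nz: "x \<noteq> 0" "A \<noteq> 0" "B \<noteq> 0" "D \<noteq> 0" by auto
  have "k * a / (x * (A * B * D)) =
      1 / (D * x) + - (1/2) * (1 / (A * D)) + 1/2 * (1 / (B * D)) + - (1/2) * (1 / (A * B))"
  proof -
    \<comment> \<open>Each term on the right is a multiple of a product of two of the four factors
      \<open>x\<close>, \<open>A\<close>, \<open>B\<close>, \<open>D\<close>, so division by
      \<open>2 * x * A * B * D\<close> leaves only reciprocals of two-factor products.\<close>
    have "2 * (k * a) = 2 * (A * B) - x * B + x * A - x * D"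
      unfolding k A_def B_def D_def by (simp add: algebra_simps)
    then show ?thesis
      using nz by (simp add: divide_simps) (simp add: algebra_simps)
  qed
  also have "\<dots>\<^sup>2 \<le> 4 * ((1 / (D * x))\<^sup>2 + (- (1/2) * (1 / (A * D)))\<^sup>2 + (1/2 * (1 / (B * D)))\<^sup>2
      + (- (1/2) * (1 / (A * B)))\<^sup>2)"
    by (rule square_sum4_le)
  also have "\<dots> \<le> 4 * ((1 / (D * x))\<^sup>2 + (1 / (A * D))\<^sup>2 + (1 / (B * D))\<^sup>2 + (1 / (A * B))\<^sup>2)"
    unfolding power_mult_distrib
    by (intro mult_left_mono add_mono mult_left_le_one_le order_refl) (auto simp: power2_eq_square)
  finally show ?thesis .
qed auto

text \<open>Any two of the pairwise sums, together with the total \<open>k\<close>, determine the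
  triple. So each of the three sums is at most 16, and 36 = 3/4 * 48.\<close>

lemma sum_triples_kernel_le:
  assumes "finite B"
  shows "(\<Sum>(x,a,b)\<in>triples B k. (of_int k / ker x a b)\<^sup>2) \<le> (36::real)"
proof -
  let ?T = "triples B k" and ?q = "\<lambda>m n. (1 / (real_of_int m * of_int n))\<^sup>2"
  have "(\<Sum>(x,a,b)\<in>?T. (of_int k / ker x a b)\<^sup>2) \<le>
     (\<Sum>(x,a,b)\<in>?T. 3/4 * (?q (a + b) (x + b) + ?q (x + a) (x + b) + ?q (x + a) (a + b)))"
  proof (intro sum_mono, clarify)
    fix x a b assume "(x, a, b) \<in> ?T"
    then have "real_of_int (x + a) + of_int (a + b) + of_int (x + b) = 2 * of_int k"
      by (auto simp: triples_def)
    from kernel_square_le[OF this]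
    show "(of_int k / ker x a b)\<^sup>2 \<le>
      3/4 * (?q (a + b) (x + b) + ?q (x + a) (x + b) + ?q (x + a) (a + b))" .
  qed
  also have "\<dots> = 3/4 * ((\<Sum>(x,a,b)\<in>?T. ?q (a + b) (x + b)) + (\<Sum>(x,a,b)\<in>?T. ?q (x + a) (x + b))
        + (\<Sum>(x,a,b)\<in>?T. ?q (x + a) (a + b)))"
    by (simp only: case_prod_unfold sum_distrib_left[symmetric] sum.distrib)
  also have "\<dots> \<le> 3/4 * (16 + 16 + 16)"
    unfolding case_prod_unfold
    by (intro mult_left_mono add_mono sum_inverse_squares_pair_le finite_triples assms)
       (auto simp: inj_on_def triples_def)
  finally show ?thesis by simp
qed

text \<open>The additional factor \<open>a / x\<close> is also dissolved by partial fractions; now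
  four pairs of independent forms occur, and 256 = 4 * 64.\<close>

lemma sum_triples_kernel2_le:
  assumes "finite B"
  shows "(\<Sum>(x,a,b)\<in>triples B k. (of_int k * of_int a / (of_int x * ker x a b))\<^sup>2) \<le> (256::real)"
proof -
  let ?T = "triples B k" and ?q = "\<lambda>m n. (1 / (real_of_int m * of_int n))\<^sup>2"
  have "(\<Sum>(x,a,b)\<in>?T. (of_int k * of_int a / (of_int x * ker x a b))\<^sup>2) \<le>
     (\<Sum>(x,a,b)\<in>?T. 4 * (?q (x + b) x + ?q (x + a) (x + b) + ?q (a + b) (x + b) + ?q (x + a) (a + b)))"
  proof (intro sum_mono, clarify)
    fix x a b assume "(x, a, b) \<in> ?T"
    then have "real_of_int k = of_int x + of_int a + of_int b" by (auto simp: triples_def)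
    from kernel2_square_le[OF this]
    show "(of_int k * of_int a / (of_int x * ker x a b))\<^sup>2 \<le>
      4 * (?q (x + b) x + ?q (x + a) (x + b) + ?q (a + b) (x + b) + ?q (x + a) (a + b))"
      unfolding of_int_add .
  qed
  also have "\<dots> = 4 * ((\<Sum>(x,a,b)\<in>?T. ?q (x + b) x) + (\<Sum>(x,a,b)\<in>?T. ?q (x + a) (x + b))
        + (\<Sum>(x,a,b)\<in>?T. ?q (a + b) (x + b)) + (\<Sum>(x,a,b)\<in>?T. ?q (x + a) (a + b)))"
    by (simp only: case_prod_unfold sum_distrib_left[symmetric] sum.distrib)
  also have "\<dots> \<le> 4 * (16 + 16 + 16 + 16)"
    unfolding case_prod_unfold
    by (intro mult_left_mono add_mono sum_inverse_squares_pair_le finite_triples assms)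
       (auto simp: inj_on_def triples_def)
  finally show ?thesis by simp
qed

text \<open>The kernel is \<open>1 / x + 1 / y\<close>, and one coordinate of a pair of given sum
  determines the other; the constant is 2 * (4 + 4).\<close>

lemma sum_pairs_kernel_le:
  assumes "finite B" "finite B'"  "0 \<notin> B" "0 \<notin> B'"
  shows "(\<Sum>(x,y)\<in>pairs B B' k. (of_int k / (of_int x * of_int y))\<^sup>2) \<le> (16::real)"
proof -
  let ?T = "pairs B B' k"
  have "(\<Sum>(x,y)\<in>?T. (of_int k / (of_int x * of_int y))\<^sup>2) \<le>
     (\<Sum>(x,y)\<in>?T. 2 * (1 / (real_of_int x)\<^sup>2 + 1 / (real_of_int y)\<^sup>2))"
  proof (intro sum_mono, clarify)
    fix x y assume "(x, y) \<in> ?T"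
    then have nz: "x \<noteq> 0" "y \<noteq> 0" and k: "k = x + y" using assms by (auto simp: pairs_def)
    have "of_int k / (of_int x * of_int y) = 1 / real_of_int x + 1 / real_of_int y"
      using nz by (simp add: k field_simps)
    moreover have "(a + b)\<^sup>2 \<le> 2 * (a\<^sup>2 + b\<^sup>2)" for a b :: real
      using zero_le_power2[of "a - b"] by (simp add: power2_eq_square algebra_simps)
    ultimately show "(of_int k / (of_int x * of_int y))\<^sup>2 \<le>
        2 * (1 / (real_of_int x)\<^sup>2 + 1 / (real_of_int y)\<^sup>2)"
      by (metis power_one_over)
  qed
  also have "\<dots> = 2 * ((\<Sum>p\<in>?T. 1 / (real_of_int (fst p))\<^sup>2) + (\<Sum>p\<in>?T. 1 / (real_of_int (snd p))\<^sup>2))"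
    by (simp only: case_prod_unfold sum_distrib_left[symmetric] sum.distrib)
  also have "(\<Sum>p\<in>?T. 1 / (real_of_int (fst p))\<^sup>2) = (\<Sum>n\<in>fst ` ?T. 1 / (real_of_int n)\<^sup>2)"
    by (subst sum.reindex) (auto simp: inj_on_def pairs_def)
  also have "(\<Sum>p\<in>?T. 1 / (real_of_int (snd p))\<^sup>2) = (\<Sum>n\<in>snd ` ?T. 1 / (real_of_int n)\<^sup>2)"
    by (subst sum.reindex) (auto simp: inj_on_def pairs_def)
  also have "2 * ((\<Sum>n\<in>fst ` ?T. 1 / (real_of_int n)\<^sup>2) + (\<Sum>n\<in>snd ` ?T. 1 / (real_of_int n)\<^sup>2))
      \<le> 2 * (4 + 4)"
    by (intro mult_left_mono add_mono sum_inverse_squares_int_le) (use assms in auto)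
  finally show ?thesis by simp
qed

section \<open>Normal forms for the truncated system\<close>

definition conv :: "int set \<Rightarrow> (int \<Rightarrow> complex) \<Rightarrow> int \<Rightarrow> complex" where
  "conv B c k = (\<Sum>(x, y)\<in>pairs B B k. c x * c y)"

text \<open>The correction of the first normal form. The interaction \<open>k * c x * c y\<close>
  has the phase \<open>k^3 - x^3 - y^3 = 3 * k * x * y\<close>; dividing by it cancels the
  derivative \<open>k\<close> and leaves \<open>1 / (x * y)\<close>.\<close>

definition quadratic_form :: "int set \<Rightarrow> (int \<Rightarrow> complex) \<Rightarrow> int \<Rightarrow> complex" where
  "quadratic_form B c k = (\<Sum>(x, y)\<in>pairs B B k. c x * c y / (of_int x * of_int y))"

text \<open>The resonant terms drop out of the forms below: there \<open>(x + a)(a + b)(x + b) = 0\<close>, and division by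
  zero gives zero.\<close>

definition cubic_form :: "int set \<Rightarrow> (int \<Rightarrow> complex) \<Rightarrow> int \<Rightarrow> complex" where
  "cubic_form B c k = (\<Sum>(x, a, b)\<in>triples B k.
     c x * c a * c b / (of_int x * ker x a b))"

text \<open>On \<open>x + y + z + s = 0\<close> the four cubes add up to
  \<open>- 3 * ker x y z\<close>. So this is the nonresonant part of the Fourier expansion of the
  integral of u^4, each term divided by its phase up to a constant.\<close>

definition quartic_form :: "int set \<Rightarrow> (int \<Rightarrow> complex) \<Rightarrow> complex" where
  "quartic_form B c = (\<Sum>(x, y, z, s)\<in>quads B.
     c x * c y * c z * c s / ker x y z)"

text \<open>Arises from \<open>cubic_form\<close> when the time derivative falls on the factor with
  \<open>x\<close> in the denominator: the nonlinear part of the equation brings a factor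
  \<open>x\<close> that cancels it. The arguments are separate because one of them becomes
  \<open>d\<close>.\<close>

definition trilinear_form ::
    "int set \<Rightarrow> (int \<Rightarrow> complex) \<Rightarrow> (int \<Rightarrow> complex) \<Rightarrow> (int \<Rightarrow> complex) \<Rightarrow> int \<Rightarrow> complex" where
  "trilinear_form B f g h k = (\<Sum>(x, a, b)\<in>triples B k.
     f x * g a * h b / ker x a b)"

text \<open>Here the time derivative falls on another factor, so \<open>1 / x\<close> survives and
  the new factor \<open>a\<close> stays in the numerator.\<close>

definition trilinear_form' :: "int set \<Rightarrow> (int \<Rightarrow> complex) \<Rightarrow> (int \<Rightarrow> complex) \<Rightarrow> int \<Rightarrow> complex" where
  "trilinear_form' B c d k = (\<Sum>(x, a, b)\<in>triples B k.
     of_int a * c x * d a * c b / (of_int x * ker x a b))"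

text \<open>The cubic terms left by the first normal form once the triples with a vanishing pairwise
  sum are set aside. Dividing each of them by its phase leads to \<open>cubic_form\<close>.\<close>

definition nonresonant :: "int set \<Rightarrow> (int \<Rightarrow> complex) \<Rightarrow> int \<Rightarrow> complex" where
  "nonresonant B c k = (\<Sum>(x, a, b)\<in>triples B k.
     if (x + a) * (a + b) * (x + b) = 0 then 0 else c x * c a * c b / of_int x)"

text \<open>The square of a function with frequencies in \<open>B\<close> has its frequencies here,
  apart from its mean. The mean does not act on the dynamics, since the nonlinearity is a
  derivative.\<close>

definition sumset :: "int set \<Rightarrow> int set" where
  "sumset B = B \<union> ((\<lambda>(x, y). x + y) ` (B \<times> B) - {0})"

lemma finite_sumset [simp]: "finite B \<Longrightarrow> finite (sumset B)"
  by (simp add: sumset_def)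

lemma zero_notin_sumset [simp]: "0 \<notin> B \<Longrightarrow> 0 \<notin> sumset B"
  by (simp add: sumset_def)

lemma sumset_subset: "B \<subseteq> sumset B"
  by (simp add: sumset_def)

lemma add_in_sumset: "x \<in> B \<Longrightarrow> y \<in> B \<Longrightarrow> x + y \<noteq> 0 \<Longrightarrow> x + y \<in> sumset B"
  by (force simp: sumset_def)

text \<open>Symmetry under negation serves the reality of u and the cancellation of resonances,
  where an odd function is summed over \<open>B\<close>.\<close>

locale frequencies =
  fixes B :: "int set"
  assumes fin [simp]: "finite B" and zero [simp]: "0 \<notin> B"
    and uminus_B [simp]: "\<And>x. x \<in> B \<Longrightarrow> - x \<in> B"
begin

lemma uminus_B_iff [simp]: "- x \<in> B \<longleftrightarrow> x \<in> B"
  using uminus_B[of x] uminus_B[of "- x"] by auto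

text \<open>Singling out \<open>s\<close> turns a quartic sum into the pairing of a sequence with a
  trilinear form at \<open>- s\<close>, which brings the trilinear bounds to bear on quartic
  sums.\<close>

lemma sum_quads:
  "(\<Sum>(x, y, z, s)\<in>quads B. F x y z s) = (\<Sum>s\<in>B. \<Sum>(x, y, z)\<in>triples B (- s). F x y z s)"
  for F :: "int \<Rightarrow> int \<Rightarrow> int \<Rightarrow> int \<Rightarrow> complex"
  unfolding case_prod_unfold
  by (subst sum.Sigma, simp, simp,
      rule sum.reindex_bij_witness[of _ "\<lambda>(s, x, y, z). (x, y, z, s)" "\<lambda>(x, y, z, s). (s, x, y, z)"])
     (auto simp: quads_def triples_def)

text \<open>The weight \<open>k\<close> is the derivative of the H1 norm: the kernel gains a full
  derivative over its three l2 arguments.\<close>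

lemma trilinear_form_bound:
  assumes "finite K"
  shows "sqn K (\<lambda>k. of_int k * trilinear_form B f g h k) \<le> 36 * (sqn B f * sqn B g * sqn B h)"
proof (rule trilinear_estimate[OF assms fin sum_triples_kernel_le[OF fin]])
  show "cmod (of_int k * trilinear_form B f g h k) \<le> (\<Sum>(x, y, z)\<in>triples B k.
      \<bar>of_int k / ker x y z\<bar> * (cmod (f x) * cmod (g y) * cmod (h z)))" for k
    unfolding trilinear_form_def sum_distrib_left case_prod_unfold
    by (rule order_trans[OF norm_sum], rule sum_mono)
       (auto simp: norm_mult norm_divide abs_mult abs_divide simp flip: of_int_add)
qed simp

lemma trilinear_form'_bound:
  assumes "finite K"
  shows "sqn K (\<lambda>k. of_int k * trilinear_form' B c d k) \<le> 256 * (sqn B c * sqn B d * sqn B c)"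
proof (rule trilinear_estimate[OF assms fin sum_triples_kernel2_le[OF fin]])
  show "cmod (of_int k * trilinear_form' B c d k) \<le> (\<Sum>(x, a, b)\<in>triples B k.
      \<bar>of_int k * of_int a / (of_int x * ker x a b)\<bar> * (cmod (c x) * cmod (d a) * cmod (c b)))" for k
    unfolding trilinear_form'_def sum_distrib_left case_prod_unfold
    by (rule order_trans[OF norm_sum], rule sum_mono)
       (auto simp: norm_mult norm_divide abs_mult abs_divide simp flip: of_int_add)
qed simp

lemma sqn_divide_le: "sqn B (\<lambda>x. c x / of_int x) \<le> sqn B c"
  unfolding sqn_def
proof (rule sum_mono)
  fix x assume "x \<in> B"
  then have "x \<noteq> 0" using zero by metis
  then have "1 \<le> \<bar>real_of_int x\<bar>" by linarith
  then have "cmod (c x / of_int x) \<le> cmod (c x)"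
    by (simp add: norm_divide divide_le_eq mult_le_cancel_left1)
  then show "(cmod (c x / of_int x))\<^sup>2 \<le> (cmod (c x))\<^sup>2" by (intro power_mono) auto
qed

lemma cubic_form_bound:
  assumes "finite K"
  shows "sqn K (\<lambda>k. of_int k * cubic_form B c k) \<le> 36 * (sqn B c * sqn B c * sqn B c)"
proof -
  have "cubic_form B c k = trilinear_form B (\<lambda>x. c x / of_int x) c c k" for k
    unfolding cubic_form_def trilinear_form_def
    by (rule sum.cong) auto
  then have "sqn K (\<lambda>k. of_int k * cubic_form B c k) \<le>
      36 * (sqn B (\<lambda>x. c x / of_int x) * sqn B c * sqn B c)"
    using trilinear_form_bound[OF assms, of "\<lambda>x. c x / of_int x" c c] by simp
  also have "sqn B (\<lambda>x. c x / of_int x) \<le> sqn B c" by (rule sqn_divide_le)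
  finally show ?thesis by (simp add: mult_right_mono)
qed

lemma bilinear_bound:
  assumes "finite K" "finite B'" "0 \<notin> B'"
  shows "sqn K (\<lambda>k. of_int k * (\<Sum>(x, y)\<in>pairs B B' k. c x * f y / (of_int x * of_int y)))
    \<le> 16 * (sqn B c * sqn B' f)"
proof (rule bilinear_estimate[OF assms(1) fin assms(2) sum_pairs_kernel_le])
  show "cmod (of_int k * (\<Sum>(x, y)\<in>pairs B B' k. c x * f y / (of_int x * of_int y))) \<le>
     (\<Sum>(x, y)\<in>pairs B B' k. \<bar>of_int k / (of_int x * of_int y)\<bar> * (cmod (c x) * cmod (f y)))" for k
    unfolding sum_distrib_left case_prod_unfold
    by (rule order_trans[OF norm_sum], rule sum_mono)
       (auto simp: norm_mult norm_divide abs_mult abs_divide)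
qed (use assms in auto)

text \<open>Here \<open>c'\<close> is only the right-hand side of the equation, and the claim is an
  algebraic identity. Since \<open>x^3 + y^3 = k^3 - 3 * k * x * y\<close>, the linear part
  reproduces the form with the phase of \<open>k\<close> and releases a multiple of
  \<open>k * conv B c k\<close>, the very term to be removed from the equation.\<close>

lemma quadratic_form_algebra:
  fixes c c' d :: "int \<Rightarrow> complex" and lam :: complex
  assumes c': "\<And>x. x \<in> B \<Longrightarrow> c' x = \<i> * lam^3 * of_int x^3 * c x + 3 * \<i> * lam * of_int x * d x"
  shows "(\<Sum>(x, y)\<in>pairs B B k. (c' x * c y + c x * c' y) / (of_int x * of_int y)) =
    \<i> * lam^3 * of_int k^3 * quadratic_form B c k - 3 * \<i> * lam^3 * of_int k * conv B c k
    + 6 * \<i> * lam * (\<Sum>(x, y)\<in>pairs B B k. c x * d y / of_int x)"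
proof -
  have "(\<Sum>(x, y)\<in>pairs B B k. (c' x * c y + c x * c' y) / (of_int x * of_int y)) =
    (\<Sum>(x, y)\<in>pairs B B k. \<i> * lam^3 * of_int k^3 * (c x * c y / (of_int x * of_int y))
      - 3 * \<i> * lam^3 * of_int k * (c x * c y)
      + 3 * \<i> * lam * (d x * c y / of_int y) + 3 * \<i> * lam * (c x * d y / of_int x))"
  proof (rule sum.cong[OF refl], clarify)
    fix x y assume "(x, y) \<in> pairs B B k"
    then have B: "x \<in> B" "y \<in> B" and k: "k = x + y" by (auto simp: pairs_def)
    then have nz: "x \<noteq> 0" "y \<noteq> 0" using zero by metis+
    show "(c' x * c y + c x * c' y) / (of_int x * of_int y) =
      \<i> * lam^3 * of_int k^3 * (c x * c y / (of_int x * of_int y))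
      - 3 * \<i> * lam^3 * of_int k * (c x * c y)
      + 3 * \<i> * lam * (d x * c y / of_int y) + 3 * \<i> * lam * (c x * d y / of_int x)"
      using nz unfolding c'[OF B(1)] c'[OF B(2)] k
      by (simp add: field_simps) (simp add: power3_eq_cube algebra_simps)
  qed
  also have "\<dots> = \<i> * lam^3 * of_int k^3 * quadratic_form B c k - 3 * \<i> * lam^3 * of_int k * conv B c k
      + 3 * \<i> * lam * (\<Sum>(x, y)\<in>pairs B B k. d x * c y / of_int y)
      + 3 * \<i> * lam * (\<Sum>(x, y)\<in>pairs B B k. c x * d y / of_int x)"
    unfolding quadratic_form_def conv_def sum_distrib_left case_prod_unfold
    by (simp only: sum.distrib sum_subtractf)
  also have "(\<Sum>(x, y)\<in>pairs B B k. d x * c y / of_int y) = (\<Sum>(x, y)\<in>pairs B B k. c x * d y / of_int x)"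
    by (rule sum.reindex_bij_witness[of _ prod.swap prod.swap]) (auto simp: pairs_def)
  finally show ?thesis by simp
qed

text \<open>The same mechanism one degree higher:
  \<open>x^3 + a^3 + b^3 = k^3 - 3 * ker x a b\<close> releases the nonresonant cubic sum. The
  factors with \<open>a\<close> and \<open>b\<close> contribute equally by symmetry, hence the
  2.\<close>

lemma cubic_form_algebra:
  fixes c c' d :: "int \<Rightarrow> complex" and lam :: complex
  assumes c': "\<And>x. x \<in> B \<Longrightarrow> c' x = \<i> * lam^3 * of_int x^3 * c x + 3 * \<i> * lam * of_int x * d x"
  shows "(\<Sum>(x, a, b)\<in>triples B k. (c' x * c a * c b + c x * c' a * c b + c x * c a * c' b)
      / (of_int x * ker x a b)) =
    \<i> * lam^3 * of_int k^3 * cubic_form B c k - 3 * \<i> * lam^3 * nonresonant B c k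
    + 3 * \<i> * lam * (trilinear_form B d c c k + 2 * trilinear_form' B c d k)"
    (is "(\<Sum>(x, a, b)\<in>_. ?l x a b) = _")
proof -
  let ?G = "\<lambda>x a b. of_int a * c x * d a * c b / (of_int x * ker x a b)"
  let ?r = "\<lambda>x a b. \<i> * lam^3 * of_int k^3 * (c x * c a * c b / (of_int x * ker x a b))
      - 3 * \<i> * lam^3 * (if (x + a) * (a + b) * (x + b) = 0 then 0 else c x * c a * c b / of_int x)
      + 3 * \<i> * lam * (d x * c a * c b / ker x a b) + 3 * \<i> * lam * ?G x a b + 3 * \<i> * lam * ?G x b a"
  have "(\<Sum>(x, a, b)\<in>triples B k. ?l x a b) = (\<Sum>(x, a, b)\<in>triples B k. ?r x a b)"
  proof (rule sum.cong[OF refl], clarify)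
    fix x a b assume "(x, a, b) \<in> triples B k"
    then have B: "x \<in> B" "a \<in> B" "b \<in> B" and k: "k = x + a + b" by (auto simp: triples_def)
    then have nz: "x \<noteq> 0" using zero by metis
    define M where "M = (ker x a b :: complex)"
    have M': "ker x b a = M" unfolding M_def by (simp add: algebra_simps)
    have M0: "(x + a) * (a + b) * (x + b) = 0 \<longleftrightarrow> M = 0"
      unfolding M_def by (simp flip: of_int_add)
    have k3: "of_int k^3 = (of_int x^3 + of_int a^3 + of_int b^3 + 3 * M :: complex)"
      unfolding M_def k by (simp add: power3_eq_cube algebra_simps)
    show "?l x a b = ?r x a b"
      unfolding M0 M' M_def[symmetric]
    proof (cases "M = 0")
      case False
      then show "(c' x * c a * c b + c x * c' a * c b + c x * c a * c' b) / (of_int x * M) =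
        \<i> * lam^3 * of_int k^3 * (c x * c a * c b / (of_int x * M))
        - 3 * \<i> * lam^3 * (if M = 0 then 0 else c x * c a * c b / of_int x)
        + 3 * \<i> * lam * (d x * c a * c b / M)
        + 3 * \<i> * lam * (of_int a * c x * d a * c b / (of_int x * M))
        + 3 * \<i> * lam * (of_int b * c x * d b * c a / (of_int x * M))"
        using nz unfolding c'[OF B(1)] c'[OF B(2)] c'[OF B(3)] k3
        by (simp add: field_simps)
    qed simp
  qed
  also have "\<dots> = \<i> * lam^3 * of_int k^3 * cubic_form B c k - 3 * \<i> * lam^3 * nonresonant B c k
      + 3 * \<i> * lam * trilinear_form B d c c k + 3 * \<i> * lam * trilinear_form' B c d k
      + 3 * \<i> * lam * (\<Sum>(x, a, b)\<in>triples B k. ?G x b a)"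
    unfolding cubic_form_def nonresonant_def trilinear_form_def trilinear_form'_def
      sum_distrib_left case_prod_unfold
    by (simp only: sum.distrib sum_subtractf)
  also have "(\<Sum>(x, a, b)\<in>triples B k. ?G x b a) = trilinear_form' B c d k"
    unfolding trilinear_form'_def
    by (rule sum.reindex_bij_witness[of _ "\<lambda>(x, a, b). (x, b, a)" "\<lambda>(x, a, b). (x, b, a)"])
       (auto simp: triples_def)
  finally show ?thesis by (simp add: algebra_simps)
qed

text \<open>Since the frequencies add up to 0, the four cubes leave only
  \<open>- 3 * ker x y z\<close>, which cancels the kernel. The four positions of \<open>d\<close>
  are exchanged by symmetry, hence 12 = 4 * 3, and the factor \<open>s\<close> beside
  \<open>d s\<close> is exactly the weight that \<open>trilinear_form_bound\<close> allows.\<close>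

lemma quartic_form_algebra:
  fixes c c' d :: "int \<Rightarrow> complex" and lam :: complex
  assumes c': "\<And>x. x \<in> B \<Longrightarrow> c' x = \<i> * lam^3 * of_int x^3 * c x + 3 * \<i> * lam * of_int x * d x"
  shows "(\<Sum>(x, y, z, s)\<in>quads B. (c' x * c y * c z * c s + c x * c' y * c z * c s
      + c x * c y * c' z * c s + c x * c y * c z * c' s) / ker x y z)
    = - 3 * \<i> * lam^3 * (\<Sum>(x, y, z, s)\<in>quads B.
        if (x + y) * (y + z) * (x + z) = 0 then 0 else c x * c y * c z * c s)
      + 12 * \<i> * lam * (\<Sum>s\<in>B. d s * (of_int s * trilinear_form B c c c (- s)))"
    (is "(\<Sum>(x, y, z, s)\<in>_. ?l x y z s) = - 3 * \<i> * lam^3 * (\<Sum>(x, y, z, s)\<in>_. ?N x y z s) + _")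
proof -
  let ?G = "\<lambda>x y z s. of_int s * d s * c x * c y * c z / ker x y z"
  let ?r = "\<lambda>x y z s. - 3 * \<i> * lam^3 * ?N x y z s + 3 * \<i> * lam * ?G s y z x
      + 3 * \<i> * lam * ?G x s z y + 3 * \<i> * lam * ?G x y s z + 3 * \<i> * lam * ?G x y z s"
  have "(\<Sum>(x, y, z, s)\<in>quads B. ?l x y z s) = (\<Sum>(x, y, z, s)\<in>quads B. ?r x y z s)"
  proof (rule sum.cong[OF refl], clarify)
    fix x y z s assume "(x, y, z, s) \<in> quads B"
    then have B: "x \<in> B" "y \<in> B" "z \<in> B" "s \<in> B" and s: "s = - (x + y + z)" by (auto simp: quads_def)
    define M where "M = (ker x y z :: complex)"
    \<comment> \<open>On \<open>x + y + z + s = 0\<close> the kernel is symmetric in all four variables.\<close>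
    have symm: "ker s y z = M" "ker x s z = M" "ker x y s = M"
      unfolding s M_def by (simp_all add: algebra_simps)
    have M0: "(x + y) * (y + z) * (x + z) = 0 \<longleftrightarrow> M = 0"
      unfolding M_def by (simp flip: of_int_add)
    have s3: "of_int s^3 = (- (of_int x^3) - of_int y^3 - of_int z^3 - 3 * M :: complex)"
      unfolding M_def s by (simp add: power3_eq_cube algebra_simps)
    show "?l x y z s = ?r x y z s"
      unfolding M0 symm M_def[symmetric]
    proof (cases "M = 0")
      case False
      then show "(c' x * c y * c z * c s + c x * c' y * c z * c s
        + c x * c y * c' z * c s + c x * c y * c z * c' s) / M =
        - 3 * \<i> * lam^3 * (if M = 0 then 0 else c x * c y * c z * c s)
        + 3 * \<i> * lam * (of_int x * d x * c s * c y * c z / M)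
        + 3 * \<i> * lam * (of_int y * d y * c x * c s * c z / M)
        + 3 * \<i> * lam * (of_int z * d z * c x * c y * c s / M)
        + 3 * \<i> * lam * (of_int s * d s * c x * c y * c z / M)"
        unfolding c'[OF B(1)] c'[OF B(2)] c'[OF B(3)] c'[OF B(4)] s3
        by (simp add: field_simps)
    qed simp
  qed
  also have "\<dots> = - 3 * \<i> * lam^3 * (\<Sum>(x, y, z, s)\<in>quads B. ?N x y z s)
      + 3 * \<i> * lam * (\<Sum>(x, y, z, s)\<in>quads B. ?G s y z x)
      + 3 * \<i> * lam * (\<Sum>(x, y, z, s)\<in>quads B. ?G x s z y)
      + 3 * \<i> * lam * (\<Sum>(x, y, z, s)\<in>quads B. ?G x y s z)
      + 3 * \<i> * lam * (\<Sum>(x, y, z, s)\<in>quads B. ?G x y z s)"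
    unfolding sum_distrib_left case_prod_unfold by (simp only: sum.distrib)
  also have "(\<Sum>(x, y, z, s)\<in>quads B. ?G s y z x) = (\<Sum>(x, y, z, s)\<in>quads B. ?G x y z s)"
    by (rule sum.reindex_bij_witness[of _ "\<lambda>(x, y, z, s). (s, y, z, x)" "\<lambda>(x, y, z, s). (s, y, z, x)"])
       (auto simp: quads_def)
  also have "(\<Sum>(x, y, z, s)\<in>quads B. ?G x s z y) = (\<Sum>(x, y, z, s)\<in>quads B. ?G x y z s)"
    by (rule sum.reindex_bij_witness[of _ "\<lambda>(x, y, z, s). (x, s, z, y)" "\<lambda>(x, y, z, s). (x, s, z, y)"])
       (auto simp: quads_def)
  also have "(\<Sum>(x, y, z, s)\<in>quads B. ?G x y s z) = (\<Sum>(x, y, z, s)\<in>quads B. ?G x y z s)"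
    by (rule sum.reindex_bij_witness[of _ "\<lambda>(x, y, z, s). (x, y, s, z)" "\<lambda>(x, y, z, s). (x, y, s, z)"])
       (auto simp: quads_def)
  also have "(\<Sum>(x, y, z, s)\<in>quads B. ?G x y z s) =
      (\<Sum>s\<in>B. d s * (of_int s * trilinear_form B c c c (- s)))"
    unfolding sum_quads unfolding trilinear_form_def sum_distrib_left case_prod_unfold
    by (intro sum.cong refl) (simp add: ac_simps)
  finally show ?thesis by (simp add: algebra_simps)
qed

text \<open>The resonances \<open>x + a = 0\<close> and \<open>x + b = 0\<close> each leave
  \<open>c k\<close> times a sum of the odd function \<open>c x * c (- x) / x\<close>. Over all of
  \<open>B\<close> that sum vanishes, so only the excluded term at \<open>x = k\<close> counts. It
  is subtracted twice, and one copy is returned by the triple where both resonances meet.\<close>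

lemma nonresonant_decomposition:
  fixes c d e :: "int \<Rightarrow> complex"
  assumes k: "k \<in> B"
    and e: "\<And>y. y \<in> sumset B \<Longrightarrow> conv B c y + e y = (if y \<in> B then d y else 0)"
  shows "(\<Sum>(x, y)\<in>pairs B B k. c x * d y / of_int x) =
    (\<Sum>(x, y)\<in>pairs B (sumset B) k. c x * e y / of_int x)
    - c k * c (- k) * c k / of_int k + nonresonant B c k"
proof -
  let ?F = "\<lambda>x a b. c x * c a * c b / of_int x"
  define g where "g x = c x * c (- x) / of_int x" for x :: int
  have k0: "k \<noteq> 0" using k zero by metis
  have "(\<Sum>(x, y)\<in>pairs B B k. c x * d y / of_int x) =
      (\<Sum>(x, y)\<in>pairs B (sumset B) k. c x * (if y \<in> B then d y else 0) / of_int x)"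
    by (rule sum.mono_neutral_cong_left, simp)
       (auto simp: pairs_def sumset_def split: if_splits)
  also have "\<dots> = (\<Sum>(x, y)\<in>pairs B (sumset B) k. c x * (conv B c y + e y) / of_int x)"
    by (rule sum.cong[OF refl]) (auto simp: pairs_def e)
  also have "\<dots> = (\<Sum>(x, y)\<in>pairs B (sumset B) k. c x * e y / of_int x) +
      (\<Sum>(x, y)\<in>pairs B (sumset B) k. c x * conv B c y / of_int x)"
    by (simp add: sum.distrib[symmetric] case_prod_unfold distrib_left add_divide_distrib add.commute)
  also have "(\<Sum>(x, y)\<in>pairs B (sumset B) k. c x * conv B c y / of_int x) =
      (\<Sum>p\<in>pairs B (sumset B) k. \<Sum>q\<in>pairs B B (snd p). ?F (fst p) (fst q) (snd q))"
    unfolding conv_def sum_distrib_left sum_divide_distrib case_prod_unfold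
    by (simp add: mult.assoc)
  also have "\<dots> = (\<Sum>(p, q)\<in>(SIGMA p:pairs B (sumset B) k. pairs B B (snd p)). ?F (fst p) (fst q) (snd q))"
    by (rule sum.Sigma) auto
  \<comment> \<open>With \<open>y = a + b\<close> the nested pairs merge into a triple. Terms with
    \<open>a + b = 0\<close> are absent because 0 is not in \<open>sumset B\<close>.\<close>
  also have "\<dots> = (\<Sum>(x, a, b)\<in>{(x, a, b)\<in>triples B k. a + b \<noteq> 0}. ?F x a b)"
    by (rule sum.reindex_bij_witness[of _ "\<lambda>(x, a, b). ((x, a + b), (a, b))" "\<lambda>((x, y), (a, b)). (x, a, b)"])
       (auto simp: pairs_def triples_def add_in_sumset)
  also have "\<dots> = (\<Sum>(x, a, b)\<in>triples B k. if a + b = 0 then 0 else ?F x a b)"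
    by (rule sum.mono_neutral_cong_left) auto
  \<comment> \<open>Inclusion-exclusion over the two remaining resonances.\<close>
  also have "\<dots> = (\<Sum>(x, a, b)\<in>triples B k.
      (if (x + a) * (a + b) * (x + b) = 0 then 0 else ?F x a b)
      + (if x + a = 0 \<and> a + b \<noteq> 0 then ?F x a b else 0)
      + (if x + b = 0 \<and> a + b \<noteq> 0 then ?F x a b else 0)
      - (if x + a = 0 \<and> x + b = 0 \<and> a + b \<noteq> 0 then ?F x a b else 0))"
    by (rule sum.cong[OF refl]) auto
  also have "\<dots> = nonresonant B c k
      + (\<Sum>(x, a, b)\<in>triples B k. if x + a = 0 \<and> a + b \<noteq> 0 then ?F x a b else 0)
      + (\<Sum>(x, a, b)\<in>triples B k. if x + b = 0 \<and> a + b \<noteq> 0 then ?F x a b else 0)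
      - (\<Sum>(x, a, b)\<in>triples B k. if x + a = 0 \<and> x + b = 0 \<and> a + b \<noteq> 0 then ?F x a b else 0)"
    unfolding nonresonant_def case_prod_unfold by (simp only: sum.distrib sum_subtractf)
  also have "(\<Sum>(x, a, b)\<in>triples B k. if x + a = 0 \<and> a + b \<noteq> 0 then ?F x a b else 0) =
      (\<Sum>(x, a, b)\<in>{(x, a, b)\<in>triples B k. x + a = 0 \<and> a + b \<noteq> 0}. ?F x a b)"
    by (rule sum.mono_neutral_cong_right) (auto split: if_splits)
  also have "\<dots> = (\<Sum>x\<in>B - {k}. g x * c k)"
    by (rule sum.reindex_bij_witness[of _ "\<lambda>x. (x, - x, k)" fst])
       (auto simp: triples_def g_def k add_eq_0_iff add_eq_0_iff2)
  also have "(\<Sum>(x, a, b)\<in>triples B k. if x + b = 0 \<and> a + b \<noteq> 0 then ?F x a b else 0) =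
      (\<Sum>(x, a, b)\<in>{(x, a, b)\<in>triples B k. x + b = 0 \<and> a + b \<noteq> 0}. ?F x a b)"
    by (rule sum.mono_neutral_cong_right) (auto split: if_splits)
  also have "\<dots> = (\<Sum>x\<in>B - {k}. g x * c k)"
    by (rule sum.reindex_bij_witness[of _ "\<lambda>x. (x, k, - x)" fst])
       (auto simp: triples_def g_def k add_eq_0_iff add_eq_0_iff2)
  \<comment> \<open>Both resonances together force \<open>a = b = - x\<close> and hence
    \<open>x = - k\<close>: a single triple.\<close>
  also have "(\<Sum>(x, a, b)\<in>triples B k. if x + a = 0 \<and> x + b = 0 \<and> a + b \<noteq> 0 then ?F x a b else 0) =
      (\<Sum>(x, a, b)\<in>{(- k, k, k)}. ?F x a b)"
    by (rule sum.mono_neutral_cong_right, simp)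
       (use k k0 in \<open>auto simp: triples_def split: if_splits\<close>)
  also have "\<dots> = - (g k * c k)"
    by (simp add: g_def)
  also have "(\<Sum>x\<in>B - {k}. g x * c k) = - (g k * c k)"
  proof -
    have "sum g B = sum (\<lambda>x. - g x) B"
      by (rule sum.reindex_bij_witness[of _ uminus uminus]) (auto simp: g_def)
    then have "sum g B = 0" by (simp add: sum_negf)
    then have "sum g (B - {k}) = - g k" using k by (simp add: sum_diff1)
    then show ?thesis by (simp flip: sum_distrib_right)
  qed
  finally show ?thesis by (simp add: g_def)
qed

lemma conv_uminus:
  assumes "\<And>x. x \<in> B \<Longrightarrow> c (- x) = cnj (c x)"
  shows "conv B c (- k) = cnj (conv B c k)"
proof -
  have "conv B c (- k) = (\<Sum>(x, y)\<in>pairs B B k. c (- x) * c (- y))"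
    unfolding conv_def
    by (rule sum.reindex_bij_witness[of _ "\<lambda>(x, y). (- x, - y)" "\<lambda>(x, y). (- x, - y)"])
       (auto simp: pairs_def)
  also have "\<dots> = cnj (conv B c k)"
    unfolding conv_def cnj_sum by (rule sum.cong) (auto simp: pairs_def assms)
  finally show ?thesis .
qed

text \<open>Parseval for u^2 without its mean. If \<open>y + z = 0\<close>, the total forces
  \<open>x + s = 0\<close>, and by the reality of u the product has modulus
  \<open>|c x|^2 * |c y|^2\<close>; likewise if \<open>x + z = 0\<close>. These two families account
  for the first term of the bound.\<close>

lemma sqn_conv_le:
  assumes c: "\<And>x. x \<in> B \<Longrightarrow> c (- x) = cnj (c x)"
  shows "sqn (sumset B) (conv B c) \<le> 2 * (sqn B c)\<^sup>2 + Re (\<Sum>(x, y, z, s)\<in>quads B.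
        if (x + y) * (y + z) * (x + z) = 0 then 0 else c x * c y * c z * c s)"
proof -
  let ?F = "\<lambda>x y z s. c x * c y * c z * c s"
  let ?NR = "\<Sum>(x, y, z, s)\<in>quads B. if (x + y) * (y + z) * (x + z) = 0 then 0 else ?F x y z s"
  let ?R = "\<Sum>(x, y, z, s)\<in>quads B. if x + y \<noteq> 0 \<and> (y + z = 0 \<or> x + z = 0) then ?F x y z s else 0"
  have "of_real (sqn (sumset B) (conv B c)) = (\<Sum>k\<in>sumset B. conv B c k * conv B c (- k))"
    unfolding sqn_def of_real_sum complex_norm_square by (simp add: conv_uminus c)
  also have "\<dots> = (\<Sum>k\<in>sumset B. \<Sum>p\<in>pairs B B k. \<Sum>q\<in>pairs B B (- k).
      ?F (fst p) (snd p) (fst q) (snd q))"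
    unfolding conv_def case_prod_unfold sum_product by (simp add: mult.assoc)
  also have "\<dots> = (\<Sum>k\<in>sumset B. \<Sum>(p, q)\<in>pairs B B k \<times> pairs B B (- k).
      ?F (fst p) (snd p) (fst q) (snd q))"
    by (simp add: sum.cartesian_product)
  also have "\<dots> = (\<Sum>(k, p, q)\<in>(SIGMA k:sumset B. pairs B B k \<times> pairs B B (- k)).
      ?F (fst p) (snd p) (fst q) (snd q))"
    by (rule sum.Sigma) auto
  also have "\<dots> = (\<Sum>(x, y, z, s)\<in>{(x, y, z, s)\<in>quads B. x + y \<noteq> 0}. ?F x y z s)"
    by (rule sum.reindex_bij_witness[of _ "\<lambda>(x, y, z, s). (x + y, (x, y), (z, s))"
          "\<lambda>(k, (x, y), (z, s)). (x, y, z, s)"])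
       (use zero_notin_sumset[OF zero] in \<open>auto simp: pairs_def quads_def add_in_sumset\<close>)
  also have "\<dots> = (\<Sum>(x, y, z, s)\<in>quads B.
      (if (x + y) * (y + z) * (x + z) = 0 then 0 else ?F x y z s) +
      (if x + y \<noteq> 0 \<and> (y + z = 0 \<or> x + z = 0) then ?F x y z s else 0))"
    by (rule sum.mono_neutral_cong_left) auto
  also have "\<dots> = ?NR + ?R"
    by (simp only: case_prod_unfold sum.distrib)
  finally have eq: "of_real (sqn (sumset B) (conv B c)) = ?NR + ?R" .
  \<comment> \<open>A quadruple with both resonances is counted twice, which an upper bound
    allows.\<close>
  have "cmod ?R \<le> (\<Sum>(x, y, z, s)\<in>quads B.
      (if y + z = 0 then cmod (?F x y z s) else 0) + (if x + z = 0 then cmod (?F x y z s) else 0))"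
    by (rule order_trans[OF norm_sum], rule sum_mono) auto
  also have "\<dots> = (\<Sum>(x, y, z, s)\<in>quads B. if y + z = 0 then cmod (?F x y z s) else 0)
      + (\<Sum>(x, y, z, s)\<in>quads B. if x + z = 0 then cmod (?F x y z s) else 0)"
    by (simp only: case_prod_unfold sum.distrib)
  also have "(\<Sum>(x, y, z, s)\<in>quads B. if y + z = 0 then cmod (?F x y z s) else 0) =
      (\<Sum>(x, y, z, s)\<in>{(x, y, z, s)\<in>quads B. y + z = 0}. cmod (?F x y z s))"
    by (rule sum.mono_neutral_cong_right) (auto split: if_splits)
  also have "\<dots> = (\<Sum>(x, y)\<in>B \<times> B. (cmod (c x))\<^sup>2 * (cmod (c y))\<^sup>2)"
    by (rule sum.reindex_bij_witness[of _ "\<lambda>(x, y). (x, y, - y, - x)" "\<lambda>(x, y, z, s). (x, y)"])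
       (auto simp: quads_def add_eq_0_iff norm_mult power2_eq_square c)
  also have "(\<Sum>(x, y, z, s)\<in>quads B. if x + z = 0 then cmod (?F x y z s) else 0) =
      (\<Sum>(x, y, z, s)\<in>{(x, y, z, s)\<in>quads B. x + z = 0}. cmod (?F x y z s))"
    by (rule sum.mono_neutral_cong_right) (auto split: if_splits)
  also have "\<dots> = (\<Sum>(x, y)\<in>B \<times> B. (cmod (c x))\<^sup>2 * (cmod (c y))\<^sup>2)"
    by (rule sum.reindex_bij_witness[of _ "\<lambda>(x, y). (x, y, - x, - y)" "\<lambda>(x, y, z, s). (x, y)"])
       (auto simp: quads_def add_eq_0_iff norm_mult power2_eq_square c)
  also have "(\<Sum>(x, y)\<in>B \<times> B. (cmod (c x))\<^sup>2 * (cmod (c y))\<^sup>2) = (sqn B c)\<^sup>2"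
    by (simp add: sqn_def power2_eq_square[of "sum _ _"] sum_product sum.cartesian_product)
  finally have R: "cmod ?R \<le> 2 * (sqn B c)\<^sup>2" by simp
  have "sqn (sumset B) (conv B c) = Re ?NR + Re ?R"
    using arg_cong[OF eq, of Re] by simp
  also have "Re ?R \<le> 2 * (sqn B c)\<^sup>2"
    using R complex_Re_le_cmod order_trans by blast
  finally show ?thesis by simp
qed

end

section \<open>The truncated system in time\<close>

text \<open>The variance of \<open>cmod (g t)\<close> about its mean \<open>m\<close> is
  nonnegative; expanding the square is the claim for \<open>cmod (g t)\<close>, whose integral
  dominates that of \<open>g\<close>.\<close>

lemma integral_cauchy_schwarz:
  fixes g :: "real \<Rightarrow> complex"
  assumes g: "continuous_on {0..T} g" and T: "0 \<le> T"
  shows "(cmod (integral {0..T} g))\<^sup>2 \<le> T * integral {0..T} (\<lambda>t. (cmod (g t))\<^sup>2)"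
proof (cases "T = 0")
  case False
  define I where "I = integral {0..T} (\<lambda>t. cmod (g t))"
  define m where "m = I / T"
  have int: "(\<lambda>t. cmod (g t)) integrable_on {0..T}" "(\<lambda>t. (cmod (g t))\<^sup>2) integrable_on {0..T}"
    by (intro integrable_continuous_interval continuous_intros g)+
  have "(\<lambda>t. (cmod (g t) - m)\<^sup>2) integrable_on {0..T}"
    by (intro integrable_continuous_interval continuous_intros g)
  then have "0 \<le> integral {0..T} (\<lambda>t. (cmod (g t) - m)\<^sup>2)"
    by (rule integral_nonneg) simp
  also have "(\<lambda>t. (cmod (g t) - m)\<^sup>2) = (\<lambda>t. (cmod (g t))\<^sup>2 - 2 * m * cmod (g t) + m\<^sup>2)"
    by (simp add: power2_diff algebra_simps)
  also have "integral {0..T} \<dots> = integral {0..T} (\<lambda>t. (cmod (g t))\<^sup>2) - 2 * m * I + T * m\<^sup>2"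
  proof (rule integral_unique, intro has_integral_add has_integral_diff has_integral_mult_right)
    show "((\<lambda>t. m\<^sup>2) has_integral T * m\<^sup>2) {0..T}"
      using has_integral_const_real[of "m\<^sup>2" 0 T] T by simp
  qed (use int in \<open>auto simp: I_def intro: integrable_integral\<close>)
  also have "\<dots> = integral {0..T} (\<lambda>t. (cmod (g t))\<^sup>2) - I\<^sup>2 / T"
    using False by (simp add: m_def power2_eq_square field_simps)
  finally have "I\<^sup>2 \<le> T * integral {0..T} (\<lambda>t. (cmod (g t))\<^sup>2)"
    using False T by (simp add: field_simps)
  moreover have "cmod (integral {0..T} g) \<le> I"
    unfolding I_def
    by (rule integral_norm_bound_integral) (use int g in \<open>auto intro: integrable_continuous_interval\<close>)
  ultimately show ?thesis
    by (smt (verit) norm_ge_zero power_mono)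
qed simp

section \<open>Algebra and constants of the normal form\<close>

lemma sqn_sum5_le:
  assumes "\<And>k. k \<in> K \<Longrightarrow>
    cmod (f k) \<le> cmod (f1 k) + cmod (f2 k) + cmod (f3 k) + cmod (f4 k) + cmod (f5 k)"
  shows "sqn K f \<le> 5 * (sqn K f1 + sqn K f2 + sqn K f3 + sqn K f4 + sqn K f5)"
proof -
  have square: "(a + b + c + d + e)\<^sup>2 \<le> 5 * (a\<^sup>2 + b\<^sup>2 + c\<^sup>2 + d\<^sup>2 + e\<^sup>2)" for a b c d e :: real
    using zero_le_power2[of "a - b"] zero_le_power2[of "a - c"] zero_le_power2[of "b - c"]
      zero_le_power2[of "a - d"] zero_le_power2[of "b - d"] zero_le_power2[of "c - d"]
      zero_le_power2[of "a - e"] zero_le_power2[of "b - e"] zero_le_power2[of "c - e"]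
      zero_le_power2[of "d - e"]
    by (simp add: power2_eq_square algebra_simps)
  have "(cmod (f k))\<^sup>2 \<le> 5 * ((cmod (f1 k))\<^sup>2 + (cmod (f2 k))\<^sup>2 + (cmod (f3 k))\<^sup>2
      + (cmod (f4 k))\<^sup>2 + (cmod (f5 k))\<^sup>2)" if "k \<in> K" for k
    by (rule order_trans[OF power_mono[OF assms[OF that]] square]) simp
  then show ?thesis
    unfolding sqn_def sum.distrib[symmetric] sum_distrib_left by (rule sum_mono)
qed

lemma sqn_cmult: "sqn K (\<lambda>k. a * f k) = (cmod a)\<^sup>2 * sqn K f"
  by (simp add: sqn_def norm_mult power_mult_distrib sum_distrib_left)

lemma scaled_div_le: "a * n / b \<le> n" if "a \<le> b" "0 < b" "0 \<le> n" for a b n :: real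
  using mult_right_mono[OF that(1,3)] that(2) by (simp add: divide_le_eq mult.commute)

text \<open>This fixes the weights of the two corrections: \<open>1 / l^2\<close> cancels the
  quadratic term \<open>w\<close>, and \<open>2 / l^4\<close> cancels the nonresonant cubic term
  \<open>n\<close>. The three linear parts combine to the phase of the whole expression.\<close>

lemma normal_form_algebra:
  fixes l :: complex
  assumes "l \<noteq> 0"
  shows "(\<i> * l^3 * k^3 * c + 3 * \<i> * l * k * (w + e))
    + (\<i> * l^3 * k^3 * G - 3 * \<i> * l^3 * k * w + 6 * \<i> * l * (p - r + n)) / l^2
    + 2 * (\<i> * l^3 * k^3 * H - 3 * \<i> * l^3 * n + 3 * \<i> * l * q) / l^4 =
    \<i> * l^3 * k^3 * (c + G / l^2 + 2 * H / l^4)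
    + (3 * \<i> * l * k * e + 6 * \<i> / l * (p - r) + 6 * \<i> / l^3 * q)"
proof -
  \<comment> \<open>With \<open>m\<close> for the inverse of \<open>l\<close>, the claim is a
    polynomial identity modulo \<open>l * m = 1\<close>.\<close>
  define m where "m = inverse l"
  have m: "l * m = 1" using assms by (simp add: m_def)
  show ?thesis
    unfolding divide_inverse power_inverse[symmetric] m_def[symmetric] using m by algebra
qed

lemma forcing_algebra:
  fixes K :: complex
  shows "K * (A * K * u + a * (r - q) + b * (v + 2 * w)) =
    A * (K\<^sup>2 * u) + a * (K * r) + - a * (K * q) + b * (K * v) + b * (2 * (K * w))"
  by (simp add: algebra_simps power2_eq_square)

lemma norm_sum5_le:
  fixes a b c d e :: complex
  shows "cmod (a + b + c + d + e) \<le> cmod a + cmod b + cmod c + cmod d + cmod e"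
  using norm_triangle_ineq[of "a + b + c + d" e] norm_triangle_ineq[of "a + b + c" d]
    norm_triangle_ineq[of "a + b" c] norm_triangle_ineq[of a b] by linarith

lemma has_vector_derivative_cis:
  "((\<lambda>t. cis (a * t)) has_vector_derivative \<i> * of_real a * cis (a * t)) (at t within S)"
  unfolding has_vector_derivative_complex_iff
  by (auto intro!: derivative_eq_intros)

text \<open>From the quartic normal form: \<open>4 + 8 * E^2 + 16 * E^3\<close> per unit of time and
  two boundary terms of size \<open>E + 36 * E^3\<close>, rounded up.\<close>

definition l4_const :: "real \<Rightarrow> real" where
  "l4_const E = 4 + 2 * E + 8 * E\<^sup>2 + 100 * E^3"

text \<open>The outer 5 comes from splitting the forcing into five pieces, and 1060 = 36 + 4 * 256
  collects the two trilinear bounds.\<close>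

definition forcing_const :: "real \<Rightarrow> real \<Rightarrow> real" where
  "forcing_const lam E = 5 * (9 * lam\<^sup>2 + 16 * E + E^3 + 1060 * E\<^sup>2 * l4_const E)"

text \<open>32 = 2 * 16 and 72 = 2 * 36 account for the quadratic and the cubic correction at both
  ends of the time interval.\<close>

definition smoothing_const :: "real \<Rightarrow> real \<Rightarrow> real" where
  "smoothing_const lam E = 5 * (forcing_const lam E + 32 * E\<^sup>2 + 72 * E^3)"

text \<open>For modes in \<open>B\<close> the equation is exact: \<open>d\<close> stands for the
  coefficients of the full u^2, and only its comparison with \<open>conv\<close> is approximate. In
  the application \<open>lam\<close> is 2 pi; the bound \<open>6 \<le> lam\<close> makes the
  prefactors \<open>6 / lam\<close> at most 1 and leaves room for absorption.\<close>

locale truncated_kdv = frequencies +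
  fixes c d :: "real \<Rightarrow> int \<Rightarrow> complex" and lam T E :: real
  assumes lam: "6 \<le> lam" and T: "0 \<le> T"
    and deriv: "\<And>t x. t \<in> {0..T} \<Longrightarrow> x \<in> B \<Longrightarrow>
      ((\<lambda>s. c s x) has_vector_derivative (\<i> * of_real lam^3 * of_int x^3 * c t x
        + 3 * \<i> * of_real lam * of_int x * d t x)) (at t within {0..T})"
    and cont_d: "\<And>x. x \<in> B \<Longrightarrow> continuous_on {0..T} (\<lambda>t. d t x)"
    and c_uminus: "\<And>t x. t \<in> {0..T} \<Longrightarrow> x \<in> B \<Longrightarrow> c t (- x) = cnj (c t x)"
    and energy: "\<And>t. t \<in> {0..T} \<Longrightarrow> sqn B (c t) \<le> E"
    and error: "\<And>t. t \<in> {0..T} \<Longrightarrow> sqn (sumset B) (\<lambda>y. (of_int y)\<^sup>2 *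
      ((if y \<in> B then d t y else 0) - conv B (c t) y)) \<le> 1"
begin

text \<open>Outside \<open>B\<close> the truncated system has no \<open>d\<close>, and the whole
  convolution counts as error.\<close>

definition e :: "real \<Rightarrow> int \<Rightarrow> complex" where
  "e t y = (if y \<in> B then d t y else 0) - conv B (c t) y"

lemma conv_add_e: "conv B (c t) y + e t y = (if y \<in> B then d t y else 0)"
  by (simp add: e_def)

lemma one_le_abs: "0 \<notin> A \<Longrightarrow> y \<in> A \<Longrightarrow> 1 \<le> \<bar>real_of_int y\<bar>"
  by (metis of_int_abs of_int_1_le_iff zero_less_abs_iff int_one_le_iff_zero_less)

lemma E_nonneg: "0 \<le> E"
  using order_trans[OF sqn_nonneg energy[of 0]] T by simp

lemma cont_c: "x \<in> B \<Longrightarrow> continuous_on {0..T} (\<lambda>t. c t x)"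
  using deriv has_vector_derivative_continuous by (fastforce simp: continuous_on_eq_continuous_within)

text \<open>Nonzero integers have modulus at least 1, so the strongest weight controls the weaker
  ones.\<close>

lemma error_bound:
  assumes "t \<in> {0..T}"
  shows "sqn (sumset B) (\<lambda>y. of_int y * e t y) \<le> 1" "sqn (sumset B) (e t) \<le> 1"
    "sqn (sumset B) (\<lambda>y. (of_int y)\<^sup>2 * e t y) \<le> 1"
proof -
  show *: "sqn (sumset B) (\<lambda>y. (of_int y)\<^sup>2 * e t y) \<le> 1"
    using error[OF assms] by (simp add: e_def)
  have le: "cmod (e t y) \<le> cmod (of_int y * e t y)"
    "cmod (of_int y * e t y) \<le> cmod ((of_int y)\<^sup>2 * e t y)" if "y \<in> sumset B" for y
  proof -
    have y: "1 \<le> \<bar>real_of_int y\<bar>" by (rule one_le_abs[OF zero_notin_sumset[OF zero] that])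
    have "\<bar>real_of_int y\<bar> * 1 \<le> \<bar>real_of_int y\<bar> * \<bar>real_of_int y\<bar>"
      by (intro mult_left_mono y) simp
    then have "\<bar>real_of_int y\<bar> * cmod (e t y) \<le> (\<bar>real_of_int y\<bar> * \<bar>real_of_int y\<bar>) * cmod (e t y)"
      by (intro mult_right_mono) auto
    then show "cmod (of_int y * e t y) \<le> cmod ((of_int y)\<^sup>2 * e t y)"
      by (simp add: norm_mult norm_power power2_eq_square)
    show "cmod (e t y) \<le> cmod (of_int y * e t y)"
      using y by (simp add: norm_mult mult_le_cancel_right1)
  qed
  have "sqn (sumset B) (\<lambda>y. of_int y * e t y) \<le> sqn (sumset B) (\<lambda>y. (of_int y)\<^sup>2 * e t y)"
    unfolding sqn_def by (intro sum_mono power_mono le) auto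
  then show **: "sqn (sumset B) (\<lambda>y. of_int y * e t y) \<le> 1" using * by simp
  have "sqn (sumset B) (e t) \<le> sqn (sumset B) (\<lambda>y. of_int y * e t y)"
    unfolding sqn_def by (intro sum_mono power_mono le) auto
  then show "sqn (sumset B) (e t) \<le> 1" using ** by simp
qed

lemma sqn_d_le:
  assumes "t \<in> {0..T}"
  shows "sqn B (d t) \<le> 2 * sqn (sumset B) (conv B (c t)) + 2"
proof -
  have "sqn B (d t) = sqn B (\<lambda>y. conv B (c t) y + e t y)"
    unfolding sqn_def by (rule sum.cong) (auto simp: conv_add_e)
  also have "\<dots> \<le> sqn (sumset B) (\<lambda>y. conv B (c t) y + e t y)"
    unfolding sqn_def by (rule sum_mono2) (auto simp: sumset_subset)
  also have "\<dots> \<le> (\<Sum>y\<in>sumset B. 2 * (cmod (conv B (c t) y))\<^sup>2 + 2 * (cmod (e t y))\<^sup>2)"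
    unfolding sqn_def
  proof (rule sum_mono)
    fix y
    have "(cmod (conv B (c t) y + e t y))\<^sup>2 \<le> (cmod (conv B (c t) y) + cmod (e t y))\<^sup>2"
      by (intro power_mono norm_triangle_ineq) simp
    then show "(cmod (conv B (c t) y + e t y))\<^sup>2 \<le> 2 * (cmod (conv B (c t) y))\<^sup>2 + 2 * (cmod (e t y))\<^sup>2"
      using zero_le_power2[of "cmod (conv B (c t) y) - cmod (e t y)"]
      by (simp add: power2_eq_square algebra_simps)
  qed
  also have "\<dots> = 2 * sqn (sumset B) (conv B (c t)) + 2 * sqn (sumset B) (e t)"
    by (simp add: sqn_def sum.distrib sum_distrib_left)
  also have "\<dots> \<le> 2 * sqn (sumset B) (conv B (c t)) + 2"
    using error_bound(2)[OF assms] by simp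
  finally show ?thesis .
qed

lemma sqn_products_le:
  assumes "t \<in> {0..T}"
  shows "sqn B (c t) * sqn B (c t) * sqn B (c t) \<le> E^3" "sqn B (c t) * sqn B (c t) \<le> E\<^sup>2"
  using energy[OF assms] E_nonneg unfolding power3_eq_cube power2_eq_square
  by (auto intro!: mult_mono)

section \<open>The time integral of the squared norm of u^2\<close>

lemma sum_trilinear_form_reflect_le:
  assumes t: "t \<in> {0..T}"
  shows "(\<Sum>s\<in>B. (cmod (of_int s * trilinear_form B (c t) (c t) (c t) (- s)))\<^sup>2) \<le> 36 * E^3"
proof -
  have "(\<Sum>s\<in>B. (cmod (of_int s * trilinear_form B (c t) (c t) (c t) (- s)))\<^sup>2) =
      sqn B (\<lambda>k. of_int k * trilinear_form B (c t) (c t) (c t) k)"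
    unfolding sqn_def
    by (rule sum.reindex_bij_witness[of _ uminus uminus]) (auto simp: norm_mult)
  also have "\<dots> \<le> 36 * (sqn B (c t) * sqn B (c t) * sqn B (c t))"
    by (rule trilinear_form_bound) simp
  also have "\<dots> \<le> 36 * E^3" using sqn_products_le[OF t] by simp
  finally show ?thesis .
qed

lemma pairing_bound:
  assumes t: "t \<in> {0..T}"
  shows "cmod (\<Sum>s\<in>B. f s * (of_int s * trilinear_form B (c t) (c t) (c t) (- s)))
    \<le> sqn B f / 4 + 36 * E^3"
proof -
  have "cmod (\<Sum>s\<in>B. f s * (of_int s * trilinear_form B (c t) (c t) (c t) (- s))) \<le>
     (\<Sum>s\<in>B. (cmod (f s))\<^sup>2 / 4 + (cmod (of_int s * trilinear_form B (c t) (c t) (c t) (- s)))\<^sup>2)"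
  proof (rule order_trans[OF norm_sum], rule sum_mono)
    fix s
    \<comment> \<open>The small weight 1/4 on \<open>f\<close> lets the choice
      \<open>f = d t\<close> be absorbed later.\<close>
    have "a * b \<le> a\<^sup>2 / 4 + b\<^sup>2" for a b :: real
      using zero_le_power2[of "a / 2 - b"] by (simp add: power2_eq_square algebra_simps)
    then show "cmod (f s * (of_int s * trilinear_form B (c t) (c t) (c t) (- s))) \<le>
        (cmod (f s))\<^sup>2 / 4 + (cmod (of_int s * trilinear_form B (c t) (c t) (c t) (- s)))\<^sup>2"
      by (simp only: norm_mult)
  qed
  also have "\<dots> \<le> sqn B f / 4 + 36 * E^3"
    using sum_trilinear_form_reflect_le[OF t]
    by (simp add: sqn_def sum.distrib sum_divide_distrib)
  finally show ?thesis .
qed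

lemma quartic_form_bound:
  assumes t: "t \<in> {0..T}"
  shows "cmod (quartic_form B (c t)) \<le> E / 4 + 36 * E^3"
proof -
  have "quartic_form B (c t) =
      (\<Sum>s\<in>B. c t s / of_int s * (of_int s * trilinear_form B (c t) (c t) (c t) (- s)))"
    unfolding quartic_form_def sum_quads unfolding trilinear_form_def sum_distrib_left case_prod_unfold
    by (intro sum.cong refl) (auto simp: ac_simps)
  also have "cmod \<dots> \<le> sqn B (\<lambda>s. c t s / of_int s) / 4 + 36 * E^3"
    by (rule pairing_bound[OF t])
  also have "sqn B (\<lambda>s. c t s / of_int s) \<le> sqn B (c t)" by (rule sqn_divide_le)
  also have "\<dots> \<le> E" by (rule energy[OF t])
  finally show ?thesis by simp
qed

text \<open>The normal form for the \<open>L\<^sup>4\<close> norm. It replaces the periodic Strichartz estimate: the kernel of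
  the quartic form gains exactly the derivative lost in the nonlinearity.\<close>

lemma integral_sqn_d_le:
  shows "integral {0..T} (\<lambda>t. sqn B (d t)) \<le> l4_const E * (1 + T)"
proof -
  let ?c' = "\<lambda>t x. \<i> * of_real lam^3 * of_int x^3 * c t x + 3 * \<i> * of_real lam * of_int x * d t x"
  define Q' where "Q' t = (\<Sum>(x, y, z, s)\<in>quads B. (?c' t x * c t y * c t z * c t s
      + c t x * ?c' t y * c t z * c t s + c t x * c t y * ?c' t z * c t s + c t x * c t y * c t z * ?c' t s)
      / ker x y z)" for t
  have Q': "((\<lambda>t. quartic_form B (c t)) has_vector_derivative Q' t) (at t within {0..T})"
    if t: "t \<in> {0..T}" for t
    unfolding quartic_form_def Q'_def case_prod_unfold
  proof (rule has_vector_derivative_sum, rule has_vector_derivative_divide)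
    fix p assume "p \<in> quads B"
    then have "fst p \<in> B" "fst (snd p) \<in> B" "fst (snd (snd p)) \<in> B" "snd (snd (snd p)) \<in> B"
      by (auto simp: quads_def)
    note D = this[THEN deriv[OF t]]
    show "((\<lambda>t. c t (fst p) * c t (fst (snd p)) * c t (fst (snd (snd p))) * c t (snd (snd (snd p))))
      has_vector_derivative
        ?c' t (fst p) * c t (fst (snd p)) * c t (fst (snd (snd p))) * c t (snd (snd (snd p)))
      + c t (fst p) * ?c' t (fst (snd p)) * c t (fst (snd (snd p))) * c t (snd (snd (snd p)))
      + c t (fst p) * c t (fst (snd p)) * ?c' t (fst (snd (snd p))) * c t (snd (snd (snd p)))
      + c t (fst p) * c t (fst (snd p)) * c t (fst (snd (snd p))) * ?c' t (snd (snd (snd p))))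
      (at t within {0..T})"
      by (rule has_vector_derivative_eq_rhs[OF has_vector_derivative_mult[OF has_vector_derivative_mult[OF has_vector_derivative_mult[OF D(1,2)] D(3)] D(4)]])
         (simp add: algebra_simps)
  qed
  \<comment> \<open>12/17 = (2/3) * (18/17): the estimate below contains \<open>- 2/3 * r\<close>,
    and moving \<open>sqn B (d t) / 18\<close> to the left multiplies by 18/17.\<close>
  define \<gamma> where "\<gamma> t = - (12 / (17 * lam^3)) * Im (quartic_form B (c t))" for t
  define \<gamma>' where "\<gamma>' t = - (12 / (17 * lam^3)) * Im (Q' t)" for t
  have lam3: "216 \<le> lam^3" "36 \<le> lam\<^sup>2"
    using power_mono[OF lam, of 3] power_mono[OF lam, of 2] by auto
  have \<gamma>': "(\<gamma> has_vector_derivative \<gamma>' t) (at t within {0..T})" if "t \<in> {0..T}" for t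
    unfolding \<gamma>_def \<gamma>'_def
    by (intro has_vector_derivative_mult_right
        bounded_linear.has_vector_derivative[OF bounded_linear_Im] Q' that)
  define M where "M = 4 + 8 * E\<^sup>2 + 16 * E^3"
  have \<gamma>: "\<bar>\<gamma> t\<bar> \<le> E + 36 * E^3" if "t \<in> {0..T}" for t
  proof -
    have "\<bar>Im (quartic_form B (c t))\<bar> \<le> E + 36 * E^3"
      using quartic_form_bound[OF that] abs_Im_le_cmod[of "quartic_form B (c t)"] E_nonneg by simp
    moreover have "12 / (17 * lam^3) \<le> 1" "0 \<le> 12 / (17 * lam^3)"
      using lam3 lam by (auto simp: divide_le_eq)
    ultimately show ?thesis
      unfolding \<gamma>_def abs_mult abs_minus
      using mult_mono[of "12 / (17 * lam^3)" 1 "\<bar>Im (quartic_form B (c t))\<bar>" "E + 36 * E^3"] by simp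
  qed
  have main: "sqn B (d t) \<le> M + \<gamma>' t" if t: "t \<in> {0..T}" for t
  proof -
    define NR where "NR = (\<Sum>(x, y, z, s)\<in>quads B.
        if (x + y) * (y + z) * (x + z) = 0 then 0 else c t x * c t y * c t z * c t s)"
    define S where "S = (\<Sum>s\<in>B. d t s * (of_int s * trilinear_form B (c t) (c t) (c t) (- s)))"
    have "Q' t = - 3 * \<i> * of_real lam^3 * NR + 12 * \<i> * of_real lam * S"
      unfolding Q'_def NR_def S_def by (rule quartic_form_algebra) simp
    \<comment> \<open>Both coefficients in \<open>Q'\<close> are purely imaginary, so its imaginary
      part sees exactly \<open>Re NR\<close> and \<open>Re S\<close>.\<close>
    then have Im: "Im (Q' t) = - 3 * lam^3 * Re NR + 12 * lam * Re S"
      by (simp flip: of_real_power)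
    define r where "r = Im (Q' t) / lam^3"
    have "Re NR = 4 * Re S / lam\<^sup>2 - r / 3"
      using lam Im unfolding r_def by (simp add: field_simps power2_eq_square power3_eq_cube)
    \<comment> \<open>The absorption is won here: \<open>1 / lam^2\<close> is at most 1/36.\<close>
    moreover have "4 * Re S / lam\<^sup>2 \<le> sqn B (d t) / 36 + 4 * E^3"
    proof -
      have "Re S \<le> sqn B (d t) / 4 + 36 * E^3"
        using pairing_bound[OF t, of "d t"] complex_Re_le_cmod[of S] unfolding S_def by linarith
      then have "4 * Re S / lam\<^sup>2 \<le> 4 * (sqn B (d t) / 4 + 36 * E^3) / lam\<^sup>2"
        by (intro divide_right_mono) auto
      also have "\<dots> \<le> 4 * (sqn B (d t) / 4 + 36 * E^3) / 36"
        by (intro divide_left_mono) (use lam3 E_nonneg in auto)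
      finally show ?thesis by simp
    qed
    ultimately have NR: "Re NR \<le> sqn B (d t) / 36 + 4 * E^3 - r / 3"
      by linarith
    have "sqn (sumset B) (conv B (c t)) \<le> 2 * (sqn B (c t))\<^sup>2 + Re NR"
      unfolding NR_def by (rule sqn_conv_le) (rule c_uminus[OF t])
    moreover have "(sqn B (c t))\<^sup>2 \<le> E\<^sup>2"
      using sqn_products_le(2)[OF t] by (simp add: power2_eq_square)
    ultimately have "sqn B (d t) \<le> 2 + 4 * E\<^sup>2 + 2 * (sqn B (d t) / 36 + 4 * E^3 - r / 3)"
      using sqn_d_le[OF t] NR by argo
    then have "sqn B (d t) \<le> 18/17 * (2 + 4 * E\<^sup>2 + 8 * E^3) - 12 / 17 * r"
      by (simp add: field_simps)
    also have "18/17 * (2 + 4 * E\<^sup>2 + 8 * E^3) \<le> M"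
    proof -
      have "0 \<le> E\<^sup>2" "0 \<le> E^3" using E_nonneg by auto
      then show ?thesis unfolding M_def by argo
    qed
    finally show ?thesis by (simp add: \<gamma>'_def r_def)
  qed
  \<comment> \<open>The integral of \<open>\<gamma>'\<close> is a boundary term, so only
    \<open>M\<close> grows with \<open>T\<close>.\<close>
  have "((\<lambda>t. M + \<gamma>' t) has_integral (T * M + (\<gamma> T - \<gamma> 0))) {0..T}"
    using has_integral_const_real[of M 0 T] fundamental_theorem_of_calculus[OF T \<gamma>'] T
    by (intro has_integral_add) auto
  moreover have "(\<lambda>t. sqn B (d t)) integrable_on {0..T}"
    unfolding sqn_def by (intro integrable_continuous_interval continuous_intros cont_d)
  ultimately have "integral {0..T} (\<lambda>t. sqn B (d t)) \<le> T * M + (\<gamma> T - \<gamma> 0)"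
    using main by (meson has_integral_le integrable_integral)
  also have "\<dots> \<le> T * M + 2 * (E + 36 * E^3)"
    using \<gamma>[of T] \<gamma>[of 0] T by auto
  also have "\<dots> \<le> l4_const E * (1 + T)"
  proof -
    have "0 \<le> T * E" "0 \<le> T * E^3" "0 \<le> E\<^sup>2" "0 \<le> E^3" using T E_nonneg by auto
    then show ?thesis unfolding M_def l4_const_def by (simp add: algebra_simps)
  qed
  finally show ?thesis .
qed

text \<open>Two differentiations by parts in time, based on
  \<open>k\<^sup>3 - x\<^sup>3 - y\<^sup>3 = 3kxy\<close> for \<open>x + y = k\<close> and \<open>k\<^sup>3 - x\<^sup>3 - a\<^sup>3 - b\<^sup>3 = 3(x + a)(a + b)(x + b)\<close> for
  \<open>x + a + b = k\<close>.\<close>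

definition forcing :: "real \<Rightarrow> int \<Rightarrow> complex" where
  "forcing t k = 3 * \<i> * of_real lam * of_int k * e t k
     + 6 * \<i> / of_real lam * ((\<Sum>(x, y)\<in>pairs B (sumset B) k. c t x * e t y / of_int x)
         - c t k * c t (- k) * c t k / of_int k)
     + 6 * \<i> / of_real lam^3 * (trilinear_form B (d t) (c t) (c t) k + 2 * trilinear_form' B (c t) (d t) k)"

text \<open>The factor \<open>cis\<close> undoes the linear flow; the bracket is the mode with its
  two corrections, weighted as \<open>normal_form_algebra\<close> requires.\<close>

definition normal_form :: "real \<Rightarrow> int \<Rightarrow> complex" where
  "normal_form t k = cis (- (lam^3 * of_int k^3 * t)) *
     (c t k + quadratic_form B (c t) k / of_real lam^2 + 2 * cubic_form B (c t) k / of_real lam^4)"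

lemma normal_form_deriv:
  assumes t: "t \<in> {0..T}" and k: "k \<in> B"
  shows "((\<lambda>t. normal_form t k) has_vector_derivative
    cis (- (lam^3 * of_int k^3 * t)) * forcing t k) (at t within {0..T})"
proof -
  let ?c' = "\<lambda>x. \<i> * of_real lam^3 * of_int x^3 * c t x + 3 * \<i> * of_real lam * of_int x * d t x"
  let ?L = "\<i> * of_real lam^3 * of_int k^3 :: complex"
  define G' where "G' = (\<Sum>(x, y)\<in>pairs B B k. (?c' x * c t y + c t x * ?c' y) / (of_int x * of_int y))"
  define H' where "H' = (\<Sum>(x, a, b)\<in>triples B k.
      (?c' x * c t a * c t b + c t x * ?c' a * c t b + c t x * c t a * ?c' b)
      / (of_int x * ker x a b))"
  have G: "((\<lambda>t. quadratic_form B (c t) k) has_vector_derivative G') (at t within {0..T})"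
    unfolding quadratic_form_def G'_def case_prod_unfold
  proof (rule has_vector_derivative_sum, rule has_vector_derivative_divide)
    fix p assume "p \<in> pairs B B k"
    then have "fst p \<in> B" "snd p \<in> B" by (auto simp: pairs_def)
    note D = this[THEN deriv[OF t]]
    show "((\<lambda>t. c t (fst p) * c t (snd p)) has_vector_derivative
        ?c' (fst p) * c t (snd p) + c t (fst p) * ?c' (snd p)) (at t within {0..T})"
      by (rule has_vector_derivative_eq_rhs[OF has_vector_derivative_mult[OF D(1,2)]])
         (simp add: algebra_simps)
  qed
  have H: "((\<lambda>t. cubic_form B (c t) k) has_vector_derivative H') (at t within {0..T})"
    unfolding cubic_form_def H'_def case_prod_unfold
  proof (rule has_vector_derivative_sum, rule has_vector_derivative_divide)
    fix p assume "p \<in> triples B k"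
    then have "fst p \<in> B" "fst (snd p) \<in> B" "snd (snd p) \<in> B" by (auto simp: triples_def)
    note D = this[THEN deriv[OF t]]
    show "((\<lambda>t. c t (fst p) * c t (fst (snd p)) * c t (snd (snd p))) has_vector_derivative
        ?c' (fst p) * c t (fst (snd p)) * c t (snd (snd p))
        + c t (fst p) * ?c' (fst (snd p)) * c t (snd (snd p))
        + c t (fst p) * c t (fst (snd p)) * ?c' (snd (snd p))) (at t within {0..T})"
      by (rule has_vector_derivative_eq_rhs[OF has_vector_derivative_mult[OF has_vector_derivative_mult[OF D(1,2)] D(3)]])
         (simp add: algebra_simps)
  qed
  have cis: "((\<lambda>t. cis (- (lam^3 * of_int k^3 * t))) has_vector_derivative
      - ?L * cis (- (lam^3 * of_int k^3 * t))) (at t within {0..T})"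
    using has_vector_derivative_cis[of "- (lam^3 * of_int k^3)" t "{0..T}"] by (simp add: mult.assoc)
  define f where "f t = c t k + quadratic_form B (c t) k / of_real lam^2
      + 2 * cubic_form B (c t) k / of_real lam^4" for t
  have f: "(f has_vector_derivative ?c' k + G' / of_real lam^2 + 2 * H' / of_real lam^4) (at t within {0..T})"
    unfolding f_def
    by (intro has_vector_derivative_add has_vector_derivative_divide has_vector_derivative_mult_right
        G H deriv t k)
  have G'_eq: "G' = ?L * quadratic_form B (c t) k - 3 * \<i> * of_real lam^3 * of_int k * conv B (c t) k
      + 6 * \<i> * of_real lam * (\<Sum>(x, y)\<in>pairs B B k. c t x * d t y / of_int x)"
    unfolding G'_def by (rule quadratic_form_algebra) simp
  have R: "(\<Sum>(x, y)\<in>pairs B B k. c t x * d t y / of_int x) =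
      (\<Sum>(x, y)\<in>pairs B (sumset B) k. c t x * e t y / of_int x)
      - c t k * c t (- k) * c t k / of_int k + nonresonant B (c t) k"
    by (rule nonresonant_decomposition[OF k]) (rule conv_add_e)
  have H'_eq: "H' = ?L * cubic_form B (c t) k - 3 * \<i> * of_real lam^3 * nonresonant B (c t) k
      + 3 * \<i> * of_real lam * (trilinear_form B (d t) (c t) (c t) k + 2 * trilinear_form' B (c t) (d t) k)"
    unfolding H'_def by (rule cubic_form_algebra) simp
  have dk: "d t k = conv B (c t) k + e t k" using k by (simp add: conv_add_e)
  have lam0: "lam \<noteq> 0" using lam by simp
  \<comment> \<open>The linear parts are collected in \<open>?L * f t\<close>, which the derivative
    of the phase factor cancels.\<close>
  have "?c' k + G' / of_real lam^2 + 2 * H' / of_real lam^4 = ?L * f t + forcing t k"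
    unfolding G'_eq R H'_eq dk f_def forcing_def by (rule normal_form_algebra) (use lam0 in simp)
  then have "((\<lambda>t. cis (- (lam^3 * of_int k^3 * t)) * f t) has_vector_derivative
      cis (- (lam^3 * of_int k^3 * t)) * (?L * f t + forcing t k)
      + - ?L * cis (- (lam^3 * of_int k^3 * t)) * f t) (at t within {0..T})"
    using has_vector_derivative_mult[OF cis f] by simp
  then show ?thesis
    unfolding normal_form_def f_def[symmetric] by (simp add: algebra_simps)
qed

lemma continuous_forcing:
  assumes k: "k \<in> B"
  shows "continuous_on {0..T} (\<lambda>t. forcing t k)"
proof -
  have conv: "continuous_on {0..T} (\<lambda>t. conv B (c t) y)" for y
    unfolding conv_def case_prod_unfold
    by (intro continuous_intros cont_c) (auto simp: pairs_def)
  have e: "continuous_on {0..T} (\<lambda>t. e t y)" for y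
    unfolding e_def by (cases "y \<in> B") (auto intro!: continuous_intros conv cont_d)
  have 1: "continuous_on {0..T} (\<lambda>t. \<Sum>(x, y)\<in>pairs B (sumset B) k. c t x * e t y / of_int x)"
    unfolding case_prod_unfold divide_inverse
    by (intro continuous_intros cont_c e) (auto simp: pairs_def)
  have 2: "continuous_on {0..T} (\<lambda>t. trilinear_form B (d t) (c t) (c t) k)"
    unfolding trilinear_form_def case_prod_unfold divide_inverse
    by (intro continuous_intros cont_c cont_d) (auto simp: triples_def)
  have 3: "continuous_on {0..T} (\<lambda>t. trilinear_form' B (c t) (d t) k)"
    unfolding trilinear_form'_def case_prod_unfold divide_inverse
    by (intro continuous_intros cont_c cont_d) (auto simp: triples_def)
  have 4: "continuous_on {0..T} (\<lambda>t. c t k * c t (- k) * c t k / of_int k)"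
    unfolding divide_inverse by (intro continuous_intros cont_c) (use k in auto)
  show ?thesis
    unfolding forcing_def
    by (intro continuous_on_add continuous_on_diff continuous_on_mult continuous_on_const 1 2 3 4 e)
qed

lemma forcing_bound:
  assumes t: "t \<in> {0..T}"
  shows "sqn B (\<lambda>k. of_int k * forcing t k) \<le>
    5 * (9 * lam\<^sup>2 + 16 * E + E^3 + 1060 * E\<^sup>2 * sqn B (d t))"
proof -
  define Re1 where "Re1 k = (\<Sum>(x, y)\<in>pairs B (sumset B) k. c t x * e t y / of_int x)" for k
  define T1 where "T1 = trilinear_form B (d t) (c t) (c t)"
  define T2 where "T2 = trilinear_form' B (c t) (d t)"
  have lam3: "6 \<le> lam^3"
    using power_mono[OF lam, of 3] by auto
  have "cmod (of_int k * forcing t k) \<le> cmod (of_real (3 * lam) * ((of_int k)\<^sup>2 * e t k))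
      + cmod (of_int k * Re1 k) + cmod (c t k ^ 3) + cmod (of_int k * T1 k) + cmod (2 * (of_int k * T2 k))"
    if k: "k \<in> B" for k
  proof -
    have k0: "k \<noteq> 0" using k zero by metis
    \<comment> \<open>The resonant cubic term carries \<open>1 / k\<close>, so the weight
      \<open>k\<close> leaves just \<open>|c k|^2 * c k\<close>.\<close>
    define q where "q = c t k * cnj (c t k) * c t k / of_int k"
    have q: "of_int k * q = c t k * cnj (c t k) * c t k"
      using k0 by (simp add: q_def)
    have eq: "of_int k * forcing t k = 3 * \<i> * of_real lam * ((of_int k)\<^sup>2 * e t k)
        + 6 * \<i> / of_real lam * (of_int k * Re1 k) + - (6 * \<i> / of_real lam) * (of_int k * q)
        + 6 * \<i> / of_real lam^3 * (of_int k * T1 k) + 6 * \<i> / of_real lam^3 * (2 * (of_int k * T2 k))"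
      unfolding forcing_def Re1_def[symmetric] T1_def[symmetric] T2_def[symmetric] c_uminus[OF t k]
        q_def[symmetric] by (rule forcing_algebra)
    \<comment> \<open>\<open>6 \<le> lam\<close> makes each prefactor at most 1 in modulus.\<close>
    have small: "cmod (6 * \<i> / of_real lam * z) \<le> cmod z" "cmod (- (6 * \<i> / of_real lam) * z) \<le> cmod z"
      "cmod (6 * \<i> / of_real lam^3 * z) \<le> cmod z" for z
      using lam lam3 scaled_div_le[of 6 lam "cmod z"] scaled_div_le[of 6 "lam^3" "cmod z"]
      by (simp_all add: norm_mult norm_divide norm_power)
    have "cmod (of_int k * forcing t k) \<le> cmod (of_real (3 * lam) * ((of_int k)\<^sup>2 * e t k))
      + cmod (of_int k * Re1 k) + cmod (of_int k * q) + cmod (of_int k * T1 k) + cmod (2 * (of_int k * T2 k))"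
      unfolding eq by (rule order_trans[OF norm_sum5_le], intro add_mono small) (simp add: norm_mult)
    also have "cmod (of_int k * q) = cmod (c t k ^ 3)"
      unfolding q by (simp add: norm_mult power3_eq_cube)
    finally show ?thesis .
  qed
  then have "sqn B (\<lambda>k. of_int k * forcing t k) \<le>
      5 * (sqn B (\<lambda>k. of_real (3 * lam) * ((of_int k)\<^sup>2 * e t k)) + sqn B (\<lambda>k. of_int k * Re1 k)
      + sqn B (\<lambda>k. c t k ^ 3) + sqn B (\<lambda>k. of_int k * T1 k) + sqn B (\<lambda>k. 2 * (of_int k * T2 k)))"
    by (rule sqn_sum5_le)
  also have "\<dots> = 5 * (9 * lam\<^sup>2 * sqn B (\<lambda>k. (of_int k)\<^sup>2 * e t k) + sqn B (\<lambda>k. of_int k * Re1 k)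
      + sqn B (\<lambda>k. c t k ^ 3) + sqn B (\<lambda>k. of_int k * T1 k) + 4 * sqn B (\<lambda>k. of_int k * T2 k))"
    unfolding sqn_cmult by (simp add: power_mult_distrib)
  also have "\<dots> \<le> 5 * (9 * lam\<^sup>2 * 1 + 16 * E + E\<^sup>2 * E + 36 * (sqn B (d t) * E\<^sup>2)
      + 4 * (256 * (sqn B (d t) * E\<^sup>2)))"
  proof (intro mult_left_mono add_mono)
    have "sqn B (\<lambda>k. (of_int k)\<^sup>2 * e t k) \<le> sqn (sumset B) (\<lambda>k. (of_int k)\<^sup>2 * e t k)"
      unfolding sqn_def by (rule sum_mono2) (auto simp: sumset_subset)
    then show "sqn B (\<lambda>k. (of_int k)\<^sup>2 * e t k) \<le> 1" using error_bound(3)[OF t] by simp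
    \<comment> \<open>Multiplying and dividing by \<open>y\<close> brings the sum into the form of
      \<open>bilinear_bound\<close>, at the price of a factor \<open>y\<close> on the error.\<close>
    have "Re1 k = (\<Sum>(x, y)\<in>pairs B (sumset B) k. c t x * (of_int y * e t y) / (of_int x * of_int y))" for k
      unfolding Re1_def
      by (rule sum.cong[OF refl]) (use zero_notin_sumset[OF zero] in \<open>auto simp: pairs_def\<close>)
    then have "sqn B (\<lambda>k. of_int k * Re1 k) \<le> 16 * (sqn B (c t) * sqn (sumset B) (\<lambda>y. of_int y * e t y))"
      using bilinear_bound[of B "sumset B" "c t" "\<lambda>y. of_int y * e t y"] by simp
    also have "\<dots> \<le> 16 * (E * 1)"
      by (intro mult_left_mono mult_mono energy[OF t] error_bound[OF t]) (auto simp: E_nonneg)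
    finally show "sqn B (\<lambda>k. of_int k * Re1 k) \<le> 16 * E" by simp
    \<comment> \<open>A single mode is bounded by the whole energy, so two of the three factors are
      paid for by \<open>E\<close>.\<close>
    have "(cmod (c t k ^ 3))\<^sup>2 \<le> E\<^sup>2 * (cmod (c t k))\<^sup>2" if k: "k \<in> B" for k
    proof -
      have "(cmod (c t k))\<^sup>2 \<le> sqn B (c t)"
        unfolding sqn_def by (rule member_le_sum) (use k in auto)
      then have "((cmod (c t k))\<^sup>2)\<^sup>2 * (cmod (c t k))\<^sup>2 \<le> E\<^sup>2 * (cmod (c t k))\<^sup>2"
        using energy[OF t] by (intro mult_right_mono power_mono) auto
      then show ?thesis by (simp add: norm_power flip: power_mult power_add)
    qed
    then have "sqn B (\<lambda>k. c t k ^ 3) \<le> E\<^sup>2 * sqn B (c t)"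
      unfolding sqn_def sum_distrib_left by (rule sum_mono)
    also have "\<dots> \<le> E\<^sup>2 * E" by (intro mult_left_mono energy[OF t]) simp
    finally show "sqn B (\<lambda>k. c t k ^ 3) \<le> E\<^sup>2 * E" .
    have "sqn B (\<lambda>k. of_int k * T1 k) \<le> 36 * (sqn B (d t) * sqn B (c t) * sqn B (c t))"
      unfolding T1_def by (rule trilinear_form_bound) simp
    also have "\<dots> \<le> 36 * (sqn B (d t) * E\<^sup>2)"
      unfolding mult.assoc[of "sqn B (d t)"] by (intro mult_left_mono sqn_products_le[OF t]) auto
    finally show "sqn B (\<lambda>k. of_int k * T1 k) \<le> 36 * (sqn B (d t) * E\<^sup>2)" .
    have "sqn B (\<lambda>k. of_int k * T2 k) \<le> 256 * (sqn B (c t) * sqn B (d t) * sqn B (c t))"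
      unfolding T2_def by (rule trilinear_form'_bound) simp
    also have "\<dots> = 256 * (sqn B (d t) * (sqn B (c t) * sqn B (c t)))" by simp
    also have "\<dots> \<le> 256 * (sqn B (d t) * E\<^sup>2)"
      by (intro mult_left_mono sqn_products_le[OF t]) auto
    finally show "sqn B (\<lambda>k. of_int k * T2 k) \<le> 256 * (sqn B (d t) * E\<^sup>2)" .
  qed auto
  finally show ?thesis
    by (simp add: algebra_simps power2_eq_square power3_eq_cube)
qed

lemma integral_sqn_forcing_le:
  "integral {0..T} (\<lambda>t. sqn B (\<lambda>k. of_int k * forcing t k)) \<le> forcing_const lam E * (1 + T)"
proof -
  have int: "(\<lambda>t. sqn B (d t)) integrable_on {0..T}"
    unfolding sqn_def by (intro integrable_continuous_interval continuous_intros cont_d)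
  \<comment> \<open>5300 = 5 * 1060.\<close>
  have "((\<lambda>t. 5 * (9 * lam\<^sup>2 + 16 * E + E^3) + 5300 * E\<^sup>2 * sqn B (d t)) has_integral
      (T * (5 * (9 * lam\<^sup>2 + 16 * E + E^3)) + 5300 * E\<^sup>2 * integral {0..T} (\<lambda>t. sqn B (d t)))) {0..T}"
    using has_integral_const_real[of "5 * (9 * lam\<^sup>2 + 16 * E + E^3)" 0 T] T
    by (intro has_integral_add has_integral_mult_right integrable_integral[OF int]) auto
  moreover have "(\<lambda>t. sqn B (\<lambda>k. of_int k * forcing t k)) integrable_on {0..T}"
    unfolding sqn_def
    by (intro integrable_continuous_interval continuous_intros continuous_forcing)
  moreover have "sqn B (\<lambda>k. of_int k * forcing t k) \<le>
      5 * (9 * lam\<^sup>2 + 16 * E + E^3) + 5300 * E\<^sup>2 * sqn B (d t)" if "t \<in> {0..T}" for t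
    using forcing_bound[OF that] by (simp add: algebra_simps)
  ultimately have "integral {0..T} (\<lambda>t. sqn B (\<lambda>k. of_int k * forcing t k)) \<le>
      T * (5 * (9 * lam\<^sup>2 + 16 * E + E^3)) + 5300 * E\<^sup>2 * integral {0..T} (\<lambda>t. sqn B (d t))"
    by (meson has_integral_le integrable_integral)
  also have "\<dots> \<le> (1 + T) * (5 * (9 * lam\<^sup>2 + 16 * E + E^3)) + 5300 * E\<^sup>2 * (l4_const E * (1 + T))"
    using T E_nonneg by (intro add_mono mult_left_mono mult_right_mono integral_sqn_d_le) auto
  also have "\<dots> = forcing_const lam E * (1 + T)"
    by (simp add: forcing_const_def algebra_simps)
  finally show ?thesis .
qed

text \<open>Cauchy-Schwarz in time contributes a factor \<open>T\<close> and the integrated forcing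
  a factor \<open>1 + T\<close>; after the square root this is the linear growth of the
  theorem.\<close>

lemma normal_form_increment_le:
  "sqn B (\<lambda>k. of_int k * (normal_form T k - normal_form 0 k)) \<le> forcing_const lam E * (1 + T)\<^sup>2"
proof -
  have "(cmod (of_int k * (normal_form T k - normal_form 0 k)))\<^sup>2 \<le>
      T * integral {0..T} (\<lambda>t. (cmod (of_int k * forcing t k))\<^sup>2)" if k: "k \<in> B" for k
  proof -
    let ?g = "\<lambda>t. of_int k * (cis (- (lam^3 * of_int k^3 * t)) * forcing t k)"
    have g: "continuous_on {0..T} ?g"
      by (intro continuous_intros continuous_forcing k)
    have "(?g has_integral (of_int k * normal_form T k - of_int k * normal_form 0 k)) {0..T}"
      by (rule fundamental_theorem_of_calculus[OF T], rule has_vector_derivative_mult_right)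
         (rule normal_form_deriv[OF _ k])
    then have eq: "integral {0..T} ?g = of_int k * (normal_form T k - normal_form 0 k)"
      unfolding right_diff_distrib by (rule integral_unique)
    have "(cmod (of_int k * (normal_form T k - normal_form 0 k)))\<^sup>2 \<le>
        T * integral {0..T} (\<lambda>t. (cmod (?g t))\<^sup>2)"
      using integral_cauchy_schwarz[OF g T] unfolding eq .
    then show ?thesis by (simp add: norm_mult)
  qed
  then have "sqn B (\<lambda>k. of_int k * (normal_form T k - normal_form 0 k)) \<le>
      (\<Sum>k\<in>B. T * integral {0..T} (\<lambda>t. (cmod (of_int k * forcing t k))\<^sup>2))"
    unfolding sqn_def by (rule sum_mono)
  also have "\<dots> = T * integral {0..T} (\<lambda>t. sqn B (\<lambda>k. of_int k * forcing t k))"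
    unfolding sqn_def sum_distrib_left[symmetric]
    by (subst integral_sum)
       (auto intro!: integrable_continuous_interval continuous_intros continuous_forcing)
  also have "\<dots> \<le> T * (forcing_const lam E * (1 + T))"
    by (intro mult_left_mono integral_sqn_forcing_le T)
  also have "\<dots> \<le> (1 + T) * (forcing_const lam E * (1 + T))"
    using T E_nonneg
    by (intro mult_right_mono) (auto simp: forcing_const_def l4_const_def)
  finally show ?thesis by (simp add: power2_eq_square algebra_simps)
qed

lemma quadratic_form_bound:
  assumes t: "t \<in> {0..T}"
  shows "sqn B (\<lambda>k. of_int k * quadratic_form B (c t) k) \<le> 16 * E\<^sup>2"
proof -
  have "sqn B (\<lambda>k. of_int k * quadratic_form B (c t) k) \<le> 16 * (sqn B (c t) * sqn B (c t))"
    unfolding quadratic_form_def by (rule bilinear_bound) auto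
  then show ?thesis using sqn_products_le(2)[OF t] by simp
qed

theorem smoothing_estimate:
  "sqn B (\<lambda>k. of_int k * (cis (- (lam^3 * of_int k^3 * T)) * c T k - c 0 k))
    \<le> smoothing_const lam E * (1 + T)\<^sup>2"
proof -
  let ?G = "\<lambda>t k. of_int k * quadratic_form B (c t) k"
  let ?H = "\<lambda>t k. of_int k * cubic_form B (c t) k"
  let ?N = "\<lambda>k. of_int k * (normal_form T k - normal_form 0 k)"
  let ?z = "\<lambda>k. of_int k * (cis (- (lam^3 * of_int k^3 * T)) * c T k - c 0 k)"
  have T0: "0 \<in> {0..T}" "T \<in> {0..T}" using T by auto
  have "36 \<le> lam^2" "1296 \<le> lam^4"
    using power_mono[OF lam, of 2] power_mono[OF lam, of 4] by auto
  then have small: "cmod (cis a * (z / of_real lam^2)) \<le> cmod z" "cmod (cis a * (2 * z / of_real lam^4)) \<le> cmod z" for a z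
    using lam scaled_div_le[of 1 "lam^2" "cmod z"] scaled_div_le[of 2 "lam^4" "cmod z"]
    by (simp_all add: norm_mult norm_divide norm_power)
  have "cmod (?z k) \<le> cmod (?N k) + cmod (?G T k) + cmod (?H T k) + cmod (?G 0 k) + cmod (?H 0 k)" for k
  proof -
    \<comment> \<open>\<open>cis 0\<close> is inserted so that \<open>small\<close> covers the
      corrections at both ends.\<close>
    have "?z k = ?N k + - (cis (- (lam^3 * of_int k^3 * T)) * (?G T k / of_real lam^2))
        + - (cis (- (lam^3 * of_int k^3 * T)) * (2 * ?H T k / of_real lam^4))
        + cis 0 * (?G 0 k / of_real lam^2) + cis 0 * (2 * ?H 0 k / of_real lam^4)"
      unfolding normal_form_def by (simp add: algebra_simps)
    then show ?thesis
      by (simp only:) (rule order_trans[OF norm_sum5_le],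
          unfold norm_minus_cancel, intro add_mono small order_refl)
  qed
  then have "sqn B ?z \<le> 5 * (sqn B ?N + sqn B (?G T) + sqn B (?H T) + sqn B (?G 0) + sqn B (?H 0))"
    by (rule sqn_sum5_le)
  also have "\<dots> \<le> 5 * (forcing_const lam E * (1 + T)\<^sup>2 + 16 * E\<^sup>2 + 36 * E^3 + 16 * E\<^sup>2 + 36 * E^3)"
  proof (intro mult_left_mono add_mono normal_form_increment_le quadratic_form_bound T0)
    have "sqn B (?H t) \<le> 36 * E^3" if "t \<in> {0..T}" for t
      using cubic_form_bound[of B "c t"] sqn_products_le(1)[OF that] by simp
    then show "sqn B (?H T) \<le> 36 * E^3" "sqn B (?H 0) \<le> 36 * E^3" using T0 by blast+
  qed auto
  also have "\<dots> \<le> smoothing_const lam E * (1 + T)\<^sup>2"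
  proof -
    have "1 \<le> (1 + T)\<^sup>2" using T by (simp add: one_le_power)
    then have "(32 * E\<^sup>2 + 72 * E^3) * 1 \<le> (32 * E\<^sup>2 + 72 * E^3) * (1 + T)\<^sup>2"
      using E_nonneg by (intro mult_left_mono) auto
    then show ?thesis unfolding smoothing_const_def by (simp add: algebra_simps)
  qed
  finally show ?thesis .
qed

end

section \<open>Fourier series on the unit interval\<close>

abbreviation circ :: "real measure" where
  "circ \<equiv> lebesgue_on {0..1}"

definition fc :: "(real \<Rightarrow> complex) \<Rightarrow> int \<Rightarrow> complex" where
  "fc g n = integral\<^sup>L circ (\<lambda>x. g x * cis (- 2 * pi * of_int n * x))"

definition fourier_sum :: "int set \<Rightarrow> (real \<Rightarrow> complex) \<Rightarrow> real \<Rightarrow> complex" where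
  "fourier_sum K g x = (\<Sum>k\<in>K. fc g k * cis (2 * pi * of_int k * x))"

interpretation circ: finite_measure circ
  by (rule finite_measure_lebesgue_on) simp

lemma measure_circ [simp]: "measure circ {0..1} = 1"
  by (simp add: measure_restrict_space)

lemma set_integrable_circ: "set_integrable lebesgue {0..1} f \<longleftrightarrow> integrable circ f"
  for f :: "real \<Rightarrow> 'a::{banach, second_countable_topology}"
  by (simp add: set_integrable_def integrable_restrict_space)

lemma set_integral_circ: "set_lebesgue_integral lebesgue {0..1} f = integral\<^sup>L circ f"
  for f :: "real \<Rightarrow> 'a::{banach, second_countable_topology}"
  by (simp add: set_lebesgue_integral_def integral_restrict_space)

lemma integrable_circ_continuous:
  "continuous_on {0..1} f \<Longrightarrow> integrable circ f" for f :: "real \<Rightarrow> 'b::euclidean_space"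
  by (rule continuous_imp_integrable_real)

lemma borel_measurable_circ_continuous:
  "continuous_on {0..1} f \<Longrightarrow> f \<in> borel_measurable circ" for f :: "real \<Rightarrow> 'b::euclidean_space"
  by (rule borel_measurable_integrable[OF integrable_circ_continuous])

lemma integral_circ_eq_integral:
  "integrable circ f \<Longrightarrow> integral\<^sup>L circ f = integral {0..1} f" for f :: "real \<Rightarrow> 'b::euclidean_space"
  by (rule lebesgue_integral_eq_integral) auto

lemma borel_measurable_circ_cis [measurable]: "(\<lambda>x. cis (a * x)) \<in> borel_measurable circ"
  by (rule borel_measurable_circ_continuous) (intro continuous_intros)

lemma norm_integral_circ_le:
  fixes f :: "real \<Rightarrow> 'a::{banach, second_countable_topology}"
  assumes "\<And>x. x \<in> {0..1} \<Longrightarrow> norm (f x) \<le> C"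
  shows "norm (integral\<^sup>L circ f) \<le> C"
proof (cases "integrable circ f")
  case True
  have "norm (integral\<^sup>L circ f) \<le> integral\<^sup>L circ (\<lambda>x. norm (f x))"
    by (rule integral_norm_bound)
  also have "\<dots> \<le> integral\<^sup>L circ (\<lambda>x. C)"
    by (rule integral_mono) (use True assms in auto)
  finally show ?thesis by simp
next
  case False
  \<comment> \<open>The integral is 0 by convention, and the bound at the point 0 shows
    \<open>0 \<le> C\<close>.\<close>
  then show ?thesis using order_trans[OF norm_ge_zero assms[of 0]] by (simp add: not_integrable_integral_eq)
qed

lemma integrable_circ_of_square:
  fixes g :: "real \<Rightarrow> complex"
  assumes "g \<in> borel_measurable circ" "integrable circ (\<lambda>x. (cmod (g x))\<^sup>2)"
  shows "integrable circ g"
  using circ.square_integrable_imp_integrable[of "\<lambda>x. cmod (g x)"] assms integrable_norm_cancel by auto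

lemma integrable_circ_mult_cis:
  assumes "integrable circ g"
  shows "integrable circ (\<lambda>x. g x * cis (a * x))"
  by (rule Bochner_Integration.integrable_bound[OF assms]) (use assms in \<open>auto simp: norm_mult\<close>)

lemma integral_circ_deriv:
  fixes F :: "real \<Rightarrow> 'a::euclidean_space"
  assumes F: "\<And>x. x \<in> {0..1} \<Longrightarrow> (F has_vector_derivative f x) (at x within {0..1})"
    and f: "continuous_on {0..1} f"
  shows "integral\<^sup>L circ f = F 1 - F 0"
  using fundamental_theorem_of_calculus[of 0 1 F f] F integral_circ_eq_integral[OF integrable_circ_continuous[OF f]]
  by (simp add: integral_unique)

lemma integral_circ_cis: "integral\<^sup>L circ (\<lambda>x. cis (2 * pi * of_int n * x)) = (if n = 0 then 1 else 0)"
proof (cases "n = 0")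
  case False
  let ?a = "2 * pi * of_int n"
  have "((\<lambda>x. cis (?a * x) / (\<i> * of_real ?a)) has_vector_derivative
      \<i> * of_real ?a * cis (?a * x) / (\<i> * of_real ?a)) (at x within {0..1})" for x
    by (rule has_vector_derivative_divide[OF has_vector_derivative_cis])
  then have "((\<lambda>x. cis (?a * x) / (\<i> * of_real ?a)) has_vector_derivative cis (?a * x)) (at x within {0..1})" for x
    using False by simp
  then have "integral\<^sup>L circ (\<lambda>x. cis (?a * x)) = cis (?a * 1) / (\<i> * of_real ?a) - cis (?a * 0) / (\<i> * of_real ?a)"
    by (rule integral_circ_deriv) (intro continuous_intros)
  then show ?thesis using False by (simp add: cis_multiple_2pi)
qed simp

lemma integral_circ_fourier_sum:
  assumes "finite K"
  shows "integral\<^sup>L circ (\<lambda>x. fourier_sum K g x * cnj (fourier_sum K g x)) = (\<Sum>k\<in>K. fc g k * cnj (fc g k))"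
proof -
  have "fourier_sum K g x * cnj (fourier_sum K g x) =
      (\<Sum>k\<in>K. \<Sum>j\<in>K. fc g k * cnj (fc g j) * cis (2 * pi * of_int (k - j) * x))" for x
    unfolding fourier_sum_def cnj_sum sum_product
    by (intro sum.cong refl) (simp add: cis_cnj cis_mult algebra_simps)
  then have "integral\<^sup>L circ (\<lambda>x. fourier_sum K g x * cnj (fourier_sum K g x)) =
      (\<Sum>k\<in>K. \<Sum>j\<in>K. fc g k * cnj (fc g j) * (if k - j = 0 then 1 else 0))"
    unfolding integral_circ_cis[symmetric]
    by (simp add: integral_sum integrable_circ_continuous continuous_intros del: of_int_diff)
  also have "\<dots> = (\<Sum>k\<in>K. \<Sum>j\<in>K. if k = j then fc g k * cnj (fc g j) else 0)"
    by (intro sum.cong refl) auto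
  also have "\<dots> = (\<Sum>k\<in>K. fc g k * cnj (fc g k))"
    using assms by (simp add: sum.delta)
  finally show ?thesis .
qed

text \<open>The squared distance from \<open>g\<close> to its partial sum is the difference of the
  two sides, because the two mixed integrals and the square of the partial sum all equal
  \<open>?S\<close>.\<close>

lemma bessel:
  assumes K: "finite K" and g: "g \<in> borel_measurable circ" "integrable circ (\<lambda>x. (cmod (g x))\<^sup>2)"
  shows "(\<Sum>k\<in>K. (cmod (fc g k))\<^sup>2) \<le> integral\<^sup>L circ (\<lambda>x. (cmod (g x))\<^sup>2)"
proof -
  let ?P = "fourier_sum K g" and ?S = "\<Sum>k\<in>K. fc g k * cnj (fc g k)"
  have int: "integrable circ g"
    by (rule integrable_circ_of_square[OF g])
  have eq: "g x * cnj (?P x) = (\<Sum>k\<in>K. cnj (fc g k) * (g x * cis (- 2 * pi * of_int k * x)))" for x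
    unfolding fourier_sum_def cnj_sum sum_distrib_left
    by (intro sum.cong refl) (simp add: cis_cnj)
  have i1: "integrable circ (\<lambda>x. g x * cnj (?P x))"
    unfolding eq by (intro Bochner_Integration.integrable_sum integrable_mult_right integrable_circ_mult_cis int)
  have I1: "integral\<^sup>L circ (\<lambda>x. g x * cnj (?P x)) = ?S"
  proof -
    have "integral\<^sup>L circ (\<lambda>x. g x * cnj (?P x)) =
        (\<Sum>k\<in>K. integral\<^sup>L circ (\<lambda>x. cnj (fc g k) * (g x * cis (- 2 * pi * of_int k * x))))"
      unfolding eq
      by (rule Bochner_Integration.integral_sum) (intro integrable_mult_right integrable_circ_mult_cis int)
    also have "\<dots> = ?S"
      unfolding integral_mult_right_zero fc_def[symmetric] by (simp only: mult.commute)
    finally show ?thesis .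
  qed
  have i2: "integrable circ (\<lambda>x. cnj (g x) * ?P x)"
    using integrable_cnj[OF i1] by simp
  have "integral\<^sup>L circ (\<lambda>x. cnj (g x * cnj (?P x))) = cnj ?S"
    unfolding I1[symmetric] by (rule Bochner_Integration.integral_cnj)
  then have I2: "integral\<^sup>L circ (\<lambda>x. cnj (g x) * ?P x) = ?S"
    by (simp add: mult.commute)
  have i3: "integrable circ (\<lambda>x. ?P x * cnj (?P x))"
    unfolding fourier_sum_def by (intro integrable_circ_continuous continuous_intros)
  have i0: "integrable circ (\<lambda>x. g x * cnj (g x))"
    using integrable_of_real[OF g(2), where 'a = complex]
    by (simp only: complex_norm_square)
  have "complex_of_real (integral\<^sup>L circ (\<lambda>x. (cmod (g x - ?P x))\<^sup>2)) =
      integral\<^sup>L circ (\<lambda>x. (g x * cnj (g x) - g x * cnj (?P x)) - cnj (g x) * ?P x + ?P x * cnj (?P x))"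
  proof -
    have "complex_of_real ((cmod (g x - ?P x))\<^sup>2) =
        (g x * cnj (g x) - g x * cnj (?P x)) - cnj (g x) * ?P x + ?P x * cnj (?P x)" for x
      unfolding complex_norm_square by (simp add: algebra_simps)
    then show ?thesis
      unfolding integral_complex_of_real[symmetric] by (simp only:)
  qed
  also have "\<dots> = integral\<^sup>L circ (\<lambda>x. g x * cnj (g x)) - ?S"
    using i0 i1 i2 i3 by (simp add: I1 I2 integral_circ_fourier_sum[OF K])
  also have "\<dots> = complex_of_real (integral\<^sup>L circ (\<lambda>x. (cmod (g x))\<^sup>2) - (\<Sum>k\<in>K. (cmod (fc g k))\<^sup>2))"
    unfolding of_real_diff of_real_sum integral_complex_of_real[symmetric] complex_norm_square ..
  finally have "integral\<^sup>L circ (\<lambda>x. (cmod (g x - ?P x))\<^sup>2) =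
      integral\<^sup>L circ (\<lambda>x. (cmod (g x))\<^sup>2) - (\<Sum>k\<in>K. (cmod (fc g k))\<^sup>2)"
    by (simp only: of_real_eq_iff)
  moreover have "0 \<le> integral\<^sup>L circ (\<lambda>x. (cmod (g x - ?P x))\<^sup>2)"
    by (rule Bochner_Integration.integral_nonneg) simp
  ultimately show ?thesis by simp
qed

text \<open>A Riemann-Lebesgue lemma: by Bessel's inequality the squares along distinct frequencies
  are summable.\<close>

lemma fc_tendsto_0:
  fixes \<sigma> :: "nat \<Rightarrow> int"
  assumes "inj \<sigma>" and g: "g \<in> borel_measurable circ" "integrable circ (\<lambda>x. (cmod (g x))\<^sup>2)"
  shows "(\<lambda>n. fc g (\<sigma> n)) \<longlonglongrightarrow> 0"
proof -
  have "(\<Sum>i<n. (cmod (fc g (\<sigma> i)))\<^sup>2) \<le> integral\<^sup>L circ (\<lambda>x. (cmod (g x))\<^sup>2)" for n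
    using bessel[of "\<sigma> ` {..<n}", OF _ g] assms(1)
    by (simp add: sum.reindex inj_on_subset)
  then have "summable (\<lambda>i. (cmod (fc g (\<sigma> i)))\<^sup>2)"
    by (intro summableI_nonneg_bounded) auto
  then have "(\<lambda>i. (cmod (fc g (\<sigma> i)))\<^sup>2) \<longlonglongrightarrow> 0"
    by (rule summable_LIMSEQ_zero)
  then have "(\<lambda>i. sqrt ((cmod (fc g (\<sigma> i)))\<^sup>2)) \<longlonglongrightarrow> sqrt 0"
    by (rule tendsto_real_sqrt)
  then show ?thesis by (simp add: tendsto_norm_zero_iff)
qed

section \<open>Pointwise convergence of Fourier series\<close>

lemma sin_ge_linear: "2 * s \<le> sin (pi * s)" if "0 \<le> s" "s \<le> 1/2" for s :: real
proof -
  \<comment> \<open>Concavity puts the sine above its chord from 0 to pi / 2.\<close>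
  have "concave_on {0..pi} sin"
  proof (rule f''_le0_imp_concave[where f' = cos and f'' = "\<lambda>x. - sin x"])
    show "- sin x \<le> 0" if "x \<in> {0..pi}" for x :: real
      using that by (simp add: sin_ge_zero)
  qed (auto intro!: derivative_eq_intros)
  then have "(1 - 2 * s) * sin 0 + 2 * s * sin (pi / 2) \<le> sin ((1 - 2 * s) *\<^sub>R 0 + (2 * s) *\<^sub>R (pi / 2))"
    using that by (intro concave_onD) auto
  then show ?thesis by (simp add: mult.commute)
qed

lemma norm_cis_minus_one: "cmod (cis (2 * a) - 1) = 2 * \<bar>sin a\<bar>"
proof -
  have "(cmod (cis (2 * a) - 1))\<^sup>2 = (2 * \<bar>sin a\<bar>)\<^sup>2"
  proof -
    have "(cmod (cis (2 * a) - 1))\<^sup>2 = (cos (2 * a) - 1)\<^sup>2 + (sin (2 * a))\<^sup>2"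
      by (simp add: cmod_power2)
    also have "\<dots> = 4 * (sin a)\<^sup>2 * (sin a)\<^sup>2 + 4 * (sin a)\<^sup>2 * (cos a)\<^sup>2"
      unfolding cos_double_sin sin_double by (simp add: power2_eq_square algebra_simps)
    also have "\<dots> = 4 * (sin a)\<^sup>2 * ((sin a)\<^sup>2 + (cos a)\<^sup>2)"
      by (simp only: distrib_left)
    finally show ?thesis by (simp add: power_mult_distrib)
  qed
  then show ?thesis by (rule power2_eq_imp_eq) auto
qed


text \<open>For \<open>|s| \<le> 1\<close> the minimum is the distance from \<open>s\<close> to the
  nearest integer, that is, the distance on the circle. This keeps the quotient in the convergence
  proof bounded.\<close>

lemma norm_cis_minus_one_ge:
  assumes "\<bar>s\<bar> \<le> 1"
  shows "4 * min \<bar>s\<bar> (1 - \<bar>s\<bar>) \<le> cmod (cis (2 * pi * s) - 1)"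
proof -
  have "2 * min \<bar>s\<bar> (1 - \<bar>s\<bar>) \<le> sin (pi * min \<bar>s\<bar> (1 - \<bar>s\<bar>))"
    using assms by (intro sin_ge_linear) (auto simp: min_def)
  also have "sin (pi * min \<bar>s\<bar> (1 - \<bar>s\<bar>)) = sin (pi * \<bar>s\<bar>)"
    by (simp add: min_def right_diff_distrib)
  also have "\<dots> \<le> \<bar>sin (pi * s)\<bar>"
    by (cases "0 \<le> s") auto
  finally show ?thesis
    using norm_cis_minus_one[of "pi * s"] by (simp add: mult.assoc)
qed

lemma fourier_sum_Suc:
  "fourier_sum {- int (Suc N)..int (Suc N)} f x = fourier_sum {- int N..int N} f x
     + fc f (int (Suc N)) * cis (2 * pi * of_int (int (Suc N)) * x)
     + fc f (- int (Suc N)) * cis (2 * pi * of_int (- int (Suc N)) * x)"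
proof -
  have "{- int (Suc N)..int (Suc N)} = insert (int (Suc N)) (insert (- int (Suc N)) {- int N..int N})"
    by auto
  then show ?thesis
    unfolding fourier_sum_def by simp
qed

text \<open>Chernoff's proof of pointwise convergence: dividing \<open>f - f x\<^sub>0\<close> by \<open>cis (2\<pi>(x - x\<^sub>0)) - 1\<close> turns
  the partial sums of the Fourier series into a telescoping sum.\<close>

lemma fourier_sum_tendsto:
  fixes f :: "real \<Rightarrow> complex"
  assumes lip: "\<And>x y. x \<in> {0..1} \<Longrightarrow> y \<in> {0..1} \<Longrightarrow> cmod (f x - f y) \<le> L * \<bar>x - y\<bar>"
    and per: "f 0 = f 1" and x0: "x0 \<in> {0..1}"
  shows "(\<lambda>N. fourier_sum {- int N..int N} f x0) \<longlonglongrightarrow> f x0"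
proof -
  define E where "E x = cis (2 * pi * (x - x0)) - 1" for x
  define h where "h x = f x - f x0" for x
  define g where "g x = h x / E x" for x
  have L: "0 \<le> L" using order_trans[OF norm_ge_zero lip[of 0 1]] by simp
  have cf: "continuous_on {0..1} f"
    by (rule lipschitz_on_continuous_on[of L])
       (use lip L in \<open>auto simp: lipschitz_on_def dist_norm\<close>)
  have hE: "cmod (h x) \<le> L / 4 * cmod (E x)" if x: "x \<in> {0..1}" for x
  proof -
    have s: "\<bar>x - x0\<bar> \<le> 1" using x x0 by auto
    have 1: "cmod (h x) \<le> L * \<bar>x - x0\<bar>"
      unfolding h_def by (rule lip[OF x x0])
    \<comment> \<open>The way from \<open>x\<close> to \<open>x0\<close> may pass through the
      endpoints, which \<open>f\<close> identifies; this upgrades the Lipschitz bound to the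
      distance on the circle.\<close>
    have via: "cmod (h x) \<le> L * (\<bar>x - a\<bar> + \<bar>b - x0\<bar>)" if "a \<in> {0..1}" "b \<in> {0..1}" "f a = f b" for a b
    proof -
      have "cmod (h x) \<le> cmod (f x - f a) + cmod (f b - f x0)"
        using norm_triangle_ineq[of "f x - f a" "f b - f x0"] that(3) by (simp add: h_def)
      also have "\<dots> \<le> L * \<bar>x - a\<bar> + L * \<bar>b - x0\<bar>"
        by (intro add_mono lip x x0 that)
      finally show ?thesis by (simp add: distrib_left)
    qed
    have 2: "cmod (h x) \<le> L * (1 - x + x0)" "cmod (h x) \<le> L * (1 - x0 + x)"
      using via[of 1 0] via[of 0 1] x x0 by (simp_all add: per add.commute)
    have "cmod (h x) \<le> L * min \<bar>x - x0\<bar> (1 - \<bar>x - x0\<bar>)"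
      using 1 2 unfolding min_def abs_if by (auto simp: algebra_simps)
    also have "\<dots> \<le> L / 4 * cmod (E x)"
      using mult_left_mono[OF norm_cis_minus_one_ge[OF s] L] by (simp add: E_def)
    finally show ?thesis .
  qed
  \<comment> \<open>Where \<open>E x = 0\<close>, the bound \<open>hE\<close> forces
    \<open>h x = 0\<close>, so the default value 0 of the quotient is the right one.\<close>
  have hg: "h x = g x * E x" if "x \<in> {0..1}" for x
    using hE[OF that] by (auto simp: g_def)
  have g_bound: "cmod (g x) \<le> L / 4" if "x \<in> {0..1}" for x
    using hE[OF that] L by (cases "E x = 0") (auto simp: g_def norm_divide divide_le_eq)
  have g_meas: "g \<in> borel_measurable circ"
    unfolding g_def h_def E_def
    by (intro borel_measurable_divide borel_measurable_circ_continuous continuous_intros cf)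
  have g_int: "integrable circ (\<lambda>x. (cmod (g x))\<^sup>2)"
    by (rule circ.integrable_const_bound[of _ "(L / 4)\<^sup>2"])
       (use g_bound g_meas in \<open>auto intro!: AE_I2 power_mono\<close>)
  have g_int1: "integrable circ g"
    by (rule integrable_circ_of_square[OF g_meas g_int])
  define b where "b k = fc g k * cis (2 * pi * of_int k * x0)" for k
  \<comment> \<open>Multiplication by \<open>E\<close> combines a shift of the frequency by one with
    the identity, so the terms of the series of \<open>h\<close> are differences and
    telescope.\<close>
  have fch: "fc h k * cis (2 * pi * of_int k * x0) = b (k - 1) - b k" for k
  proof -
    have "fc h k = integral\<^sup>L circ (\<lambda>x. cis (- 2 * pi * x0) * (g x * cis (- 2 * pi * of_int (k - 1) * x))
        - g x * cis (- 2 * pi * of_int k * x))"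
      unfolding fc_def
    proof (rule Bochner_Integration.integral_cong[OF refl])
      fix x assume "x \<in> space circ"
      then have "h x = g x * E x" using hg by simp
      then show "h x * cis (- 2 * pi * of_int k * x) =
          cis (- 2 * pi * x0) * (g x * cis (- 2 * pi * of_int (k - 1) * x)) - g x * cis (- 2 * pi * of_int k * x)"
      proof -
        have alg: "G * (z - 1) * w = G * (z * w) - G * w" for G z w :: complex
          by (simp add: algebra_simps)
        have "cis (2 * pi * (x - x0)) * cis (- 2 * pi * of_int k * x) =
            cis (- 2 * pi * x0) * cis (- 2 * pi * of_int (k - 1) * x)"
          by (simp add: cis_mult algebra_simps)
        then show ?thesis
          unfolding \<open>h x = g x * E x\<close> E_def alg by (simp only: mult.left_commute)
      qed
    qed
    also have "\<dots> = cis (- 2 * pi * x0) * fc g (k - 1) - fc g k"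
      unfolding fc_def
      by (subst Bochner_Integration.integral_diff)
         (intro integrable_mult_right integrable_circ_mult_cis g_int1 | simp)+
    finally have fchk: "fc h k = cis (- 2 * pi * x0) * fc g (k - 1) - fc g k" .
    have "fc h k * cis (2 * pi * of_int k * x0) =
        fc g (k - 1) * (cis (- 2 * pi * x0) * cis (2 * pi * of_int k * x0)) - fc g k * cis (2 * pi * of_int k * x0)"
      unfolding fchk by (simp only: left_diff_distrib right_diff_distrib mult_ac)
    also have "cis (- 2 * pi * x0) * cis (2 * pi * of_int k * x0) = cis (2 * pi * of_int (k - 1) * x0)"
      by (simp add: cis_mult algebra_simps)
    finally show ?thesis by (simp only: b_def)
  qed
  \<comment> \<open>Subtracting the constant \<open>f x0\<close> affects only the coefficient at
    0.\<close>
  have fchf: "fc h k = fc f k - f x0 * (if k = 0 then 1 else 0)" for k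
  proof -
    have "fc h k = integral\<^sup>L circ (\<lambda>x. f x * cis (- 2 * pi * of_int k * x)
        - f x0 * cis (2 * pi * of_int (- k) * x))"
      unfolding fc_def h_def by (simp add: algebra_simps)
    also have "\<dots> = fc f k - f x0 * (if - k = 0 then 1 else 0)"
      unfolding fc_def integral_circ_cis[symmetric]
      by (subst Bochner_Integration.integral_diff)
         (intro integrable_circ_continuous continuous_intros cf | simp)+
    finally show ?thesis by simp
  qed
  have "fourier_sum {- int N..int N} f x0 - f x0 = b (- int N - 1) - b (int N)" for N
  proof (induction N)
    case 0
    show ?case using fch[of 0] fchf[of 0] by (simp add: fourier_sum_def)
  next
    case (Suc N)
    have neg: "- int (Suc N) = - int N - 1" by simp
    have 1: "fc f (int (Suc N)) * cis (2 * pi * of_int (int (Suc N)) * x0) = b (int N) - b (int (Suc N))"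
      using fch[of "int (Suc N)"] fchf[of "int (Suc N)"] by simp
    have 2: "fc f (- int (Suc N)) * cis (2 * pi * of_int (- int (Suc N)) * x0) =
        b (- int (Suc N) - 1) - b (- int N - 1)"
      using fch[of "- int (Suc N)"] fchf[of "- int (Suc N)"] unfolding neg by simp
    have "fourier_sum {- int N..int N} f x0 = f x0 + (b (- int N - 1) - b (int N))"
      using Suc by (simp add: algebra_simps)
    then show ?case
      unfolding fourier_sum_Suc 1 2 by simp
  qed
  moreover have "(\<lambda>N. b (- int N - 1) - b (int N)) \<longlonglongrightarrow> 0 - 0"
  proof (rule tendsto_diff)
    have "(\<lambda>N. fc g (- int N - 1)) \<longlonglongrightarrow> 0" "(\<lambda>N. fc g (int N)) \<longlonglongrightarrow> 0"
      by (rule fc_tendsto_0[OF _ g_meas g_int], simp add: inj_def)+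
    then have "(\<lambda>N. norm (b (- int N - 1))) \<longlonglongrightarrow> 0" "(\<lambda>N. norm (b (int N))) \<longlonglongrightarrow> 0"
      by (simp_all add: b_def norm_mult tendsto_norm_zero_iff)
    then show "(\<lambda>N. b (- int N - 1)) \<longlonglongrightarrow> 0" "(\<lambda>N. b (int N)) \<longlonglongrightarrow> 0"
      by (simp_all only: tendsto_norm_zero_iff)
  qed
  ultimately have "(\<lambda>N. fourier_sum {- int N..int N} f x0 - f x0) \<longlonglongrightarrow> 0" by simp
  then show ?thesis by (simp add: LIM_zero_iff)
qed

text \<open>Integration by parts; periodicity removes the boundary term.\<close>

lemma fc_deriv:
  assumes F: "\<And>x. x \<in> {0..1} \<Longrightarrow> (F has_vector_derivative F' x) (at x within {0..1})"
    and F': "continuous_on {0..1} F'" and per: "F 0 = F 1"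
  shows "fc F' n = 2 * pi * \<i> * of_int n * fc F n"
proof -
  let ?a = "- 2 * pi * of_int n"
  have cF: "continuous_on {0..1} F"
    by (rule continuous_on_vector_derivative[OF F])
  have "integral\<^sup>L circ (\<lambda>x. F x * (\<i> * of_real ?a * cis (?a * x)) + F' x * cis (?a * x)) =
      F 1 * cis (?a * 1) - F 0 * cis (?a * 0)"
    by (rule integral_circ_deriv)
       (intro has_vector_derivative_mult F has_vector_derivative_cis continuous_intros cF F' | simp)+
  also have "\<dots> = 0" using per cis_multiple_2pi[of "- of_int n"] by (simp add: mult.commute)
  also have "(\<lambda>x. F x * (\<i> * of_real ?a * cis (?a * x)) + F' x * cis (?a * x)) =
      (\<lambda>x. (\<i> * of_real ?a) * (F x * cis (?a * x)) + F' x * cis (?a * x))"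
    by (simp add: algebra_simps)
  also have "integral\<^sup>L circ \<dots> = (\<i> * of_real ?a) * fc F n + fc F' n"
    unfolding fc_def
    by (subst Bochner_Integration.integral_add)
       (intro integrable_circ_continuous continuous_intros cF F' | simp)+
  finally show ?thesis
    by (simp add: algebra_simps add_eq_0_iff)
qed

lemma norm_fc_le: "(\<And>x. x \<in> {0..1} \<Longrightarrow> cmod (f x) \<le> C) \<Longrightarrow> cmod (fc f n) \<le> C"
  unfolding fc_def by (rule norm_integral_circ_le) (simp add: norm_mult)

text \<open>Of the \<open>q + 2\<close> powers of decay, \<open>q\<close> are estimated by their
  value at \<open>N\<close> and two are spent on a telescoping sum. The 2 counts the frequencies
  \<open>k\<close> and \<open>- k\<close>.\<close>

lemma fourier_sum_tail_le:
  assumes lim: "(\<lambda>N. fourier_sum {- int N..int N} f x) \<longlonglongrightarrow> y"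
    and A: "\<And>k. k \<noteq> 0 \<Longrightarrow> cmod (fc f k) \<le> A / \<bar>real_of_int k\<bar> ^ (q + 2)" and N: "0 < N"
  shows "cmod (y - fourier_sum {- int N..int N} f x) \<le> 2 * A / real N ^ (q + 1)"
proof -
  have A0: "0 \<le> A" using order_trans[OF norm_ge_zero A[of 1]] by simp
  have le: "cmod (fourier_sum {- int M..int M} f x - fourier_sum {- int N..int N} f x) \<le>
      2 * A / real N ^ q * (1 / real N - 1 / real M)" if "N \<le> M" for M
    using that
  proof (induction M rule: dec_induct)
    case (step M)
    have 1: "1 / real (Suc M) ^ (q + 2) \<le> 1 / real N ^ q * (1 / real M - 1 / real (Suc M))"
    proof -
      have "1 / real (Suc M) ^ (q + 2) = 1 / real (Suc M) ^ q * (1 / real (Suc M) ^ 2)"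
        by (simp add: power_add power2_eq_square)
      also have "\<dots> \<le> 1 / real N ^ q * (1 / real M - 1 / real (Suc M))"
      proof (intro mult_mono)
        show "1 / real (Suc M) ^ q \<le> 1 / real N ^ q"
          using step N by (intro divide_left_mono power_mono) auto
        show "1 / real (Suc M) ^ 2 \<le> 1 / real M - 1 / real (Suc M)"
          using step N by (simp add: divide_simps power2_eq_square)
      qed auto
      finally show ?thesis .
    qed
    have 2: "cmod (fc f k * cis a) \<le> A / real (Suc M) ^ (q + 2)" if "\<bar>k\<bar> = int (Suc M)" for k a
    proof -
      have "\<bar>real_of_int k\<bar> = real (Suc M)" using that by (metis of_int_abs of_int_of_nat_eq)
      then show ?thesis using A[of k] that by (auto simp: norm_mult)
    qed
    have "cmod (fourier_sum {- int (Suc M)..int (Suc M)} f x - fourier_sum {- int N..int N} f x) \<le>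
        cmod (fourier_sum {- int M..int M} f x - fourier_sum {- int N..int N} f x)
        + cmod (fc f (int (Suc M)) * cis (2 * pi * of_int (int (Suc M)) * x))
        + cmod (fc f (- int (Suc M)) * cis (2 * pi * of_int (- int (Suc M)) * x))"
      unfolding fourier_sum_Suc
      by (rule order_trans[OF _ add_right_mono[OF norm_triangle_ineq]],
          rule order_trans[OF _ norm_triangle_ineq]) (simp add: algebra_simps)
    also have "\<dots> \<le> 2 * A / real N ^ q * (1 / real N - 1 / real M)
        + A / real (Suc M) ^ (q + 2) + A / real (Suc M) ^ (q + 2)"
      by (intro add_mono step.IH 2) auto
    also have "\<dots> = 2 * A / real N ^ q * (1 / real N - 1 / real M) + 2 * A * (1 / real (Suc M) ^ (q + 2))"
      by simp
    also have "\<dots> \<le> 2 * A / real N ^ q * (1 / real N - 1 / real M)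
        + 2 * A * (1 / real N ^ q * (1 / real M - 1 / real (Suc M)))"
      using A0 by (intro add_left_mono mult_left_mono 1) auto
    also have "\<dots> = 2 * A / real N ^ q * (1 / real N - 1 / real (Suc M))"
    proof -
      have "2 * A / P * (a - b) + 2 * A * (1 / P * (b - c)) = 2 * A / P * (a - c)" for P a b c :: real
        by (simp add: divide_inverse algebra_simps)
      then show ?thesis .
    qed
    finally show ?case .
  qed simp
  have "cmod (fourier_sum {- int M..int M} f x - fourier_sum {- int N..int N} f x) \<le> 2 * A / real N ^ (q + 1)"
    if "N \<le> M" for M
  proof -
    have "2 * A / real N ^ q * (1 / real N - 1 / real M) \<le> 2 * A / real N ^ q * (1 / real N)"
      using A0 by (intro mult_left_mono) auto
    moreover have "2 * A / real N ^ q * (1 / real N) = 2 * A / real N ^ (q + 1)" by simp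
    ultimately show ?thesis using le[OF that] by linarith
  qed
  moreover have "(\<lambda>M. cmod (fourier_sum {- int M..int M} f x - fourier_sum {- int N..int N} f x))
      \<longlonglongrightarrow> cmod (y - fourier_sum {- int N..int N} f x)"
    by (intro tendsto_intros lim)
  ultimately show ?thesis
    by (intro LIMSEQ_le_const2) auto
qed

section \<open>The full system\<close>

definition freqs :: "nat \<Rightarrow> int set" where
  "freqs N = {- int N..int N} - {0}"

lemma frequencies_freqs: "frequencies (freqs N)"
  by unfold_locales (auto simp: freqs_def)

lemma card_freqs: "card (freqs N) \<le> 2 * N + 1"
proof -
  have "card (freqs N) \<le> card {- int N..int N}"
    unfolding freqs_def by (intro card_mono) auto
  then show ?thesis by simp
qed

lemma abs_le_sumset_freqs: "y \<in> sumset (freqs N) \<Longrightarrow> \<bar>y\<bar> \<le> 2 * int N"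
  by (auto simp: sumset_def freqs_def)

lemma card_sumset_freqs: "card (sumset (freqs N)) \<le> 4 * N + 1"
proof -
  have "card (sumset (freqs N)) \<le> card {- 2 * int N..2 * int N}"
    by (intro card_mono) (auto dest!: abs_le_sumset_freqs)
  then show ?thesis by simp
qed

definition truncation_error ::
    "(real \<Rightarrow> int \<Rightarrow> complex) \<Rightarrow> (real \<Rightarrow> int \<Rightarrow> complex) \<Rightarrow> nat \<Rightarrow> real \<Rightarrow> int \<Rightarrow> complex" where
  "truncation_error c w N t y =
     (if y \<in> freqs N then w t y else 0) - conv (freqs N) (c t) y"

lemma six_le_two_pi: "6 \<le> 2 * pi"
  using pi_gt3 by simp

text \<open>Collects the properties of the coefficients of a smooth solution and of its square, for
  all real times so that time reversal stays within the locale. In the squared norm the weight y^2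
  costs N^4 and the number of frequencies costs N, so the rate N^(-5) makes the error small.\<close>

locale fourier_system =
  fixes c w :: "real \<Rightarrow> int \<Rightarrow> complex" and E :: real
  assumes deriv: "\<And>t k. ((\<lambda>s. c s k) has_vector_derivative
      (\<i> * of_real (2 * pi)^3 * of_int k^3 * c t k + 3 * \<i> * of_real (2 * pi) * of_int k * w t k)) (at t)"
    and cont_w: "\<And>k. continuous_on UNIV (\<lambda>t. w t k)"
    and c_uminus: "\<And>t k. c t (- k) = cnj (c t k)"
    and energy: "\<And>t K. finite K \<Longrightarrow> sqn K (c t) \<le> E"
    and error: "\<And>T. \<exists>C. \<forall>N>0. \<forall>t\<in>{-T..T}. \<forall>y\<in>sumset (freqs N).
      cmod (truncation_error c w N t y) \<le> C / real N ^ 5"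
begin

lemma truncated:
  assumes "0 \<le> T"
  shows "\<exists>N\<^sub>0. \<forall>N\<ge>N\<^sub>0. truncated_kdv (freqs N) c w (2 * pi) T E"
proof -
  obtain C where C: "\<And>N t y. 0 < N \<Longrightarrow> t \<in> {-T..T} \<Longrightarrow> y \<in> sumset (freqs N) \<Longrightarrow>
      cmod (truncation_error c w N t y) \<le> C / real N ^ 5"
    using error[of T] by blast
  \<comment> \<open>80 = 5 * 16: at most \<open>5 * N\<close> frequencies, each contributing at most
    \<open>16 * C^2 / N^6\<close>.\<close>
  obtain N\<^sub>0 :: nat where N\<^sub>0: "80 * C\<^sup>2 + 1 \<le> real N\<^sub>0"
    using real_arch_simple by blast
  have "truncated_kdv (freqs N) c w (2 * pi) T E" if N: "N\<^sub>0 \<le> N" for N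
  proof -
    have N80: "80 * C\<^sup>2 \<le> real N" "1 \<le> real N" "0 < N"
      using N N\<^sub>0 zero_le_power2[of C] by linarith+
    interpret frequencies "freqs N" by (rule frequencies_freqs)
    show ?thesis
    proof unfold_locales
      fix t assume t: "t \<in> {0..T}"
      have "(cmod ((of_int y)\<^sup>2 * truncation_error c w N t y))\<^sup>2 \<le> 16 * C\<^sup>2 / real N ^ 6"
        if y: "y \<in> sumset (freqs N)" for y
      proof -
        have e: "cmod (truncation_error c w N t y) \<le> C / real N ^ 5"
          by (rule C) (use N80 t y in auto)
        have "\<bar>real_of_int y\<bar> \<le> 2 * real N"
          using abs_le_sumset_freqs[OF y] by linarith
        then have "(\<bar>real_of_int y\<bar>)\<^sup>2 \<le> (2 * real N)\<^sup>2" by (intro power_mono) auto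
        then have "cmod ((of_int y)\<^sup>2 * truncation_error c w N t y) \<le> (2 * real N)\<^sup>2 * (C / real N ^ 5)"
          unfolding norm_mult norm_power norm_of_int by (intro mult_mono e) auto
        also have "\<dots> = 4 * C / real N ^ 3"
          using N80 by (simp add: field_simps power_add[symmetric] flip: power_add)
        finally have "(cmod ((of_int y)\<^sup>2 * truncation_error c w N t y))\<^sup>2 \<le> (4 * C / real N ^ 3)\<^sup>2"
          by (intro power_mono) auto
        then show ?thesis by (simp add: power_divide power_mult_distrib flip: power_mult)
      qed
      then have "sqn (sumset (freqs N)) (\<lambda>y. (of_int y)\<^sup>2 * truncation_error c w N t y) \<le>
          real (card (sumset (freqs N))) * (16 * C\<^sup>2 / real N ^ 6)"
        unfolding sqn_def by (rule sum_bounded_above)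
      also have "\<dots> \<le> (5 * real N) * (16 * C\<^sup>2 / real N ^ 6)"
        using card_sumset_freqs[of N] N80 by (intro mult_right_mono) auto
      also have "\<dots> = 80 * C\<^sup>2 / real N ^ 5"
        using N80 by (simp add: eval_nat_numeral)
      also have "\<dots> \<le> 1"
      proof -
        have "real N ^ 1 \<le> real N ^ 5" using N80(2) by (intro power_increasing) auto
        then have "80 * C\<^sup>2 \<le> real N ^ 5" using N80(1) unfolding power_one_right by linarith
        then show ?thesis using N80(3) by (simp add: divide_le_eq)
      qed
      finally show "sqn (sumset (freqs N)) (\<lambda>y. (of_int y)\<^sup>2 *
          ((if y \<in> freqs N then w t y else 0) - conv (freqs N) (c t) y)) \<le> 1"
        by (simp add: truncation_error_def)
    next
      show "((\<lambda>s. c s x) has_vector_derivative (\<i> * of_real (2 * pi)^3 * of_int x^3 * c t x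
          + 3 * \<i> * of_real (2 * pi) * of_int x * w t x)) (at t within {0..T})" for t x
        by (rule has_vector_derivative_at_within[OF deriv])
    qed (use assms six_le_two_pi in \<open>auto intro: continuous_on_subset[OF cont_w] c_uminus energy\<close>)
  qed
  then show ?thesis by blast
qed

text \<open>The bound is independent of \<open>N\<close>, so one truncation containing
  \<open>K - {0}\<close> suffices; frequency 0 has the weight 0.\<close>

lemma smoothing_nonneg:
  assumes T: "0 \<le> T" and K: "finite K"
  shows "sqn K (\<lambda>k. of_int k * (cis (- ((2 * pi)^3 * of_int k^3 * T)) * c T k - c 0 k))
    \<le> smoothing_const (2 * pi) E * (1 + T)\<^sup>2"
proof -
  obtain N\<^sub>0 where N\<^sub>0: "\<And>N. N\<^sub>0 \<le> N \<Longrightarrow> truncated_kdv (freqs N) c w (2 * pi) T E"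
    using truncated[OF T] by blast
  obtain m :: nat where m: "\<And>k. k \<in> K \<Longrightarrow> nat \<bar>k\<bar> \<le> m"
    using finite_nat_set_iff_bounded_le[of "(\<lambda>k. nat \<bar>k\<bar>) ` K"] K by auto
  define N where "N = max N\<^sub>0 m"
  interpret truncated_kdv "freqs N" c w "2 * pi" T E
    by (rule N\<^sub>0) (simp add: N_def)
  have "K - {0} \<subseteq> freqs N"
    using m by (force simp: freqs_def N_def)
  then have "sqn (K - {0}) (\<lambda>k. of_int k * (cis (- ((2 * pi)^3 * of_int k^3 * T)) * c T k - c 0 k)) \<le>
      sqn (freqs N) (\<lambda>k. of_int k * (cis (- ((2 * pi)^3 * of_int k^3 * T)) * c T k - c 0 k))"
    unfolding sqn_def by (intro sum_mono2) auto
  moreover have "sqn (K - {0}) (\<lambda>k. of_int k * (cis (- ((2 * pi)^3 * of_int k^3 * T)) * c T k - c 0 k)) =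
      sqn K (\<lambda>k. of_int k * (cis (- ((2 * pi)^3 * of_int k^3 * T)) * c T k - c 0 k))"
    unfolding sqn_def by (rule sum.mono_neutral_left) (use K in auto)
  ultimately show ?thesis
    using smoothing_estimate by simp
qed

lemma conv_cnj: "conv B (\<lambda>k. cnj (f k)) y = cnj (conv B f y)"
  unfolding conv_def cnj_sum by (rule sum.cong) auto

text \<open>KdV is invariant under reversing both t and x, and for real u the reflection of x
  conjugates the coefficients.\<close>

lemma reflected: "fourier_system (\<lambda>t k. cnj (c (- t) k)) (\<lambda>t k. cnj (w (- t) k)) E"
proof unfold_locales
  fix t k
  let ?v = "\<i> * of_real (2 * pi)^3 * of_int k^3 * c (- t) k + 3 * \<i> * of_real (2 * pi) * of_int k * w (- t) k"
  have minus: "(uminus has_vector_derivative (- 1 :: real)) (at t)"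
    by (auto intro!: derivative_eq_intros)
  have "((\<lambda>s. c (- s) k) has_vector_derivative - 1 *\<^sub>R ?v) (at t)"
    using vector_diff_chain_at[of uminus "- 1" t "\<lambda>s. c s k" ?v] minus deriv[of k "- t"]
    unfolding o_def by blast
  then have "((\<lambda>s. cnj (c (- s) k)) has_vector_derivative cnj (- 1 *\<^sub>R ?v)) (at t)"
    by (rule bounded_linear.has_vector_derivative[OF bounded_linear_cnj])
  then show "((\<lambda>s. cnj (c (- s) k)) has_vector_derivative
      (\<i> * of_real (2 * pi)^3 * of_int k^3 * cnj (c (- t) k)
       + 3 * \<i> * of_real (2 * pi) * of_int k * cnj (w (- t) k))) (at t)"
    by (simp add: algebra_simps)
next
  show "continuous_on UNIV (\<lambda>t. cnj (w (- t) k))" for k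
    by (intro continuous_intros continuous_on_compose2[OF cont_w]) auto
next
  fix T
  obtain C where C: "\<And>N t y. 0 < N \<Longrightarrow> t \<in> {-T..T} \<Longrightarrow> y \<in> sumset (freqs N) \<Longrightarrow>
      cmod (truncation_error c w N t y) \<le> C / real N ^ 5"
    using error[of T] by blast
  have "truncation_error (\<lambda>t k. cnj (c (- t) k)) (\<lambda>t k. cnj (w (- t) k)) N t y =
      cnj (truncation_error c w N (- t) y)" for N t y
    by (simp add: truncation_error_def conv_cnj)
  then show "\<exists>C. \<forall>N>0. \<forall>t\<in>{-T..T}. \<forall>y\<in>sumset (freqs N).
      cmod (truncation_error (\<lambda>t k. cnj (c (- t) k)) (\<lambda>t k. cnj (w (- t) k)) N t y) \<le> C / real N ^ 5"
    using C by (intro exI[of _ C]) auto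
next
  fix t and K :: "int set" assume "finite K"
  then show "sqn K (\<lambda>k. cnj (c (- t) k)) \<le> E"
    using energy[of K "- t"] by (simp add: sqn_def)
qed (auto simp: c_uminus)

theorem smoothing:
  assumes K: "finite K"
  shows "sqn K (\<lambda>k. of_int k * (cis (- ((2 * pi)^3 * of_int k^3 * t)) * c t k - c 0 k))
    \<le> smoothing_const (2 * pi) E * (1 + \<bar>t\<bar>)\<^sup>2"
proof (cases "0 \<le> t")
  case True
  then show ?thesis using smoothing_nonneg[OF True K] by simp
next
  case False
  interpret R: fourier_system "\<lambda>t k. cnj (c (- t) k)" "\<lambda>t k. cnj (w (- t) k)" E
    by (rule reflected)
  have "cis (- ((2 * pi)^3 * of_int k^3 * (- t))) * cnj (c (- (- t)) k) - cnj (c (- 0) k) =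
      cnj (cis (- ((2 * pi)^3 * of_int k^3 * t)) * c t k - c 0 k)" for k
    by (simp add: cis_cnj)
  then have eq: "cmod (of_int k * (cis (- ((2 * pi)^3 * of_int k^3 * (- t))) * cnj (c (- (- t)) k) - cnj (c (- 0) k))) =
      cmod (of_int k * (cis (- ((2 * pi)^3 * of_int k^3 * t)) * c t k - c 0 k))" for k
    by (simp only: norm_mult complex_mod_cnj)
  show ?thesis
    using R.smoothing_nonneg[of "- t", OF _ K] False unfolding sqn_def eq by simp
qed

end

section \<open>Smooth solutions\<close>

lemma leibniz_circ:
  fixes F F' :: "real \<Rightarrow> real \<Rightarrow> 'a::euclidean_space"
  assumes F: "\<And>t x. ((\<lambda>s. F s x) has_vector_derivative F' t x) (at t)"
    and F': "continuous_on UNIV (\<lambda>(t, x). F' t x)" and cF: "\<And>t. continuous_on {0..1} (F t)"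
  shows "((\<lambda>t. integral\<^sup>L circ (F t)) has_vector_derivative integral\<^sup>L circ (F' t)) (at t)"
proof -
  have cF': "continuous_on {0..1} (F' t)" for t
    using continuous_on_compose2[OF F', of "{0..1}" "\<lambda>x. (t, x)"]
    by (simp add: continuous_on_Pair)
  have "((\<lambda>t. integral (cbox 0 1) (F t)) has_vector_derivative integral (cbox 0 1) (F' t)) (at t within UNIV)"
    by (rule leibniz_rule_vector_derivative)
       (use F cF in \<open>auto intro: integrable_continuous_interval continuous_on_subset[OF F']\<close>)
  then show ?thesis
    using cF cF' by (simp add: integral_circ_eq_integral integrable_circ_continuous)
qed

text \<open>For frequencies inside the cutoff, this makes the truncation error a Fourier coefficient
  of the difference between u^2 and the square of the partial sum.\<close>

lemma conv_eq_fc: "conv B (fc g) k = fc (\<lambda>x. (fourier_sum B g x)\<^sup>2) k" if "finite B"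
proof -
  have eq: "(fourier_sum B g x)\<^sup>2 * cis (- 2 * pi * of_int k * x) =
      (\<Sum>i\<in>B. \<Sum>j\<in>B. fc g i * fc g j * cis (2 * pi * of_int (i + j - k) * x))" for x
    unfolding fourier_sum_def power2_eq_square sum_product unfolding sum_distrib_right
    by (intro sum.cong refl) (simp add: cis_mult algebra_simps)
  have "fc (\<lambda>x. (fourier_sum B g x)\<^sup>2) k = (\<Sum>i\<in>B. \<Sum>j\<in>B. fc g i * fc g j * (if i + j - k = 0 then 1 else 0))"
    unfolding fc_def[of "\<lambda>x. (fourier_sum B g x)\<^sup>2"] eq integral_circ_cis[symmetric]
    by (simp add: Bochner_Integration.integral_sum integrable_circ_continuous continuous_intros
        del: of_int_diff of_int_add)
  also have "\<dots> = (\<Sum>(i, j)\<in>B \<times> B. fc g i * fc g j * (if i + j - k = 0 then 1 else 0))"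
    by (simp add: sum.cartesian_product)
  also have "\<dots> = conv B (fc g) k"
    unfolding conv_def by (rule sum.mono_neutral_cong_right) (use that in \<open>auto simp: pairs_def split: if_splits\<close>)
  finally show ?thesis by simp
qed

lemma fc_add:
  "continuous_on {0..1} f \<Longrightarrow> continuous_on {0..1} g \<Longrightarrow> fc (\<lambda>x. f x + g x) k = fc f k + fc g k"
  unfolding fc_def distrib_right
  by (intro Bochner_Integration.integral_add integrable_circ_continuous continuous_on_mult
      continuous_on_cis continuous_on_const continuous_on_id)

lemma fc_cmult: "fc (\<lambda>x. a * f x) k = a * fc f k"
  unfolding fc_def mult.assoc by (rule integral_mult_right_zero)

lemma fc_time_deriv:
  assumes "\<And>t x. ((\<lambda>s. F s x) has_real_derivative F' t x) (at t)"
    and "continuous_on UNIV (\<lambda>(t, x). F' t x)" and "\<And>t. continuous_on {0..1} (F t)"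
  shows "((\<lambda>t. fc (\<lambda>x. of_real (F t x)) k) has_vector_derivative fc (\<lambda>x. of_real (F' t x)) k) (at t)"
  unfolding fc_def
proof (rule leibniz_circ)
  show "((\<lambda>s. complex_of_real (F s x) * cis (- 2 * pi * of_int k * x)) has_vector_derivative
      complex_of_real (F' t x) * cis (- 2 * pi * of_int k * x)) (at t)" for t x
    by (intro has_vector_derivative_mult_left has_vector_derivative_of_real assms)
  show "continuous_on UNIV (\<lambda>(t, x). complex_of_real (F' t x) * cis (- 2 * pi * of_int k * x))"
    using assms(2) unfolding case_prod_unfold by (intro continuous_intros)
qed (intro continuous_intros assms)

text \<open>The family of mixed partial derivatives from \<open>smooth_time_circle\<close> is fixed
  as \<open>D\<close>, with \<open>D 0 0\<close> the solution.\<close>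

locale smooth_kdv =
  fixes D :: "nat \<Rightarrow> nat \<Rightarrow> real \<Rightarrow> real \<Rightarrow> real"
  assumes periodic: "\<And>t x. D 0 0 t (x + 1) = D 0 0 t x"
    and cont: "\<And>i j. continuous_on UNIV (\<lambda>(t, x). D i j t x)"
    and dt: "\<And>i j t x. ((\<lambda>s. D i j s x) has_real_derivative D (Suc i) j t x) (at t)"
    and dx: "\<And>i j t x. (D i j t has_real_derivative D i (Suc j) t x) (at x)"
    and kdv: "\<And>t x. D (Suc 0) 0 t x = - D 0 3 t x + 6 * D 0 0 t x * D 0 1 t x"
    and mean: "integral\<^sup>L circ (D 0 0 0) = 0"
begin

lemma cont_comp [continuous_intros]:
  "continuous_on S f \<Longrightarrow> continuous_on S g \<Longrightarrow> continuous_on S (\<lambda>p. D i j (f p) (g p))"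
  using continuous_on_compose2[OF cont, of S "\<lambda>p. (f p, g p)"] by (auto intro!: continuous_intros)

lemma cont_x [continuous_intros]: "continuous_on S (D i j t)"
  using cont_comp[OF continuous_on_const continuous_on_id, of S i j t] by simp

lemma periodic_all: "D 0 j t (x + 1) = D 0 j t x"
proof (induction j arbitrary: x)
  case (Suc j)
  have "((\<lambda>x. D 0 j t (x + 1)) has_real_derivative D 0 (Suc j) t (x + 1)) (at x)"
    using dx[of 0 j t "x + 1"] by (simp add: DERIV_shift)
  then have "(D 0 j t has_real_derivative D 0 (Suc j) t (x + 1)) (at x)"
    by (simp add: Suc)
  then show ?case using dx DERIV_unique by blast
qed (rule periodic)

lemma ends: "D 0 j t 0 = D 0 j t 1"
  using periodic_all[of j t 0] by simp

definition c :: "real \<Rightarrow> int \<Rightarrow> complex" where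
  "c t = fc (\<lambda>x. of_real (D 0 0 t x))"

definition w :: "real \<Rightarrow> int \<Rightarrow> complex" where
  "w t = fc (\<lambda>x. of_real ((D 0 0 t x)\<^sup>2))"

lemma fc_D_Suc:
  "fc (\<lambda>x. of_real (D 0 (Suc j) t x)) k = 2 * pi * \<i> * of_int k * fc (\<lambda>x. of_real (D 0 j t x)) k"
  by (rule fc_deriv, rule has_vector_derivative_at_within[OF has_vector_derivative_of_real[OF dx]])
     (auto intro!: continuous_intros simp: ends)

lemma fc_D: "fc (\<lambda>x. of_real (D 0 j t x)) k = (2 * pi * \<i> * of_int k)^j * c t k"
  by (induction j) (simp_all add: c_def fc_D_Suc)

lemma fc_square_deriv:
  "fc (\<lambda>x. of_real (2 * D 0 0 t x * D 0 1 t x)) k = 2 * pi * \<i> * of_int k * w t k"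
  unfolding w_def
proof (rule fc_deriv)
  fix x
  have "((\<lambda>x. (D 0 0 t x)\<^sup>2) has_real_derivative 2 * D 0 0 t x * D 0 1 t x) (at x)"
    using DERIV_power[OF dx[of 0 0 t x], of 2] by (simp add: mult_ac)
  then show "((\<lambda>x. complex_of_real ((D 0 0 t x)\<^sup>2)) has_vector_derivative
      of_real (2 * D 0 0 t x * D 0 1 t x)) (at x within {0..1})"
    by (rule has_vector_derivative_at_within[OF has_vector_derivative_of_real])
  show "continuous_on {0..1} (\<lambda>x. complex_of_real (2 * D 0 0 t x * D 0 1 t x))"
    by (intro continuous_on_of_real continuous_on_mult continuous_on_const cont_x)
qed (simp add: ends)

lemma c_deriv: "((\<lambda>s. c s k) has_vector_derivative
    (\<i> * of_real (2 * pi)^3 * of_int k^3 * c t k + 3 * \<i> * of_real (2 * pi) * of_int k * w t k)) (at t)"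
proof -
  have "((\<lambda>s. c s k) has_vector_derivative fc (\<lambda>x. of_real (D (Suc 0) 0 t x)) k) (at t)"
    unfolding c_def by (rule fc_time_deriv) (auto intro: dt cont cont_x)
  also have "(\<lambda>x. complex_of_real (D (Suc 0) 0 t x)) =
      (\<lambda>x. (- 1) * of_real (D 0 3 t x) + 3 * of_real (2 * D 0 0 t x * D 0 1 t x))"
    by (simp add: kdv mult.assoc)
  also have "fc \<dots> k = (- 1) * fc (\<lambda>x. of_real (D 0 3 t x)) k + 3 * fc (\<lambda>x. of_real (2 * D 0 0 t x * D 0 1 t x)) k"
    unfolding fc_cmult[symmetric] by (rule fc_add) (intro continuous_intros)+
  also have "\<dots> = \<i> * of_real (2 * pi)^3 * of_int k^3 * c t k + 3 * \<i> * of_real (2 * pi) * of_int k * w t k"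
    unfolding fc_D fc_square_deriv by (simp add: power_mult_distrib power3_eq_cube)
  finally show ?thesis .
qed

section \<open>Conservation of the mean and of the L2 norm\<close>

lemma c_zero: "c t 0 = 0"
proof -
  \<comment> \<open>At frequency 0 both terms of the evolution equation vanish.\<close>
  have "((\<lambda>s. c s 0) has_vector_derivative 0) (at s within UNIV)" for s
    using c_deriv[of 0 s] by simp
  then obtain a where a: "\<And>s. c s 0 = a"
    using has_vector_derivative_zero_constant[of UNIV "\<lambda>s. c s 0"] by auto
  have "c 0 0 = complex_of_real (integral\<^sup>L circ (D 0 0 0))"
    by (simp add: c_def fc_def)
  then show ?thesis using a mean by simp
qed

lemma integral_square_const: "integral\<^sup>L circ (\<lambda>x. (D 0 0 t x)\<^sup>2) = integral\<^sup>L circ (\<lambda>x. (D 0 0 0 x)\<^sup>2)"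
proof -
  have "((\<lambda>t. integral\<^sup>L circ (\<lambda>x. (D 0 0 t x)\<^sup>2)) has_vector_derivative 0) (at t)" for t
  proof -
    \<comment> \<open>A primitive in x of 2 u u_t: by the equation, that is the x-derivative of 4
      u^3 - 2 u u_xx + (u_x)^2.\<close>
    let ?F = "\<lambda>x. 4 * D 0 0 t x ^ 3 - 2 * D 0 0 t x * D 0 2 t x + (D 0 1 t x)\<^sup>2"
    have "((\<lambda>t. integral\<^sup>L circ (\<lambda>x. (D 0 0 t x)\<^sup>2)) has_vector_derivative
        integral\<^sup>L circ (\<lambda>x. 2 * D 0 0 t x * D (Suc 0) 0 t x)) (at t)"
    proof (rule leibniz_circ)
      fix t x
      show "((\<lambda>s. (D 0 0 s x)\<^sup>2) has_vector_derivative 2 * D 0 0 t x * D (Suc 0) 0 t x) (at t)"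
        using DERIV_power[OF dt[of 0 0 x t], of 2]
        by (simp add: has_real_derivative_iff_has_vector_derivative mult_ac)
    qed (auto simp: case_prod_unfold intro!: continuous_intros)
    also have "integral\<^sup>L circ (\<lambda>x. 2 * D 0 0 t x * D (Suc 0) 0 t x) =
?F 1 - ?F 0"
    proof (rule integral_circ_deriv)
      fix x
      have d: "(D 0 0 t has_real_derivative D 0 1 t x) (at x)" "(D 0 1 t has_real_derivative D 0 2 t x) (at x)"
        "(D 0 2 t has_real_derivative D 0 3 t x) (at x)"
        using dx[of 0 0 t x] dx[of 0 1 t x] dx[of 0 2 t x] by (simp_all add: eval_nat_numeral)
      have "(?F has_real_derivative
          4 * (3 * (D 0 0 t x)\<^sup>2 * D 0 1 t x) - (2 * D 0 1 t x * D 0 2 t x + 2 * D 0 0 t x * D 0 3 t x)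
          + 2 * D 0 1 t x * D 0 2 t x) (at x)"
        by (rule derivative_eq_intros d refl | simp)+
      also have "4 * (3 * (D 0 0 t x)\<^sup>2 * D 0 1 t x) - (2 * D 0 1 t x * D 0 2 t x + 2 * D 0 0 t x * D 0 3 t x)
          + 2 * D 0 1 t x * D 0 2 t x = 2 * D 0 0 t x * D (Suc 0) 0 t x"
        unfolding kdv by (simp add: power2_eq_square algebra_simps)
      finally have "(?F has_real_derivative
          2 * D 0 0 t x * D (Suc 0) 0 t x) (at x)" .
      then show "(?F has_vector_derivative
          2 * D 0 0 t x * D (Suc 0) 0 t x) (at x within {0..1})"
        by (simp add: has_real_derivative_iff_has_vector_derivative has_vector_derivative_at_within)
    qed (intro continuous_intros)
    also have "\<dots> = 0" by (simp add: ends)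
    finally show ?thesis .
  qed
  then obtain a where "\<And>t. integral\<^sup>L circ (\<lambda>x. (D 0 0 t x)\<^sup>2) = a"
    using has_vector_derivative_zero_constant[of UNIV "\<lambda>t. integral\<^sup>L circ (\<lambda>x. (D 0 0 t x)\<^sup>2)"] by auto
  then show ?thesis by simp
qed

lemma c_energy:
  assumes "finite K"
  shows "sqn K (c t) \<le> integral\<^sup>L circ (\<lambda>x. (D 0 0 0 x)\<^sup>2)"
proof -
  have "sqn K (c t) \<le> integral\<^sup>L circ (\<lambda>x. (cmod (of_real (D 0 0 t x)))\<^sup>2)"
    unfolding sqn_def c_def
    by (rule bessel[OF assms])
       (intro borel_measurable_circ_continuous integrable_circ_continuous continuous_intros)+
  then show ?thesis unfolding integral_square_const[of t, symmetric] by simp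
qed

section \<open>Decay of the coefficients and the truncation error\<close>

lemma bounded_D: "\<exists>M\<ge>0. \<forall>t\<in>{-T..T}. \<forall>x\<in>{0..1}. \<bar>D i j t x\<bar> \<le> M"
proof -
  have "compact ((\<lambda>(t, x). D i j t x) ` ({-T..T} \<times> {0..1}))"
    by (intro compact_continuous_image compact_Times compact_Icc continuous_on_subset[OF cont]) auto
  then obtain M where M: "\<forall>y\<in>(\<lambda>(t, x). D i j t x) ` ({-T..T} \<times> {0..1}). norm y \<le> M"
    by (blast dest: compact_imp_bounded bounded_iff[THEN iffD1])
  have "\<bar>D i j t x\<bar> \<le> max M 0" if "t \<in> {-T..T}" "x \<in> {0..1}" for t x
  proof -
    have "D i j t x \<in> (\<lambda>(t, x). D i j t x) ` ({-T..T} \<times> {0..1})"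
      using that by force
    then have "norm (D i j t x) \<le> M" using M by blast
    then show ?thesis by simp
  qed
  then show ?thesis by (intro exI[of _ "max M 0"]) auto
qed

text \<open>Six derivatives, because summing the tail loses one power and the truncation error has
  to decay like N^(-5).\<close>

lemma c_decay:
  assumes M: "\<And>x. x \<in> {0..1} \<Longrightarrow> \<bar>D 0 6 t x\<bar> \<le> M" and k: "k \<noteq> 0"
  shows "cmod (c t k) \<le> M / \<bar>real_of_int k\<bar> ^ 6"
proof -
  have "1 ^ 6 \<le> (2 * pi) ^ 6"
    using six_le_two_pi by (intro power_mono) auto
  then have "1 * (\<bar>real_of_int k\<bar> ^ 6 * cmod (c t k)) \<le> (2 * pi) ^ 6 * (\<bar>real_of_int k\<bar> ^ 6 * cmod (c t k))"
    by (intro mult_right_mono) auto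
  also have "\<dots> = cmod (fc (\<lambda>x. of_real (D 0 6 t x)) k)"
    unfolding fc_D by (simp add: norm_mult norm_power power_mult_distrib)
  also have "\<dots> \<le> M"
    by (rule norm_fc_le) (simp add: M)
  finally show ?thesis using k by (simp add: field_simps)
qed

lemma fourier_sum_close:
  assumes M: "\<And>x. x \<in> {0..1} \<Longrightarrow> \<bar>D 0 6 t x\<bar> \<le> M"
    and x: "x \<in> {0..1}" and N: "0 < N"
  shows "cmod (of_real (D 0 0 t x) - fourier_sum (freqs N) (\<lambda>x. of_real (D 0 0 t x)) x) \<le> 2 * M / real N ^ 5"
proof -
  obtain L where L: "\<And>y. y \<in> {0..1} \<Longrightarrow> \<bar>D 0 1 t y\<bar> \<le> L"
    using bounded_D[of "\<bar>t\<bar>" 0 1] by (metis abs_le_iff atLeastAtMost_iff minus_le_iff order_refl abs_ge_self abs_ge_minus_self)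
  have "fourier_sum {- int N..int N} (\<lambda>x. of_real (D 0 0 t x)) x =
      fourier_sum (freqs N) (\<lambda>x. of_real (D 0 0 t x)) x"
    unfolding fourier_sum_def freqs_def
    by (rule sum.mono_neutral_right) (use c_zero[of t] in \<open>auto simp: c_def\<close>)
  moreover have "cmod (of_real (D 0 0 t x) - fourier_sum {- int N..int N} (\<lambda>x. of_real (D 0 0 t x)) x)
      \<le> 2 * M / real N ^ (4 + 1)"
  proof (rule fourier_sum_tail_le[OF fourier_sum_tendsto])
    fix y z :: real assume yz: "y \<in> {0..1}" "z \<in> {0..1}"
    have "norm (D 0 0 t y - D 0 0 t z) \<le> L * norm (y - z)"
      by (rule field_differentiable_bound[of "{0..1}"])
         (use L yz in \<open>auto intro: DERIV_subset dx[of 0 0, simplified]\<close>)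
    then show "cmod (complex_of_real (D 0 0 t y) - complex_of_real (D 0 0 t z)) \<le> L * \<bar>y - z\<bar>"
      by (simp flip: of_real_diff)
  next
    show "cmod (fc (\<lambda>x. of_real (D 0 0 t x)) k) \<le> M / \<bar>real_of_int k\<bar> ^ (4 + 2)" if "k \<noteq> 0" for k
      using c_decay[OF M that] by (simp add: c_def)
  qed (use x N ends in auto)
  ultimately show ?thesis by simp
qed

lemma error_bound:
  "\<exists>C. \<forall>N>0. \<forall>t\<in>{-T..T}. \<forall>y\<in>sumset (freqs N). cmod (truncation_error c w N t y) \<le> C / real N ^ 5"
proof -
  obtain M where M: "0 \<le> M" "\<And>t x. t \<in> {-T..T} \<Longrightarrow> x \<in> {0..1} \<Longrightarrow> \<bar>D 0 6 t x\<bar> \<le> M"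
    using bounded_D[of T 0 6] by blast
  obtain U where U: "0 \<le> U" "\<And>t x. t \<in> {-T..T} \<Longrightarrow> x \<in> {0..1} \<Longrightarrow> \<bar>D 0 0 t x\<bar> \<le> U"
    using bounded_D[of T 0 0] by blast
  \<comment> \<open>The first summand serves the frequencies inside the cutoff, the second those
    outside.\<close>
  define C where "C = 2 * M * (2 * U + 2 * M) + 192 * M\<^sup>2"
  have "cmod (truncation_error c w N t y) \<le> C / real N ^ 5"
    if N: "0 < N" and t: "t \<in> {-T..T}" and y: "y \<in> sumset (freqs N)" for N t y
  proof (cases "y \<in> freqs N")
    case True
    let ?u = "\<lambda>x. complex_of_real (D 0 0 t x)" let ?P = "fourier_sum (freqs N) ?u"
    have fin: "finite (freqs N)" by (simp add: freqs_def)
    have cP: "continuous_on {0..1} ?P"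
      unfolding fourier_sum_def by (intro continuous_intros)
    have "truncation_error c w N t y = w t y - fc (\<lambda>x. (?P x)\<^sup>2) y"
      using True conv_eq_fc[OF fin, of ?u y] by (simp add: truncation_error_def c_def)
    \<comment> \<open>Factoring the difference of squares leaves one small and one bounded
      factor.\<close>
    also have "\<dots> = fc (\<lambda>x. (?u x - ?P x) * (?u x + ?P x)) y"
    proof -
      have "w t y = fc (\<lambda>x. (?u x - ?P x) * (?u x + ?P x) + (?P x)\<^sup>2) y"
        unfolding w_def by (simp add: power2_eq_square algebra_simps)
      also have "\<dots> = fc (\<lambda>x. (?u x - ?P x) * (?u x + ?P x)) y + fc (\<lambda>x. (?P x)\<^sup>2) y"
        by (rule fc_add) (intro continuous_intros cP)+
      finally show ?thesis by simp
    qed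
    also have "cmod \<dots> \<le> 2 * M / real N ^ 5 * (2 * U + 2 * M)"
    proof (rule norm_fc_le)
      fix x :: real assume x: "x \<in> {0..1}"
      have close: "cmod (?u x - ?P x) \<le> 2 * M / real N ^ 5"
        by (rule fourier_sum_close) (use M t x N in auto)
      also have "\<dots> \<le> 2 * M"
        using M(1) N by (simp add: divide_le_eq mult_le_cancel_left1)
      finally have "cmod (?u x - ?P x) \<le> 2 * M" .
      moreover have "cmod (?u x) \<le> U" using U(2)[OF t x] by simp
      moreover have "cmod (?u x + ?P x) \<le> 2 * cmod (?u x) + cmod (?u x - ?P x)"
        using norm_triangle_ineq4[of "2 * ?u x" "?u x - ?P x"] by (simp add: norm_mult)
      ultimately have "cmod (?u x + ?P x) \<le> 2 * U + 2 * M" by linarith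
      then show "cmod ((?u x - ?P x) * (?u x + ?P x)) \<le> 2 * M / real N ^ 5 * (2 * U + 2 * M)"
        unfolding norm_mult using close M(1) by (intro mult_mono) auto
    qed
    also have "\<dots> \<le> C / real N ^ 5"
      unfolding C_def by (simp add: divide_right_mono)
    finally show ?thesis .
  next
    case False
    have yN: "int N < \<bar>y\<bar>"
      using False y frequencies.zero[OF frequencies_freqs] zero_notin_sumset[of "freqs N"]
      by (auto simp: freqs_def)
    have cM: "cmod (c t k) \<le> M" if "k \<in> freqs N" for k
    proof -
      have k: "k \<noteq> 0" using that by (simp add: freqs_def)
      then have "1 \<le> \<bar>real_of_int k\<bar>" by linarith
      then have "1 \<le> \<bar>real_of_int k\<bar> ^ 6" by (rule one_le_power)
      then have "M / \<bar>real_of_int k\<bar> ^ 6 \<le> M"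
        using M(1) by (simp add: divide_le_eq mult_le_cancel_left1)
      then show ?thesis using c_decay[of t M k] M(2)[OF t] k by fastforce
    qed
    \<comment> \<open>Since \<open>|y|\<close> exceeds \<open>N\<close>, one of two frequencies
      adding up to \<open>y\<close> exceeds \<open>N / 2\<close> in modulus; 64 = 2^6.\<close>
    have cbig: "cmod (c t k) \<le> 64 * M / real N ^ 6" if "int N < 2 * \<bar>k\<bar>" for k
    proof -
      have k: "k \<noteq> 0" using that by auto
      have "real N / 2 \<le> \<bar>real_of_int k\<bar>" using that by linarith
      then have "(real N / 2) ^ 6 \<le> \<bar>real_of_int k\<bar> ^ 6" by (intro power_mono) auto
      then have "M / \<bar>real_of_int k\<bar> ^ 6 \<le> M / (real N / 2) ^ 6"
        using M(1) N k by (intro divide_left_mono) auto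
      also have "\<dots> = 64 * M / real N ^ 6" by (simp add: power_divide)
      finally show ?thesis using c_decay[of t M k] M(2)[OF t] k by fastforce
    qed
    have summand: "cmod (case p of (i, j) \<Rightarrow> c t i * c t j) \<le> 64 * M\<^sup>2 / real N ^ 6"
      if p: "p \<in> pairs (freqs N) (freqs N) y" for p
    proof -
      obtain i j where ij: "p = (i, j)" "i \<in> freqs N" "j \<in> freqs N" "i + j = y"
        using p by (auto simp: pairs_def)
      then consider "int N < 2 * \<bar>i\<bar>" | "int N < 2 * \<bar>j\<bar>" using yN by linarith
      then have "cmod (c t i) * cmod (c t j) \<le> 64 * M / real N ^ 6 * M"
      proof cases
        case 1
        then show ?thesis using cbig[OF 1] cM[OF ij(3)] M(1) by (intro mult_mono) auto
      next
        case 2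
        have "cmod (c t j) * cmod (c t i) \<le> 64 * M / real N ^ 6 * M"
          using cbig[OF 2] cM[OF ij(2)] M(1) by (intro mult_mono) auto
        then show ?thesis by (simp add: mult.commute)
      qed
      then show ?thesis by (simp add: ij(1) norm_mult power2_eq_square)
    qed
    have cardp: "card (pairs (freqs N) (freqs N) y) \<le> 3 * N"
    proof -
      have "card (pairs (freqs N) (freqs N) y) \<le> card (freqs N)"
        by (rule card_inj_on_le[of fst]) (auto simp: inj_on_def pairs_def freqs_def)
      then show ?thesis using card_freqs[of N] N by linarith
    qed
    have "cmod (truncation_error c w N t y) = cmod (conv (freqs N) (c t) y)"
      using False by (simp add: truncation_error_def)
    also have "\<dots> \<le> (\<Sum>p\<in>pairs (freqs N) (freqs N) y. cmod (case p of (i, j) \<Rightarrow> c t i * c t j))"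
      unfolding conv_def by (rule norm_sum)
    also have "\<dots> \<le> real (card (pairs (freqs N) (freqs N) y)) * (64 * M\<^sup>2 / real N ^ 6)"
      by (rule sum_bounded_above) (rule summand)
    also have "\<dots> \<le> real (3 * N) * (64 * M\<^sup>2 / real N ^ 6)"
      using cardp by (intro mult_right_mono) (auto simp del: of_nat_mult)
    also have "\<dots> = 192 * M\<^sup>2 / real N ^ 5"
      using N by (simp add: eval_nat_numeral)
    also have "\<dots> \<le> C / real N ^ 5"
      unfolding C_def using M(1) U(1) by (intro divide_right_mono) auto
    finally show ?thesis .
  qed
  then show ?thesis by blast
qed

lemma fourier_system: "fourier_system c w (integral\<^sup>L circ (\<lambda>x. (D 0 0 0 x)\<^sup>2))"
proof unfold_locales
  fix k
  have "((\<lambda>s. w s k) has_vector_derivative fc (\<lambda>x. of_real (2 * D 0 0 t x * D (Suc 0) 0 t x)) k) (at t)" for t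
    unfolding w_def
  proof (rule fc_time_deriv)
    show "((\<lambda>s. (D 0 0 s x)\<^sup>2) has_real_derivative 2 * D 0 0 t x * D (Suc 0) 0 t x) (at t)" for t x
      using DERIV_power[OF dt[of 0 0 x t], of 2] by (simp add: mult_ac)
  qed (auto simp: case_prod_unfold intro!: continuous_intros)
  then show "continuous_on UNIV (\<lambda>t. w t k)"
    by (intro continuous_at_imp_continuous_on ballI has_vector_derivative_continuous)
next
  show "c t (- k) = cnj (c t k)" for t k
    unfolding c_def fc_def Bochner_Integration.integral_cnj[symmetric] by (simp add: cis_cnj)
next
  show "((\<lambda>s. c s k) has_vector_derivative
    (\<i> * of_real (2 * pi)^3 * of_int k^3 * c t k + 3 * \<i> * of_real (2 * pi) * of_int k * w t k)) (at t)" for t k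
    by (rule c_deriv)
  show "sqn K (c t) \<le> integral\<^sup>L circ (\<lambda>x. (D 0 0 0 x)\<^sup>2)" if "finite K" for t K
    by (rule c_energy[OF that])
  show "\<exists>C. \<forall>N>0. \<forall>t\<in>{-T..T}. \<forall>y\<in>sumset (freqs N). cmod (truncation_error c w N t y) \<le> C / real N ^ 5" for T
    by (rule error_bound)
qed

end

section \<open>Square-integrable functions and smooth approximation\<close>

text \<open>Taking the real part gives a real function for every choice of the coefficients, with no
  symmetry to check.\<close>

definition trig_poly :: "int set \<Rightarrow> (int \<Rightarrow> complex) \<Rightarrow> real \<Rightarrow> real" where
  "trig_poly K a x = Re (\<Sum>k\<in>K. a k * cis (2 * pi * of_int k * x))"

lemma trig_poly_deriv:
  "(trig_poly K a has_real_derivative trig_poly K (\<lambda>k. 2 * pi * \<i> * of_int k * a k) x) (at x)"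
proof -
  have "((\<lambda>x. \<Sum>k\<in>K. a k * cis (2 * pi * of_int k * x)) has_vector_derivative
      (\<Sum>k\<in>K. a k * (\<i> * of_real (2 * pi * of_int k) * cis (2 * pi * of_int k * x)))) (at x)"
    by (intro has_vector_derivative_sum has_vector_derivative_mult_right has_vector_derivative_cis)
  then have "(trig_poly K a has_real_derivative
      Re (\<Sum>k\<in>K. a k * (\<i> * of_real (2 * pi * of_int k) * cis (2 * pi * of_int k * x)))) (at x)"
    unfolding trig_poly_def[abs_def] has_real_derivative_iff_has_vector_derivative
    by (rule bounded_linear.has_vector_derivative[OF bounded_linear_Re])
  also have "Re (\<Sum>k\<in>K. a k * (\<i> * of_real (2 * pi * of_int k) * cis (2 * pi * of_int k * x))) =
      trig_poly K (\<lambda>k. 2 * pi * \<i> * of_int k * a k) x"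
    unfolding trig_poly_def by (intro arg_cong[where f = Re] sum.cong refl) simp
  finally show ?thesis .
qed

lemma deriv_trig_poly: "deriv (trig_poly K a) = trig_poly K (\<lambda>k. 2 * pi * \<i> * of_int k * a k)"
  by (rule ext, rule DERIV_imp_deriv, rule trig_poly_deriv)

lemma higher_deriv_trig_poly:
  "(deriv ^^ j) (trig_poly K a) = trig_poly K (\<lambda>k. (2 * pi * \<i> * of_int k)^j * a k)"
proof (induction j)
  case (Suc j)
  then show ?case by (simp add: deriv_trig_poly mult.assoc)
qed simp

lemma smooth_circle_trig_poly: "smooth_circle (trig_poly K a)"
  unfolding smooth_circle_def
proof (intro conjI allI)
  have "cis (2 * pi * of_int k * (x + 1)) = cis (2 * pi * of_int k * x) * cis (2 * pi * of_int k)" for k and x :: real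
    by (simp add: cis_mult algebra_simps)
  then have "cis (2 * pi * of_int k * (x + 1)) = cis (2 * pi * of_int k * x)" for k and x :: real
    by (simp add: cis_multiple_2pi)
  then show "periodic1 (trig_poly K a)"
    by (simp add: periodic1_def trig_poly_def)
  show "(deriv ^^ j) (trig_poly K a) differentiable at x" for j x
    unfolding higher_deriv_trig_poly
    using trig_poly_deriv real_differentiable_def by blast
qed

lemma continuous_trig_poly: "continuous_on S (trig_poly K a)"
  by (rule DERIV_continuous_on) (rule has_field_derivative_at_within[OF trig_poly_deriv])

lemma l2norm_circ: "l2norm f = sqrt (integral\<^sup>L circ (\<lambda>x. (f x)\<^sup>2))"
  by (simp add: l2norm_def set_integral_circ)

lemma l2norm_square: "(l2norm f)\<^sup>2 = integral\<^sup>L circ (\<lambda>x. (f x)\<^sup>2)"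
  by (simp add: l2norm_circ Bochner_Integration.integral_nonneg)

lemma fourier_coeff_fc: "fourier_coeff f n = fc (\<lambda>x. of_real (f x)) n"
  by (simp add: fourier_coeff_def fc_def set_integral_circ)

lemma AE_circ: "AE x in lebesgue. P x \<Longrightarrow> AE x in circ. P x"
  by (auto simp: AE_restrict_space_iff elim: eventually_mono)

lemma L2_circle_measurable: "f \<in> L2_circle \<Longrightarrow> f \<in> borel_measurable circ"
  by (simp add: L2_circle_def measurable_restrict_space1)

lemma L2_circle_square_integrable: "f \<in> L2_circle \<Longrightarrow> integrable circ (\<lambda>x. (f x)\<^sup>2)"
  by (simp add: L2_circle_def set_integrable_circ)

section \<open>Approximation in mean square\<close>

lemma square_triangle_le: "(a - b)\<^sup>2 \<le> 2 * (a - c)\<^sup>2 + 2 * (c - b)\<^sup>2" for a b c :: real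
  using zero_le_power2[of "(a - c) - (c - b)"] by (simp add: power2_eq_square algebra_simps)

lemma square_integrable_diff:
  fixes f g :: "real \<Rightarrow> real"
  assumes "f \<in> borel_measurable circ" "g \<in> borel_measurable circ"
    and "integrable circ (\<lambda>x. (f x)\<^sup>2)" "integrable circ (\<lambda>x. (g x)\<^sup>2)"
  shows "integrable circ (\<lambda>x. (f x - g x)\<^sup>2)"
proof (rule Bochner_Integration.integrable_bound[of _ "\<lambda>x. 2 * (f x)\<^sup>2 + 2 * (g x)\<^sup>2"])
  show "AE x in circ. norm ((f x - g x)\<^sup>2) \<le> norm (2 * (f x)\<^sup>2 + 2 * (g x)\<^sup>2)"
  proof (rule AE_I2)
    fix x
    show "norm ((f x - g x)\<^sup>2) \<le> norm (2 * (f x)\<^sup>2 + 2 * (g x)\<^sup>2)"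
      using square_triangle_le[of "f x" "g x" 0] by (simp add: abs_of_nonneg)
  qed
qed (use assms in auto)

lemma L2_circle_diff:
  assumes "f \<in> L2_circle" "g \<in> L2_circle"
  shows "(\<lambda>x. f x - g x) \<in> L2_circle"
proof -
  have "integrable circ (\<lambda>x. (f x - g x)\<^sup>2)"
    by (intro square_integrable_diff L2_circle_measurable L2_circle_square_integrable assms)
  then show ?thesis
    using assms unfolding L2_circle_def
    by (auto simp: periodic1_def set_integrable_circ)
qed

lemma square_integral_le:
  fixes f :: "real \<Rightarrow> real"
  assumes "f \<in> borel_measurable circ" "integrable circ (\<lambda>x. (f x)\<^sup>2)"
  shows "(integral\<^sup>L circ f)\<^sup>2 \<le> integral\<^sup>L circ (\<lambda>x. (f x)\<^sup>2)"
proof -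
  let ?m = "integral\<^sup>L circ f"
  have int: "integrable circ f" by (rule circ.square_integrable_imp_integrable[OF assms])
  have "0 \<le> integral\<^sup>L circ (\<lambda>x. (f x - ?m)\<^sup>2)"
    by (rule Bochner_Integration.integral_nonneg) simp
  also have "(\<lambda>x. (f x - ?m)\<^sup>2) = (\<lambda>x. (f x)\<^sup>2 - 2 * ?m * f x + ?m\<^sup>2)"
    by (simp add: power2_diff algebra_simps)
  also have "integral\<^sup>L circ \<dots> = integral\<^sup>L circ (\<lambda>x. (f x)\<^sup>2) - 2 * ?m * ?m + ?m\<^sup>2"
    using assms int by simp
  finally show ?thesis by (simp add: power2_eq_square)
qed

text \<open>First \<open>q\<close> is cut off at a height \<open>n\<close>, then continuous
  functions converging to \<open>q\<close> almost everywhere are cut off at the same height. The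
  cut-off bounds the second difference, as \<open>q\<close> itself bounds the first, for dominated
  convergence. Each error enters with a factor 2, hence \<open>\<epsilon> / 4\<close>.\<close>

lemma continuous_approximation:
  fixes q :: "real \<Rightarrow> real"
  assumes q: "q \<in> borel_measurable lebesgue" "integrable circ (\<lambda>x. (q x)\<^sup>2)" and "0 < \<epsilon>"
  obtains h where "continuous_on UNIV h" "integral\<^sup>L circ (\<lambda>x. (q x - h x)\<^sup>2) < \<epsilon>"
proof -
  define cl :: "real \<Rightarrow> real \<Rightarrow> real" where "cl M y = max (- M) (min M y)" for M y
  have cl_cont: "continuous_on UNIV (cl M)" for M
    unfolding cl_def by (intro continuous_intros)
  have cl_meas: "cl M \<in> borel_measurable borel" for M
    by (rule borel_measurable_continuous_onI[OF cl_cont])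
  have qm: "q \<in> borel_measurable circ" using q(1) by (rule measurable_restrict_space1)
  have "(\<lambda>n. integral\<^sup>L circ (\<lambda>x. (q x - cl (real n) (q x))\<^sup>2)) \<longlonglongrightarrow> integral\<^sup>L circ (\<lambda>x. 0 :: real)"
  proof (rule integral_dominated_convergence[where w = "\<lambda>x. (q x)\<^sup>2"])
    show "AE x in circ. (\<lambda>n. (q x - cl (real n) (q x))\<^sup>2) \<longlonglongrightarrow> 0"
    proof (intro AE_I2 tendsto_eventually)
      fix x
      obtain n0 :: nat where "\<bar>q x\<bar> \<le> real n0" using real_arch_simple by blast
      then show "\<forall>\<^sub>F n in sequentially. (q x - cl (real n) (q x))\<^sup>2 = 0"
        by (intro eventually_sequentiallyI[of n0]) (auto simp: cl_def)
    qed
    show "AE x in circ. norm ((q x - cl (real n) (q x))\<^sup>2) \<le> (q x)\<^sup>2" for n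
    proof (rule AE_I2)
      fix x
      have "\<bar>q x - cl (real n) (q x)\<bar> \<le> \<bar>q x\<bar>" by (auto simp: cl_def)
      then show "norm ((q x - cl (real n) (q x))\<^sup>2) \<le> (q x)\<^sup>2" by (simp add: abs_le_square_iff)
    qed
  qed (use q qm measurable_compose[OF qm cl_meas] in auto)
  then have "\<forall>\<^sub>F n in sequentially. integral\<^sup>L circ (\<lambda>x. (q x - cl (real n) (q x))\<^sup>2) < \<epsilon> / 4"
    using \<open>0 < \<epsilon>\<close> by (intro order_tendstoD(2)[where a = "\<epsilon> / 4"]) auto
  then obtain n where n: "integral\<^sup>L circ (\<lambda>x. (q x - cl (real n) (q x))\<^sup>2) < \<epsilon> / 4"
    by (meson eventually_sequentially order_refl)
  define M where "M = real n"
  have "q measurable_on UNIV"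
    by (rule lebesgue_measurable_imp_measurable_on_real[OF q(1)]) simp
  then obtain N g where N: "negligible N" and g: "\<And>n. continuous_on UNIV (g n)"
      and lim: "\<And>x. x \<notin> N \<Longrightarrow> (\<lambda>n. g n x) \<longlonglongrightarrow> q x"
    unfolding measurable_on_def by auto
  have AE_N: "AE x in circ. x \<notin> N"
  proof -
    have "AE x in lebesgue. x \<notin> N"
      using N by (simp add: negligible_iff_null_sets AE_not_in)
    then show ?thesis by (rule AE_circ)
  qed
  have gm: "(\<lambda>x. cl M (g k x)) \<in> borel_measurable circ" for k
    by (intro borel_measurable_circ_continuous continuous_on_compose2[OF cl_cont]
        continuous_on_subset[OF g]) auto
  have clq: "(\<lambda>x. cl M (q x)) \<in> borel_measurable circ"
    by (rule measurable_compose[OF qm cl_meas])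
  have "(\<lambda>k. integral\<^sup>L circ (\<lambda>x. (cl M (q x) - cl M (g k x))\<^sup>2)) \<longlonglongrightarrow> integral\<^sup>L circ (\<lambda>x. 0 :: real)"
  proof (rule integral_dominated_convergence[where w = "\<lambda>x. (2 * M)\<^sup>2"])
    show "AE x in circ. (\<lambda>k. (cl M (q x) - cl M (g k x))\<^sup>2) \<longlonglongrightarrow> 0"
      using AE_N
    proof (rule AE_mp, intro AE_I2 impI)
      fix x assume "x \<notin> N"
      then have "(\<lambda>k. cl M (g k x)) \<longlonglongrightarrow> cl M (q x)"
        unfolding cl_def by (intro tendsto_intros lim)
      then have "(\<lambda>k. (cl M (q x) - cl M (g k x))\<^sup>2) \<longlonglongrightarrow> (cl M (q x) - cl M (q x))\<^sup>2"
        by (intro tendsto_intros)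
      then show "(\<lambda>k. (cl M (q x) - cl M (g k x))\<^sup>2) \<longlonglongrightarrow> 0" by simp
    qed
    show "AE x in circ. norm ((cl M (q x) - cl M (g k x))\<^sup>2) \<le> (2 * M)\<^sup>2" for k
    proof (rule AE_I2)
      fix x
      have "\<bar>cl M (q x) - cl M (g k x)\<bar> \<le> \<bar>2 * M\<bar>" by (auto simp: cl_def M_def)
      then show "norm ((cl M (q x) - cl M (g k x))\<^sup>2) \<le> (2 * M)\<^sup>2" by (simp only: abs_le_square_iff) simp
    qed
  qed (use clq gm in auto)
  then have "\<forall>\<^sub>F k in sequentially. integral\<^sup>L circ (\<lambda>x. (cl M (q x) - cl M (g k x))\<^sup>2) < \<epsilon> / 4"
    using \<open>0 < \<epsilon>\<close> by (intro order_tendstoD(2)[where a = "\<epsilon> / 4"]) auto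
  then obtain k where k: "integral\<^sup>L circ (\<lambda>x. (cl M (q x) - cl M (g k x))\<^sup>2) < \<epsilon> / 4"
    by (meson eventually_sequentially order_refl)
  define h where "h x = cl M (g k x)" for x
  have bounded: "integrable circ (\<lambda>x. (f x)\<^sup>2)" if "f \<in> borel_measurable circ" "\<And>x. \<bar>f x\<bar> \<le> M" for f :: "real \<Rightarrow> real"
  proof (rule circ.integrable_const_bound[of _ "M\<^sup>2"])
    show "AE x in circ. norm ((f x)\<^sup>2) \<le> M\<^sup>2"
    proof (rule AE_I2)
      fix x
      have "\<bar>f x\<bar> \<le> \<bar>M\<bar>" using that(2)[of x] by linarith
      then show "norm ((f x)\<^sup>2) \<le> M\<^sup>2" by (simp only: abs_le_square_iff) simp
    qed
  qed (use that in auto)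
  have clM: "\<bar>cl M y\<bar> \<le> M" for y by (auto simp: cl_def M_def)
  have i1: "integrable circ (\<lambda>x. (cl M (q x))\<^sup>2)" by (rule bounded[OF clq clM])
  have i2: "integrable circ (\<lambda>x. (h x)\<^sup>2)" unfolding h_def by (rule bounded[OF gm clM])
  have hm: "h \<in> borel_measurable circ" using gm[of k] by (simp add: h_def[abs_def])
  have "integral\<^sup>L circ (\<lambda>x. (q x - h x)\<^sup>2) \<le>
      integral\<^sup>L circ (\<lambda>x. 2 * (q x - cl M (q x))\<^sup>2 + 2 * (cl M (q x) - h x)\<^sup>2)"
    by (intro integral_mono Bochner_Integration.integrable_add integrable_mult_right
        square_integrable_diff qm clq hm q(2) i1 i2 square_triangle_le)
  also have "\<dots> = 2 * integral\<^sup>L circ (\<lambda>x. (q x - cl M (q x))\<^sup>2) + 2 * integral\<^sup>L circ (\<lambda>x. (cl M (q x) - h x)\<^sup>2)"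
    by (simp add: square_integrable_diff qm clq hm q(2) i1 i2)
  also have "\<dots> < \<epsilon>"
    using n k by (simp add: M_def h_def)
  finally have "integral\<^sup>L circ (\<lambda>x. (q x - h x)\<^sup>2) < \<epsilon>" .
  moreover have "continuous_on UNIV h"
    unfolding h_def by (intro continuous_on_compose2[OF cl_cont g]) auto
  ultimately show ?thesis using that by blast
qed

text \<open>The factor \<open>(1 - (2x - 1)\<^bsup>2m\<^esup>)\<^sup>2\<close> makes a polynomial match to first order at the endpoints.\<close>

lemma periodic_polynomial_approximation:
  fixes p :: "real \<Rightarrow> real"
  assumes p: "real_polynomial_function p" and "0 < \<epsilon>"
  obtains f f' f'' where "\<And>x. (f has_real_derivative f' x) (at x)"
    "\<And>x. (f' has_real_derivative f'' x) (at x)" "continuous_on UNIV f''"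
    "f 0 = f 1" "f' 0 = f' 1" "integral\<^sup>L circ (\<lambda>x. (p x - f x)\<^sup>2) < \<epsilon>"
proof -
  define cut where "cut m x = 1 - (2 * x - 1) ^ (2 * m)" for m and x :: real
  have cp: "continuous_on S p" for S
    by (rule continuous_on_polymonial_function) (use p in \<open>simp add: real_polynomial_function_eq\<close>)
  have cf: "continuous_on S (\<lambda>x. p x * (cut m x)\<^sup>2)" for S m
    unfolding cut_def by (intro continuous_intros cp)
  have chi: "0 \<le> cut m x" "cut m x \<le> 1" if "x \<in> {0..1}" for m x
  proof -
    have "\<bar>2 * x - 1\<bar> ^ (2 * m) \<le> 1" using that by (intro power_le_one) auto
    then show "0 \<le> cut m x" "cut m x \<le> 1" by (simp_all add: cut_def power_even_abs)
  qed
  have "(\<lambda>m. integral\<^sup>L circ (\<lambda>x. (p x - p x * (cut m x)\<^sup>2)\<^sup>2)) \<longlonglongrightarrow> integral\<^sup>L circ (\<lambda>x. 0 :: real)"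
  proof (rule integral_dominated_convergence[where w = "\<lambda>x. (p x)\<^sup>2"])
    \<comment> \<open>The cut-off factor tends to 1 strictly inside the interval; the two endpoints
      are null.\<close>
    have "AE x in lebesgue. x \<notin> {0, 1 :: real}"
      by (rule AE_not_in) (simp add: negligible_iff_null_sets[symmetric])
    then have "AE x in circ. x \<notin> {0, 1}" by (rule AE_circ)
    then show "AE x in circ. (\<lambda>m. (p x - p x * (cut m x)\<^sup>2)\<^sup>2) \<longlonglongrightarrow> 0"
    proof (rule AE_mp, intro AE_I2 impI)
      fix x :: real assume "x \<in> space circ" "x \<notin> {0, 1}"
      then have "\<bar>(2 * x - 1)\<^sup>2\<bar> < 1"
        using abs_square_less_1[of "2 * x - 1"] by auto
      then have lim0: "(\<lambda>m. ((2 * x - 1)\<^sup>2) ^ m) \<longlonglongrightarrow> 0"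
        using LIMSEQ_power_zero[of "(2 * x - 1)\<^sup>2"] by simp
      have "(\<lambda>m. (p x - p x * (1 - ((2 * x - 1)\<^sup>2) ^ m)\<^sup>2)\<^sup>2) \<longlonglongrightarrow> (p x - p x * (1 - 0)\<^sup>2)\<^sup>2"
        by (intro tendsto_power tendsto_diff tendsto_mult tendsto_const lim0)
      then show "(\<lambda>m. (p x - p x * (cut m x)\<^sup>2)\<^sup>2) \<longlonglongrightarrow> 0"
        by (simp add: cut_def power_mult)
    qed
    show "AE x in circ. norm ((p x - p x * (cut m x)\<^sup>2)\<^sup>2) \<le> (p x)\<^sup>2" for m
    proof (rule AE_I2)
      fix x assume "x \<in> space circ"
      then have "0 \<le> cut m x" "cut m x \<le> 1" using chi[of x m] by auto
      then have "0 \<le> 1 - (cut m x)\<^sup>2" "1 - (cut m x)\<^sup>2 \<le> 1" by (auto simp: power_le_one)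
      then have "\<bar>p x * (1 - (cut m x)\<^sup>2)\<bar> \<le> \<bar>p x\<bar>"
        by (simp add: abs_mult mult_left_le)
      then show "norm ((p x - p x * (cut m x)\<^sup>2)\<^sup>2) \<le> (p x)\<^sup>2"
        by (simp add: abs_le_square_iff right_diff_distrib)
    qed
    show "(\<lambda>x. (p x - p x * (cut m x)\<^sup>2)\<^sup>2) \<in> borel_measurable circ" for m
      by (intro borel_measurable_circ_continuous continuous_intros cp cf)
    show "integrable circ (\<lambda>x. (p x)\<^sup>2)"
      by (intro integrable_circ_continuous continuous_intros cp)
  qed simp
  then have "\<forall>\<^sub>F m in sequentially. integral\<^sup>L circ (\<lambda>x. (p x - p x * (cut m x)\<^sup>2)\<^sup>2) < \<epsilon>"
    using \<open>0 < \<epsilon>\<close> by (intro order_tendstoD(2)[where a = \<epsilon>]) auto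
  then obtain m0 where "\<And>m. m0 \<le> m \<Longrightarrow> integral\<^sup>L circ (\<lambda>x. (p x - p x * (cut m x)\<^sup>2)\<^sup>2) < \<epsilon>"
    by (auto simp: eventually_sequentially)
  then obtain m where m: "0 < m" "integral\<^sup>L circ (\<lambda>x. (p x - p x * (cut m x)\<^sup>2)\<^sup>2) < \<epsilon>"
    by (metis le_add1 zero_less_Suc add_Suc_right)
  define f where "f x = p x * (cut m x)\<^sup>2" for x
  have "real_polynomial_function f"
    unfolding f_def[abs_def] cut_def
    by (intro real_polynomial_function.intros p real_polynomial_function_power real_polynomial_function_diff
        bounded_linear_ident)
  then obtain f' where f': "real_polynomial_function f'" "\<And>x. (f has_real_derivative f' x) (at x)"
    using has_real_derivative_polynomial_function by metis
  then obtain f'' where f'': "real_polynomial_function f''" "\<And>x. (f' has_real_derivative f'' x) (at x)"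
    using has_real_derivative_polynomial_function by metis
  have "continuous_on UNIV f''"
    by (rule continuous_on_polymonial_function) (use f'' in \<open>simp add: real_polynomial_function_eq\<close>)
  moreover have chi01: "cut m 0 = 0" "cut m 1 = 0" using m by (simp_all add: cut_def)
  then have "f 0 = f 1" by (simp add: f_def)
  \<comment> \<open>The factor \<open>cut m\<close> enters squared, so every term of the derivative
    keeps one copy and \<open>f'\<close> vanishes at both ends.\<close>
  moreover have "f' 0 = f' 1"
  proof -
    obtain p' where p': "\<And>x. (p has_real_derivative p' x) (at x)"
      using has_real_derivative_polynomial_function[OF p] by metis
    have chi': "(cut m has_real_derivative (- (real (2 * m) * (2 * x - 1) ^ (2 * m - 1) * 2))) (at x)" for x
      unfolding cut_def by (auto intro!: derivative_eq_intros)
    have "(f has_real_derivative p' x * (cut m x)\<^sup>2 + p x * (2 * cut m x *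
        (- (real (2 * m) * (2 * x - 1) ^ (2 * m - 1) * 2)))) (at x)" for x
      unfolding f_def by (rule derivative_eq_intros p' chi' refl | simp)+
    then have "f' x = p' x * (cut m x)\<^sup>2 + p x * (2 * cut m x *
        (- (real (2 * m) * (2 * x - 1) ^ (2 * m - 1) * 2)))" for x
      using f'(2) DERIV_unique by blast
    then show ?thesis by (simp add: chi01)
  qed
  moreover have "integral\<^sup>L circ (\<lambda>x. (p x - f x)\<^sup>2) < \<epsilon>"
    using m(2) by (simp add: f_def)
  ultimately show ?thesis using that f'(2) f''(2) by blast
qed

text \<open>Matching \<open>f\<close> and \<open>f'\<close> at the endpoints permits two
  integrations by parts, and the resulting quadratic decay gives uniform convergence. The mean is
  split off so that the approximating polynomial has no frequency 0.\<close>

lemma trig_poly_approximation: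
  fixes f f' f'' :: "real \<Rightarrow> real"
  assumes f': "\<And>x. (f has_real_derivative f' x) (at x)"
    and f'': "\<And>x. (f' has_real_derivative f'' x) (at x)" and cf'': "continuous_on UNIV f''"
    and per: "f 0 = f 1" "f' 0 = f' 1" and "0 < \<epsilon>"
  obtains K where "finite K" "0 \<notin> K"
    "\<And>x. x \<in> {0..1} \<Longrightarrow> \<bar>f x - integral\<^sup>L circ f - trig_poly K (fc (\<lambda>x. of_real (f x))) x\<bar> \<le> \<epsilon>"
proof -
  let ?f = "\<lambda>x. complex_of_real (f x)"
  have cf: "continuous_on S f" "continuous_on S f'" "continuous_on S f''" for S
    using f' f'' cf'' by (auto intro: DERIV_continuous_on has_field_derivative_at_within continuous_on_subset)
  have bdd: "\<exists>A. \<forall>x\<in>{0..1::real}. \<bar>g x\<bar> \<le> A" if "continuous_on {0..1} g" for g :: "real \<Rightarrow> real"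
    using compact_imp_bounded[OF compact_continuous_image[OF that compact_Icc]]
    by (auto simp: bounded_iff)
  obtain A where A: "\<And>x. x \<in> {0..1} \<Longrightarrow> \<bar>f'' x\<bar> \<le> A" using bdd[OF cf(3)] by blast
  obtain L where L: "\<And>x. x \<in> {0..1} \<Longrightarrow> \<bar>f' x\<bar> \<le> L" using bdd[OF cf(2)] by blast
  have A0: "0 \<le> A" using A[of 0] by simp
  have d1: "fc (\<lambda>x. of_real (f' x)) k = 2 * pi * \<i> * of_int k * fc ?f k" for k
    by (rule fc_deriv, rule has_vector_derivative_at_within[OF has_vector_derivative_of_real[OF f']])
       (use per cf in \<open>auto intro!: continuous_on_of_real\<close>)
  have d2: "fc (\<lambda>x. of_real (f'' x)) k = 2 * pi * \<i> * of_int k * fc (\<lambda>x. of_real (f' x)) k" for k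
    by (rule fc_deriv, rule has_vector_derivative_at_within[OF has_vector_derivative_of_real[OF f'']])
       (use per cf in \<open>auto intro!: continuous_on_of_real\<close>)
  have decay: "cmod (fc ?f k) \<le> A / \<bar>real_of_int k\<bar> ^ (0 + 2)" if "k \<noteq> 0" for k
  proof -
    have "1 ^ 2 \<le> (2 * pi) ^ 2"
      using six_le_two_pi by (intro power_mono) auto
    then have "1 * (\<bar>real_of_int k\<bar> ^ 2 * cmod (fc ?f k)) \<le> (2 * pi) ^ 2 * (\<bar>real_of_int k\<bar> ^ 2 * cmod (fc ?f k))"
      by (intro mult_right_mono) auto
    also have "\<dots> = cmod (fc (\<lambda>x. of_real (f'' x)) k)"
      unfolding d2 d1 by (simp add: norm_mult power2_eq_square)
    also have "\<dots> \<le> A"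
      by (rule norm_fc_le) (simp add: A)
    finally have "cmod (fc ?f k) \<le> A / \<bar>real_of_int k\<bar> ^ 2"
      using that by (simp add: pos_le_divide_eq mult.commute)
    then show ?thesis unfolding add_0 .
  qed
  obtain N0 :: nat where N0: "2 * A / \<epsilon> \<le> real N0" using real_arch_simple by blast
  define N where "N = Suc N0"
  have N: "0 < N" "2 * A / \<epsilon> \<le> real N" using N0 by (auto simp: N_def)
  have "\<bar>f x - integral\<^sup>L circ f - trig_poly (freqs N) (fc ?f) x\<bar> \<le> \<epsilon>" if x: "x \<in> {0..1}" for x
  proof -
    have "cmod (?f x - fourier_sum {- int N..int N} ?f x) \<le> 2 * A / real N ^ (0 + 1)"
    proof (rule fourier_sum_tail_le[OF fourier_sum_tendsto])
      fix y z :: real assume yz: "y \<in> {0..1}" "z \<in> {0..1}"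
      have "norm (f y - f z) \<le> L * norm (y - z)"
        by (rule field_differentiable_bound[of "{0..1}"])
           (use L yz f' in \<open>auto intro: DERIV_subset\<close>)
      then show "cmod (?f y - ?f z) \<le> L * \<bar>y - z\<bar>"
        by (simp flip: of_real_diff)
    qed (use x N per decay in auto)
    also have "\<dots> \<le> \<epsilon>"
      using N \<open>0 < \<epsilon>\<close> by (simp add: field_simps)
    finally have "cmod (?f x - fourier_sum {- int N..int N} ?f x) \<le> \<epsilon>" .
    moreover have "fourier_sum {- int N..int N} ?f x =
        complex_of_real (integral\<^sup>L circ f) + (\<Sum>k\<in>freqs N. fc ?f k * cis (2 * pi * of_int k * x))"
    proof -
      have "fc ?f 0 = complex_of_real (integral\<^sup>L circ f)" by (simp add: fc_def)
      then show ?thesis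
        unfolding fourier_sum_def freqs_def by (subst sum.remove[of _ 0]) auto
    qed
    ultimately have "cmod (?f x - complex_of_real (integral\<^sup>L circ f)
        - (\<Sum>k\<in>freqs N. fc ?f k * cis (2 * pi * of_int k * x))) \<le> \<epsilon>"
      by (simp add: algebra_simps)
    then have "\<bar>Re (?f x - complex_of_real (integral\<^sup>L circ f)
        - (\<Sum>k\<in>freqs N. fc ?f k * cis (2 * pi * of_int k * x)))\<bar> \<le> \<epsilon>"
      using abs_Re_le_cmod order_trans by blast
    then show ?thesis by (simp add: trig_poly_def)
  qed
  moreover have "finite (freqs N)" "0 \<notin> freqs N" by (simp_all add: freqs_def)
  ultimately show ?thesis using that by blast
qed


lemma l2norm_less_iff: "0 < d \<Longrightarrow> l2norm f < d \<longleftrightarrow> integral\<^sup>L circ (\<lambda>x. (f x)\<^sup>2) < d\<^sup>2"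
  unfolding l2norm_circ using real_less_lsqrt real_sqrt_less_iff[of _ "d\<^sup>2"] by force

lemma smooth_dense:
  assumes q: "q \<in> L20" and "0 < d"
  obtains p where "p \<in> L20" "smooth_circle p" "l2norm (\<lambda>x. p x - q x) < d"
proof -
  have qL: "q \<in> L2_circle" and q0: "integral\<^sup>L circ q = 0"
    using q by (simp_all add: L20_def set_integral_circ)
  have qm: "q \<in> borel_measurable circ" and qi: "integrable circ (\<lambda>x. (q x)\<^sup>2)"
    by (rule L2_circle_measurable[OF qL], rule L2_circle_square_integrable[OF qL])
  \<comment> \<open>Squared errors in units of \<open>\<epsilon>\<close>: 2 + 4 + 4 = 10 from
    \<open>q\<close> to \<open>f\<close>, then 44 + 2 * 10 = 64 from \<open>q\<close> to
    \<open>p\<close>, which is below 100.\<close>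
  define \<epsilon> where "\<epsilon> = d\<^sup>2 / 100"
  have \<epsilon>: "0 < \<epsilon>" using \<open>0 < d\<close> by (simp add: \<epsilon>_def)
  obtain h where h: "continuous_on UNIV h" "integral\<^sup>L circ (\<lambda>x. (q x - h x)\<^sup>2) < \<epsilon>"
    using continuous_approximation[OF _ qi \<epsilon>] qL by (auto simp: L2_circle_def)
  obtain g where g: "real_polynomial_function g" "\<And>x. x \<in> {0..1} \<Longrightarrow> \<bar>h x - g x\<bar> < sqrt \<epsilon>"
    using Stone_Weierstrass_real_polynomial_function[of "{0..1::real}" h "sqrt \<epsilon>"] h \<epsilon>
    by (metis compact_Icc continuous_on_subset real_sqrt_gt_zero top_greatest)
  obtain f f' f'' where f: "\<And>x. (f has_real_derivative f' x) (at x)"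
    "\<And>x. (f' has_real_derivative f'' x) (at x)" "continuous_on UNIV f''"
    "f 0 = f 1" "f' 0 = f' 1" "integral\<^sup>L circ (\<lambda>x. (g x - f x)\<^sup>2) < \<epsilon>"
    using periodic_polynomial_approximation[OF g(1) \<epsilon>] by blast
  obtain K where K: "finite K" "0 \<notin> K"
    "\<And>x. x \<in> {0..1} \<Longrightarrow> \<bar>f x - integral\<^sup>L circ f - trig_poly K (fc (\<lambda>x. of_real (f x))) x\<bar> \<le> sqrt \<epsilon>"
    using trig_poly_approximation[OF f(1-5), of "sqrt \<epsilon>"] \<epsilon> by (metis real_sqrt_gt_zero)
  define p where "p = trig_poly K (fc (\<lambda>x. of_real (f x)))"
  have ch: "continuous_on {0..1} h" and cg: "continuous_on {0..1} g" and cf: "continuous_on {0..1} f"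
    and cp: "continuous_on {0..1} p"
    using h(1) f(1) g(1)
    by (auto intro: continuous_on_subset DERIV_continuous_on has_field_derivative_at_within
        continuous_on_polymonial_function simp: p_def continuous_trig_poly real_polynomial_function_eq)
  note m = ch[THEN borel_measurable_circ_continuous] cg[THEN borel_measurable_circ_continuous]
    cf[THEN borel_measurable_circ_continuous] cp[THEN borel_measurable_circ_continuous]
  have sq: "integrable circ (\<lambda>x. (r x)\<^sup>2)" if "continuous_on {0..1} r" for r :: "real \<Rightarrow> real"
    by (intro integrable_circ_continuous continuous_on_power that)
  have qf_int: "integrable circ (\<lambda>x. (q x - f x)\<^sup>2)"
    by (rule square_integrable_diff[OF qm m(3) qi sq[OF cf]])
  have qf: "integral\<^sup>L circ (\<lambda>x. (q x - f x)\<^sup>2) \<le> 10 * \<epsilon>"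
  proof -
    have i1: "integrable circ (\<lambda>x. (q x - h x)\<^sup>2)" and i2: "integrable circ (\<lambda>x. (g x - f x)\<^sup>2)"
      by (rule square_integrable_diff[OF qm m(1) qi sq[OF ch]],
          rule square_integrable_diff[OF m(2,3) sq[OF cg] sq[OF cf]])
    have "integral\<^sup>L circ (\<lambda>x. (q x - f x)\<^sup>2) \<le>
        integral\<^sup>L circ (\<lambda>x. 2 * (q x - h x)\<^sup>2 + 4 * \<epsilon> + 4 * (g x - f x)\<^sup>2)"
    proof (rule integral_mono[OF qf_int])
      show "integrable circ (\<lambda>x. 2 * (q x - h x)\<^sup>2 + 4 * \<epsilon> + 4 * (g x - f x)\<^sup>2)"
        using i1 i2 by simp
      fix x assume "x \<in> space circ"
      then have "\<bar>h x - g x\<bar> \<le> sqrt \<epsilon>" using g(2)[of x] by (simp add: less_imp_le)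
      then have "\<bar>h x - g x\<bar>\<^sup>2 \<le> (sqrt \<epsilon>)\<^sup>2" by (intro power_mono) auto
      then have "(h x - g x)\<^sup>2 \<le> \<epsilon>" using \<epsilon> by simp
      then show "(q x - f x)\<^sup>2 \<le> 2 * (q x - h x)\<^sup>2 + 4 * \<epsilon> + 4 * (g x - f x)\<^sup>2"
        using square_triangle_le[of "q x" "f x" "h x"] square_triangle_le[of "h x" "f x" "g x"] by linarith
    qed
    also have "\<dots> = 2 * integral\<^sup>L circ (\<lambda>x. (q x - h x)\<^sup>2) + 4 * \<epsilon> + 4 * integral\<^sup>L circ (\<lambda>x. (g x - f x)\<^sup>2)"
      using i1 i2 by simp
    also have "\<dots> \<le> 10 * \<epsilon>" using h(2) f(6) by linarith
    finally show ?thesis .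
  qed
  \<comment> \<open>The mean of \<open>q\<close> is 0, so the mean of \<open>f\<close> is controlled
    by the distance from \<open>f\<close> to \<open>q\<close>.\<close>
  have "(integral\<^sup>L circ f)\<^sup>2 \<le> 10 * \<epsilon>"
  proof -
    have "integral\<^sup>L circ (\<lambda>x. q x - f x) = - integral\<^sup>L circ f"
      using circ.square_integrable_imp_integrable[OF qm qi] integrable_circ_continuous[OF cf] q0 by simp
    then have "(integral\<^sup>L circ f)\<^sup>2 = (integral\<^sup>L circ (\<lambda>x. q x - f x))\<^sup>2" by simp
    also have "\<dots> \<le> integral\<^sup>L circ (\<lambda>x. (q x - f x)\<^sup>2)"
      by (rule square_integral_le) (use qm m qf_int in auto)
    finally show ?thesis using qf by simp
  qed
  then have int_f: "(integral\<^sup>L circ f)\<^sup>2 \<le> 10 * \<epsilon>" .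
  have pq_int: "integrable circ (\<lambda>x. (p x - q x)\<^sup>2)"
    by (rule square_integrable_diff[OF m(4) qm sq[OF cp] qi])
  have "integral\<^sup>L circ (\<lambda>x. (p x - q x)\<^sup>2) \<le> integral\<^sup>L circ (\<lambda>x. 4 * \<epsilon> + 40 * \<epsilon> + 2 * (q x - f x)\<^sup>2)"
  proof (rule integral_mono[OF pq_int])
    show "integrable circ (\<lambda>x. 4 * \<epsilon> + 40 * \<epsilon> + 2 * (q x - f x)\<^sup>2)" using qf_int by simp
    fix x assume "x \<in> space circ"
    then have "\<bar>f x - integral\<^sup>L circ f - p x\<bar> \<le> sqrt \<epsilon>" using K(3)[of x] by (simp add: p_def)
    then have "\<bar>f x - integral\<^sup>L circ f - p x\<bar>\<^sup>2 \<le> (sqrt \<epsilon>)\<^sup>2" by (intro power_mono) auto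
    then have "(p x - (f x - integral\<^sup>L circ f))\<^sup>2 \<le> \<epsilon>" using \<epsilon> by (simp add: power2_commute)
    then have "(p x - f x)\<^sup>2 \<le> 2 * \<epsilon> + 2 * (10 * \<epsilon>)"
      using square_triangle_le[of "p x" "f x" "f x - integral\<^sup>L circ f"] int_f by simp
    then show "(p x - q x)\<^sup>2 \<le> 4 * \<epsilon> + 40 * \<epsilon> + 2 * (q x - f x)\<^sup>2"
      using square_triangle_le[of "p x" "q x" "f x"] power2_commute[of "f x" "q x"] by linarith
  qed
  also have "\<dots> = 44 * \<epsilon> + 2 * integral\<^sup>L circ (\<lambda>x. (q x - f x)\<^sup>2)"
    using qf_int by simp
  also have "\<dots> \<le> 64 * \<epsilon>" using qf by linarith
  also have "\<dots> < d\<^sup>2" using \<open>0 < d\<close> by (simp add: \<epsilon>_def)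
  finally have "l2norm (\<lambda>x. p x - q x) < d"
    using \<open>0 < d\<close> by (simp add: l2norm_less_iff)
  moreover have sp: "smooth_circle p" unfolding p_def by (rule smooth_circle_trig_poly)
  moreover have "p \<in> L20"
  proof -
    have "continuous_on UNIV p" unfolding p_def by (rule continuous_trig_poly)
    then have "p \<in> borel_measurable lebesgue"
      by (intro measurable_completion) (simp add: borel_measurable_continuous_onI)
    moreover have "integral\<^sup>L circ p = 0"
    proof -
      have int: "integrable circ (\<lambda>x. \<Sum>k\<in>K. fc (\<lambda>x. of_real (f x)) k * cis (2 * pi * of_int k * x))"
        by (intro integrable_circ_continuous continuous_intros)
      have "integral\<^sup>L circ (\<lambda>x. \<Sum>k\<in>K. fc (\<lambda>x. of_real (f x)) k * cis (2 * pi * of_int k * x)) =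
          (\<Sum>k\<in>K. fc (\<lambda>x. of_real (f x)) k * (if k = 0 then 1 else 0))"
        unfolding integral_circ_cis[symmetric]
        by (simp add: Bochner_Integration.integral_sum integrable_circ_continuous continuous_intros)
      also have "\<dots> = 0" using K(2) by (intro sum.neutral) auto
      finally show ?thesis
        unfolding p_def trig_poly_def[abs_def] using integral_Re[OF int] by simp
    qed
    ultimately show ?thesis
      using sp sq[OF cp]
      by (simp add: L20_def L2_circle_def set_integral_circ set_integrable_circ smooth_circle_def)
  qed
  ultimately show ?thesis using that by blast
qed

section \<open>Limit of smooth solutions\<close>

lemma (in fourier_system) energy_mono: "E \<le> E' \<Longrightarrow> fourier_system c w E'"
  by unfold_locales (rule deriv cont_w c_uminus error | rule order_trans[OF energy]; assumption)+

lemma L2_circle_integrable: "f \<in> L2_circle \<Longrightarrow> integrable circ f"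
  by (rule circ.square_integrable_imp_integrable[OF L2_circle_measurable L2_circle_square_integrable])

lemma fourier_coeff_diff:
  assumes "f \<in> L2_circle" "g \<in> L2_circle"
  shows "fourier_coeff (\<lambda>x. f x - g x) k = fourier_coeff f k - fourier_coeff g k"
proof -
  have "integrable circ (\<lambda>x. complex_of_real (h x) * cis (- 2 * pi * of_int k * x))" if "h \<in> L2_circle" for h
    by (rule integrable_circ_mult_cis[OF integrable_of_real[OF L2_circle_integrable[OF that]]])
  then show ?thesis
    unfolding fourier_coeff_fc fc_def using assms
    by (subst Bochner_Integration.integral_diff[symmetric]) (auto simp: algebra_simps)
qed

lemma norm_fourier_coeff_le:
  assumes "f \<in> L2_circle"
  shows "cmod (fourier_coeff f k) \<le> l2norm f"
proof -
  have m: "(\<lambda>x. complex_of_real (f x)) \<in> borel_measurable circ"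
    using L2_circle_measurable[OF assms] by simp
  have "(\<Sum>k\<in>{k}. (cmod (fc (\<lambda>x. of_real (f x)) k))\<^sup>2) \<le> integral\<^sup>L circ (\<lambda>x. (cmod (of_real (f x)))\<^sup>2)"
    by (rule bessel) (use m L2_circle_square_integrable[OF assms] in auto)
  then have "(cmod (fourier_coeff f k))\<^sup>2 \<le> (l2norm f)\<^sup>2"
    by (simp add: fourier_coeff_fc l2norm_square)
  then show ?thesis
    by (rule power2_le_imp_le) (simp add: l2norm_circ Bochner_Integration.integral_nonneg)
qed

lemma fourier_coeff_diff_le:
  assumes "f \<in> L2_circle" "g \<in> L2_circle"
  shows "cmod (fourier_coeff f k - fourier_coeff g k) \<le> l2norm (\<lambda>x. f x - g x)"
  using norm_fourier_coeff_le[OF L2_circle_diff[OF assms]] by (simp add: fourier_coeff_diff[OF assms])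

lemma fourier_coeff_cong_AE:
  assumes "f \<in> L2_circle" "AE x in lebesgue. f x = g x" "g \<in> borel_measurable circ"
  shows "fourier_coeff f k = fourier_coeff g k"
  unfolding fourier_coeff_fc fc_def
proof (rule Bochner_Integration.integral_cong_AE)
  show "(\<lambda>x. complex_of_real (f x) * cis (- 2 * pi * of_int k * x)) \<in> borel_measurable circ"
    "(\<lambda>x. complex_of_real (g x) * cis (- 2 * pi * of_int k * x)) \<in> borel_measurable circ"
    using L2_circle_measurable[OF assms(1)] assms(3)
    by (intro borel_measurable_times borel_measurable_of_real borel_measurable_circ_cis; simp)+
  show "AE x in circ. complex_of_real (f x) * cis (- 2 * pi * of_int k * x) =
      complex_of_real (g x) * cis (- 2 * pi * of_int k * x)"
    by (rule AE_mp[OF AE_circ[OF assms(2)]]) (auto intro!: AE_I2)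
qed

lemma l2norm_square_le:
  assumes "f \<in> L2_circle" "g \<in> L2_circle"
  shows "(l2norm f)\<^sup>2 \<le> 2 * (l2norm (\<lambda>x. f x - g x))\<^sup>2 + 2 * (l2norm g)\<^sup>2"
proof -
  have i: "integrable circ (\<lambda>x. (f x - g x)\<^sup>2)" "integrable circ (\<lambda>x. (g x)\<^sup>2)" "integrable circ (\<lambda>x. (f x)\<^sup>2)"
    using L2_circle_square_integrable L2_circle_diff assms by auto
  have "integral\<^sup>L circ (\<lambda>x. (f x)\<^sup>2) \<le> integral\<^sup>L circ (\<lambda>x. 2 * (f x - g x)\<^sup>2 + 2 * (g x)\<^sup>2)"
    by (rule integral_mono) (use i square_triangle_le[of "f x" 0 "g x" for x] in auto)
  then show ?thesis using i by (simp add: l2norm_square)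
qed

text \<open>Testing with cosine and sine turns the weak equation into a rotation of the two real
  coefficients \<open>C\<close> and \<open>D\<close>; after multiplication by
  \<open>cis (- l * t)\<close> their complex combination is constant.\<close>

lemma linear_solution_fourier_coeff:
  assumes "linear_solution q v" "q \<in> L20"
  shows "fourier_coeff (v t) k = cis ((2 * pi)^3 * of_int k^3 * t) * fourier_coeff q k"
proof -
  define \<phi> where "\<phi> = trig_poly {k} (\<lambda>_. 1)"
  define \<psi> where "\<psi> = trig_poly {k} (\<lambda>_. - \<i>)"
  have vL: "v t \<in> L2_circle" for t
    using assms by (simp add: linear_solution_def)
  have \<phi>: "\<phi> x = cos (2 * pi * of_int k * x)" and \<psi>: "\<psi> x = sin (2 * pi * of_int k * x)" for x
    by (simp_all add: \<phi>_def \<psi>_def trig_poly_def)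
  have \<phi>3: "(deriv ^^ 3) \<phi> x = (2 * pi * of_int k)^3 * \<psi> x"
    and \<psi>3: "(deriv ^^ 3) \<psi> x = - ((2 * pi * of_int k)^3) * \<phi> x" for x
    unfolding \<phi>_def \<psi>_def higher_deriv_trig_poly
    by (simp_all add: trig_poly_def power_mult_distrib power3_eq_cube)
  have int: "integrable circ (\<lambda>x. v t x * r x)" if "continuous_on UNIV r" "\<And>x. \<bar>r x\<bar> \<le> 1" for t r
  proof (rule Bochner_Integration.integrable_bound)
    show "integrable circ (v t)"
      by (rule L2_circle_integrable[OF vL])
    show "(\<lambda>x. v t x * r x) \<in> borel_measurable circ"
      using L2_circle_measurable[OF vL] borel_measurable_circ_continuous[OF continuous_on_subset[OF that(1)]] by simp
    show "AE x in circ. norm (v t x * r x) \<le> norm (v t x)"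
      using that(2) by (intro AE_I2) (simp add: abs_mult mult_left_le)
  qed
  have int\<phi>: "integrable circ (\<lambda>x. v t x * \<phi> x)" and int\<psi>: "integrable circ (\<lambda>x. v t x * \<psi> x)" for t
    by (rule int; simp add: \<phi> \<psi> continuous_intros)+
  define C where "C t = integral\<^sup>L circ (\<lambda>x. v t x * \<phi> x)" for t
  define D where "D t = integral\<^sup>L circ (\<lambda>x. v t x * \<psi> x)" for t
  define l where "l = (2 * pi * of_int k)^3"
  have d: "((\<lambda>s. integral\<^sup>L circ (\<lambda>x. v s x * r x)) has_real_derivative
      integral\<^sup>L circ (\<lambda>x. v t x * (deriv ^^ 3) r x)) (at t)" if "smooth_circle r" for r t
    using assms(1) that unfolding linear_solution_def set_integral_circ by blast
  have dC: "(C has_real_derivative l * D t) (at t)" for t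
  proof -
    have "integral\<^sup>L circ (\<lambda>x. v t x * (deriv ^^ 3) \<phi> x) = integral\<^sup>L circ (\<lambda>x. l * (v t x * \<psi> x))"
      by (simp add: \<phi>3 l_def mult_ac)
    then show ?thesis
      using d[of \<phi> t] smooth_circle_trig_poly by (simp add: C_def[abs_def] D_def \<phi>_def)
  qed
  have dD: "(D has_real_derivative - l * C t) (at t)" for t
  proof -
    have "integral\<^sup>L circ (\<lambda>x. v t x * (deriv ^^ 3) \<psi> x) = integral\<^sup>L circ (\<lambda>x. - l * (v t x * \<phi> x))"
      by (simp add: \<psi>3 l_def mult_ac)
    then show ?thesis
      using d[of \<psi> t] smooth_circle_trig_poly by (simp add: C_def D_def[abs_def] \<psi>_def)
  qed
  have c_eq: "fourier_coeff (v t) k = of_real (C t) - \<i> * of_real (D t)" for t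
  proof -
    have "fourier_coeff (v t) k = integral\<^sup>L circ (\<lambda>x. of_real (v t x * \<phi> x) - \<i> * of_real (v t x * \<psi> x))"
      unfolding fourier_coeff_fc fc_def
      by (rule Bochner_Integration.integral_cong) (auto simp: \<phi> \<psi> complex_eq_iff)
    also have "\<dots> = of_real (C t) - \<i> * of_real (D t)"
      unfolding C_def D_def integral_complex_of_real[symmetric] integral_mult_right_zero[symmetric]
      by (rule Bochner_Integration.integral_diff) (intro integrable_mult_right integrable_of_real int\<phi> int\<psi>)+
    finally show ?thesis .
  qed
  define Z where "Z t = cis (- l * t) * (of_real (C t) - \<i> * of_real (D t))" for t
  have "(Z has_vector_derivative 0) (at t)" for t
  proof -
    have "((\<lambda>t. of_real (C t) - \<i> * of_real (D t)) has_vector_derivative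
        (of_real (l * D t) - \<i> * of_real (- l * C t))) (at t)"
      by (intro has_vector_derivative_diff has_vector_derivative_mult_right has_vector_derivative_of_real dC dD)
    from has_vector_derivative_mult[OF has_vector_derivative_cis[of "- l" t UNIV] this]
    show ?thesis
      by (simp add: Z_def[abs_def] algebra_simps)
  qed
  then obtain z where z: "\<And>t. Z t = z"
    using has_vector_derivative_zero_constant[of UNIV Z] by auto
  have "Z t = fourier_coeff (v 0) k"
    using z[of t] z[of 0] by (simp add: Z_def c_eq)
  also have "fourier_coeff (v 0) k = fourier_coeff q k"
  proof (rule fourier_coeff_cong_AE[OF vL])
    show "AE x in lebesgue. v 0 x = q x" using assms by (simp add: linear_solution_def)
    show "q \<in> borel_measurable circ" using assms by (auto simp: L20_def L2_circle_measurable)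
  qed
  finally have "cis (- l * t) * fourier_coeff (v t) k = fourier_coeff q k"
    by (simp add: Z_def c_eq)
  then have "(cis (l * t) * cis (- l * t)) * fourier_coeff (v t) k = cis (l * t) * fourier_coeff q k"
    by (simp only: mult.assoc)
  also have "cis (l * t) * cis (- l * t) = 1" by (simp add: cis_mult)
  finally show ?thesis
    unfolding l_def power_mult_distrib by simp
qed

text \<open>Measurability is recorded because \<open>kdv_solution_map\<close> relates
  \<open>S\<close> to the classical solution only almost everywhere.\<close>

lemma classical_smoothing:
  assumes u: "classical_kdv_solution p u" and p: "p \<in> L20" and E: "(l2norm p)\<^sup>2 \<le> E" and K: "finite K"
  shows "sqn K (\<lambda>k. of_int k * (cis (- ((2 * pi)^3 * of_int k^3 * t)) * fourier_coeff (u t) k - fourier_coeff p k))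
    \<le> smoothing_const (2 * pi) E * (1 + \<bar>t\<bar>)\<^sup>2" and "u t \<in> borel_measurable circ"
proof -
  obtain D where D0: "D 0 0 = u" and cont: "\<And>i j. continuous_on UNIV (\<lambda>(t, x). D i j t x)"
    and dt: "\<And>i j t x. ((\<lambda>s. D i j s x) has_real_derivative D (Suc i) j t x) (at t)"
    and dx: "\<And>i j t x. (D i j t has_real_derivative D i (Suc j) t x) (at x)"
    using u unfolding classical_kdv_solution_def smooth_time_circle_def by metis
  have u0: "u 0 = p"
    and eq: "deriv (\<lambda>s. u s x) t = - (deriv ^^ 3) (u t) x + 6 * u t x * deriv (u t) x" for t x
    using u unfolding classical_kdv_solution_def smooth_time_circle_def by auto
  have derx: "deriv (D i j t) = D i (Suc j) t" for i j t
    by (rule ext, rule DERIV_imp_deriv, rule dx)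
  interpret smooth_kdv D
  proof unfold_locales
    show "D 0 0 t (x + 1) = D 0 0 t x" for t x
      using u by (simp add: D0 classical_kdv_solution_def smooth_time_circle_def periodic1_def)
    show "D (Suc 0) 0 t x = - D 0 3 t x + 6 * D 0 0 t x * D 0 1 t x" for t x
    proof -
      have "deriv (\<lambda>s. D 0 0 s x) t = D (Suc 0) 0 t x"
        by (rule DERIV_imp_deriv) (rule dt)
      moreover have "(deriv ^^ 3) (D 0 0 t) = D 0 3 t"
        by (simp add: numeral_3_eq_3 derx)
      ultimately show ?thesis
        using eq[of x t] by (simp add: D0[symmetric] derx)
    qed
    show "integral\<^sup>L circ (D 0 0 0) = 0"
      using p by (simp add: D0 u0 L20_def set_integral_circ)
  qed (fact cont dt dx)+
  have "integral\<^sup>L circ (\<lambda>x. (D 0 0 0 x)\<^sup>2) \<le> E"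
    using E by (simp add: D0 u0 l2norm_square)
  then interpret F: fourier_system c w E
    by (rule fourier_system.energy_mono[OF fourier_system])
  have "c t k = fourier_coeff (u t) k" "c 0 k = fourier_coeff p k" for k
    by (simp_all add: c_def D0 u0 fourier_coeff_fc)
  then show "sqn K (\<lambda>k. of_int k * (cis (- ((2 * pi)^3 * of_int k^3 * t)) * fourier_coeff (u t) k - fourier_coeff p k))
    \<le> smoothing_const (2 * pi) E * (1 + \<bar>t\<bar>)\<^sup>2"
    using F.smoothing[OF K, of t] by simp
  show "u t \<in> borel_measurable circ"
    using borel_measurable_circ_continuous[OF cont_x[of _ 0 0 t]] by (simp add: D0)
qed

text \<open>Each coefficient is continuous in L2, so on a finite \<open>K\<close> the bound for
  smooth data passes to the limit. The slack in \<open>E\<close> covers data at distance at most 1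
  from \<open>q\<close>.\<close>

lemma smoothing_L20:
  assumes S: "kdv_solution_map S" and q: "q \<in> L20" and v: "linear_solution q v"
    and E: "2 * (l2norm q)\<^sup>2 + 2 \<le> E" and K: "finite K"
  shows "sqn K (\<lambda>k. of_int k * fourier_coeff (\<lambda>x. S q t x - v t x) k)
    \<le> smoothing_const (2 * pi) E * (1 + \<bar>t\<bar>)\<^sup>2"
proof -
  have L: "f \<in> L2_circle" if "f \<in> L20" for f using that by (simp add: L20_def)
  define T where "T = \<bar>t\<bar> + 1"
  have T: "0 < T" "t \<in> {-T..T}" by (auto simp: T_def)
  have SL: "S p t \<in> L20" if "p \<in> L20" for p
    using S T that unfolding kdv_solution_map_def by blast
  have vL: "v t \<in> L2_circle" using v by (simp add: linear_solution_def)
  have "\<exists>p. p \<in> L20 \<and> smooth_circle p \<and> l2norm (\<lambda>x. p x - q x) < 1 / real (Suc n)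
      \<and> l2norm (\<lambda>x. S p t x - S q t x) < 1 / real (Suc n)" for n
  proof -
    have "0 < 1 / real (Suc n)" by simp
    moreover have "\<forall>q\<in>L20. \<forall>\<epsilon>>0. \<exists>\<delta>>0. \<forall>p\<in>L20. l2norm (\<lambda>x. p x - q x) < \<delta> \<longrightarrow>
        (\<forall>t\<in>{-T..T}. l2norm (\<lambda>x. S p t x - S q t x) < \<epsilon>)"
      using S T(1) unfolding kdv_solution_map_def by simp
    ultimately obtain \<delta> where \<delta>: "0 < \<delta>" "\<And>p. p \<in> L20 \<Longrightarrow> l2norm (\<lambda>x. p x - q x) < \<delta> \<Longrightarrow>
        l2norm (\<lambda>x. S p t x - S q t x) < 1 / real (Suc n)"
      using q T(2) by meson
    then obtain p where "p \<in> L20" "smooth_circle p" "l2norm (\<lambda>x. p x - q x) < min \<delta> (1 / real (Suc n))"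
      using smooth_dense[OF q, of "min \<delta> (1 / real (Suc n))"] by auto
    then show ?thesis using \<delta>(2) by auto
  qed
  then obtain p where p: "\<And>n. p n \<in> L20" "\<And>n. smooth_circle (p n)"
      "\<And>n. l2norm (\<lambda>x. p n x - q x) < 1 / real (Suc n)"
      "\<And>n. l2norm (\<lambda>x. S (p n) t x - S q t x) < 1 / real (Suc n)"
    by metis
  have lim: "(\<lambda>n. fourier_coeff (f n) k) \<longlonglongrightarrow> fourier_coeff g k"
    if "\<And>n. f n \<in> L20" "g \<in> L20" "\<And>n. l2norm (\<lambda>x. f n x - g x) < 1 / real (Suc n)" for f g k
  proof (rule LIM_zero_cancel, rule Lim_null_comparison)
    show "\<forall>\<^sub>F n in sequentially. norm (fourier_coeff (f n) k - fourier_coeff g k) \<le> 1 / real (Suc n)"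
      using fourier_coeff_diff_le[OF L[OF that(1)] L[OF that(2)]] that(3)
      by (intro always_eventually allI) (meson less_imp_le order_trans)
    show "(\<lambda>n. 1 / real (Suc n)) \<longlonglongrightarrow> 0" using LIMSEQ_Suc[OF lim_1_over_n] by simp
  qed
  let ?e = "\<lambda>k. cis (- ((2 * pi)^3 * of_int k^3 * t))"
  have bound: "sqn K (\<lambda>k. of_int k * (?e k * fourier_coeff (S (p n) t) k - fourier_coeff (p n) k))
      \<le> smoothing_const (2 * pi) E * (1 + \<bar>t\<bar>)\<^sup>2" for n
  proof -
    obtain u where u: "classical_kdv_solution (p n) u" "\<And>t. AE x in lebesgue. S (p n) t x = u t x"
      using S p(1,2) unfolding kdv_solution_map_def by blast
    have "(l2norm (\<lambda>x. p n x - q x))\<^sup>2 \<le> 1"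
    proof -
      have "l2norm (\<lambda>x. p n x - q x) \<le> 1" using p(3)[of n] by (rule less_imp_le[OF less_le_trans]) simp
      then show ?thesis by (simp add: power_le_one l2norm_circ Bochner_Integration.integral_nonneg)
    qed
    then have "(l2norm (p n))\<^sup>2 \<le> E"
      using l2norm_square_le[OF L[OF p(1)[of n]] L[OF q]] E by linarith
    note cs = classical_smoothing[OF u(1) p(1) this K, of t]
    have "fourier_coeff (S (p n) t) k = fourier_coeff (u t) k" for k
      by (rule fourier_coeff_cong_AE[OF L[OF SL[OF p(1)]] u(2) cs(2)])
    then show ?thesis using cs(1) by simp
  qed
  have "(\<lambda>n. sqn K (\<lambda>k. of_int k * (?e k * fourier_coeff (S (p n) t) k - fourier_coeff (p n) k)))
      \<longlonglongrightarrow> sqn K (\<lambda>k. of_int k * (?e k * fourier_coeff (S q t) k - fourier_coeff q k))"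
    unfolding sqn_def
    by (intro tendsto_sum tendsto_power tendsto_norm tendsto_mult tendsto_diff tendsto_const lim p SL q)
  then have "sqn K (\<lambda>k. of_int k * (?e k * fourier_coeff (S q t) k - fourier_coeff q k))
      \<le> smoothing_const (2 * pi) E * (1 + \<bar>t\<bar>)\<^sup>2"
    by (rule LIMSEQ_le_const2) (use bound in auto)
  \<comment> \<open>The factor \<open>?e k\<close> has modulus 1, so moving the linear flow from one
    term to the other preserves the norm.\<close>
  moreover have "cmod (of_int k * (?e k * fourier_coeff (S q t) k - fourier_coeff q k)) =
      cmod (of_int k * fourier_coeff (\<lambda>x. S q t x - v t x) k)" for k
  proof -
    have "fourier_coeff (\<lambda>x. S q t x - v t x) k =
        fourier_coeff (S q t) k - cis ((2 * pi)^3 * of_int k^3 * t) * fourier_coeff q k"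
      by (simp only: fourier_coeff_diff[OF L[OF SL[OF q]] vL] linear_solution_fourier_coeff[OF v q])
    then have "?e k * fourier_coeff (S q t) k - fourier_coeff q k =
        ?e k * fourier_coeff (\<lambda>x. S q t x - v t x) k"
      by (simp add: right_diff_distrib cis_mult flip: mult.assoc)
    then show ?thesis by (simp add: norm_mult)
  qed
  ultimately show ?thesis by (simp add: sqn_def)
qed

theorem corollary1p7:
  fixes S :: "(real \<Rightarrow> real) \<Rightarrow> real \<Rightarrow> real \<Rightarrow> real"
  assumes "kdv_solution_map S"
  shows "\<forall>q\<^sub>0\<in>L20. \<exists>r>0. \<exists>C>0. \<forall>q\<in>L20. l2norm (\<lambda>x. q x - q\<^sub>0 x) < r \<longrightarrow>
           (\<forall>v. linear_solution q v \<longrightarrow>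
             (\<forall>t. (\<lambda>x. S q t x - v t x) \<in> H1_circle \<and>
                  h1norm (\<lambda>x. S q t x - v t x) \<le> C * (1 + \<bar>t\<bar>)))"
proof
  fix q\<^sub>0 assume q0: "q\<^sub>0 \<in> L20"
  \<comment> \<open>With radius 1, \<open>2 * (l2norm q)^2 + 2\<close> is at most
    \<open>2 * (2 + 2 * (l2norm q\<^sub>0)^2) + 2\<close>. The constant depends on
    \<open>q\<^sub>0\<close> alone, which is the local uniformity.\<close>
  define E where "E = 4 * (l2norm q\<^sub>0)\<^sup>2 + 6"
  \<comment> \<open>The first factor compares the weights:
    \<open>1 + (2 * pi * n)^2 \<le> (1 + (2 * pi)^2) * n^2\<close> for
    \<open>n \<noteq> 0\<close>.\<close>
  define W where "W = (1 + (2 * pi)\<^sup>2) * smoothing_const (2 * pi) E"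
  have "0 \<le> E" by (simp add: E_def)
  then have W: "0 \<le> W"
    unfolding W_def smoothing_const_def forcing_const_def l4_const_def
    by (intro mult_nonneg_nonneg add_nonneg_nonneg) auto
  have main: "(\<lambda>x. S q t x - v t x) \<in> H1_circle \<and> h1norm (\<lambda>x. S q t x - v t x) \<le> (sqrt W + 1) * (1 + \<bar>t\<bar>)"
    if q: "q \<in> L20" "l2norm (\<lambda>x. q x - q\<^sub>0 x) < 1" and v: "linear_solution q v" for q v t
  proof -
    let ?f = "\<lambda>x. S q t x - v t x"
    let ?h = "\<lambda>n::int. (1 + (2 * pi * of_int n)\<^sup>2) * (cmod (fourier_coeff ?f n))\<^sup>2"
    have qL: "q \<in> L2_circle" "q\<^sub>0 \<in> L2_circle" using q q0 by (auto simp: L20_def)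
    have "(l2norm (\<lambda>x. q x - q\<^sub>0 x))\<^sup>2 \<le> 1"
      using q(2) by (simp add: power_le_one l2norm_circ Bochner_Integration.integral_nonneg)
    then have E: "2 * (l2norm q)\<^sup>2 + 2 \<le> E"
      using l2norm_square_le[OF qL] unfolding E_def by linarith
    have "\<bar>t\<bar> + 1 > 0" "t \<in> {- (\<bar>t\<bar> + 1)..\<bar>t\<bar> + 1}" by auto
    then have SqL: "S q t \<in> L20"
      using assms q(1) unfolding kdv_solution_map_def by blast
    then have SL: "S q t \<in> L2_circle" by (simp add: L20_def)
    have vL: "v t \<in> L2_circle" using v by (simp add: linear_solution_def)
    have fL: "?f \<in> L2_circle" by (rule L2_circle_diff[OF SL vL])
    \<comment> \<open>Frequency 0 is invisible to \<open>smoothing_L20\<close>, but there the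
      difference vanishes since both functions have mean zero.\<close>
    have f0: "fourier_coeff ?f 0 = 0"
    proof -
      have "fourier_coeff g 0 = 0" if "g \<in> L20" for g
        using that by (simp add: L20_def fourier_coeff_fc fc_def set_integral_circ)
      then show ?thesis
        using SqL q(1) by (simp only: fourier_coeff_diff[OF SL vL] linear_solution_fourier_coeff[OF v q(1)]) simp
    qed
    have bound: "sum ?h K \<le> W * (1 + \<bar>t\<bar>)\<^sup>2" if K: "finite K" for K
    proof -
      have "?h n \<le> (1 + (2 * pi)\<^sup>2) * (cmod (of_int n * fourier_coeff ?f n))\<^sup>2" for n
      proof (cases "n = 0")
        case False
        then have "1 \<le> \<bar>real_of_int n\<bar>" by linarith
        then have "1 \<le> (real_of_int n)\<^sup>2" using one_le_power[of "\<bar>real_of_int n\<bar>" 2] by simp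
        then have "1 + (2 * pi * of_int n)\<^sup>2 \<le> (1 + (2 * pi)\<^sup>2) * (real_of_int n)\<^sup>2"
          by (simp add: power_mult_distrib algebra_simps)
        then have "?h n \<le> (1 + (2 * pi)\<^sup>2) * (real_of_int n)\<^sup>2 * (cmod (fourier_coeff ?f n))\<^sup>2"
          by (intro mult_right_mono) auto
        then show ?thesis by (simp add: norm_mult power_mult_distrib)
      qed (simp add: f0)
      then have "sum ?h K \<le> (\<Sum>n\<in>K. (1 + (2 * pi)\<^sup>2) * (cmod (of_int n * fourier_coeff ?f n))\<^sup>2)"
        by (intro sum_mono)
      also have "\<dots> = (1 + (2 * pi)\<^sup>2) * sqn K (\<lambda>n. of_int n * fourier_coeff ?f n)"
        by (simp add: sqn_def sum_distrib_left)
      also have "\<dots> \<le> (1 + (2 * pi)\<^sup>2) * (smoothing_const (2 * pi) E * (1 + \<bar>t\<bar>)\<^sup>2)"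
        by (intro mult_left_mono smoothing_L20[OF assms q(1) v E K]) simp
      finally show ?thesis by (simp add: W_def mult.assoc)
    qed
    have summable: "?h summable_on UNIV"
      by (rule nonneg_bounded_partial_sums_imp_summable_on[of _ _ "W * (1 + \<bar>t\<bar>)\<^sup>2"])
         (auto simp: eventually_finite_subsets_at_top intro!: bound)
    have "infsum ?h UNIV \<le> W * (1 + \<bar>t\<bar>)\<^sup>2"
      by (rule infsum_le_finite_sums[OF summable bound])
    then have "h1norm ?f \<le> sqrt (W * (1 + \<bar>t\<bar>)\<^sup>2)"
      unfolding h1norm_def by (rule real_sqrt_le_mono)
    also have "\<dots> = sqrt W * (1 + \<bar>t\<bar>)" by (simp add: real_sqrt_mult)
    also have "\<dots> \<le> (sqrt W + 1) * (1 + \<bar>t\<bar>)" by (intro mult_right_mono) auto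
    finally show ?thesis using fL summable by (simp add: H1_circle_def)
  qed
  \<comment> \<open>The added 1 keeps the constant positive even for \<open>W = 0\<close>.\<close>
  have "0 < sqrt W + 1" using W by (simp add: add_nonneg_pos)
  then show "\<exists>r>0. \<exists>C>0. \<forall>q\<in>L20. l2norm (\<lambda>x. q x - q\<^sub>0 x) < r \<longrightarrow>
           (\<forall>v. linear_solution q v \<longrightarrow>
             (\<forall>t. (\<lambda>x. S q t x - v t x) \<in> H1_circle \<and>
                  h1norm (\<lambda>x. S q t x - v t x) \<le> C * (1 + \<bar>t\<bar>)))"
    using main by (intro exI[of _ 1] exI[of _ "sqrt W + 1"]) auto
qed

end
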